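(* Let $n\ge1$, a setpoint $y^*\in\mathbb{R}$, constants $\underline{b}>0$, $\overline{b}>0$, $L>0$, an increasing function $\tau:[0,\infty)\to[0,\infty)$, and $(\beta_1,\dots,\beta_n)\in\mathbb{R}^n$ such that the polynomial $s^n+\beta_1s^{n-1}+\cdots+\beta_n$ is Hurwitz be given (known). Then there exists an open unbounded set $\Omega\subset\mathbb{R}^{n+1}$, depending only on these data, such that the following holds for every system $\dot x=f(x)+g(x)u$, $y=h(x)$ on $\mathbb{R}^n$ satisfying Assumptions (A), (B1) and (C): for any $(k_0,\dots,k_n)\in\Omega$ there exists $\epsilon^*>0$ such that for any $0<\epsilon<\epsilon^*$ and for any initial states $x(0)\in\mathbb{R}^n$, $\hat z(0)\in\mathbb{R}^n$, the solution of the closed-loop system formed with the differential observer-based extended PID controller $$u(t)=k_1e(t)+k_0\int_0^te(s)\,ds+k_2\hat z_2(t)+\cdots+k_n\hat z_n(t),\qquad e(t)=y^*-y(t),$$ $$\dot{\hat z}_i=\hat z_{i+1}+\frac{\beta_i}{\epsilon^i}(e-\hat z_1)\ \ (1\le i\le n-1),\qquad \dot{\hat z}_n=\frac{\beta_n}{\epsilon^n}(e-\hat z_1),$$ exists on $[0,\infty)$ and the regulation error $e(t)$ converges to zero exponentially. Moreover, if Assumption (C) is replaced by Assumption (C'), then there exists an open unbounded set $\Omega\subset\mathbb{R}^{n+1}$, depending only on $n,y^*,\underline{b},\overline{b},L,\tau$ and $(\beta_1,\dots,\beta_n)$, such that for every system $\dot x=f(x)+g(x)u$, $y=h(x)$ on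 $\mathbb{R}^n$ satisfying Assumptions (A), (B1) and (C'), for any $(k_0,\dots,k_n)\in\Omega$ there exists $\epsilon^*>0$ such that for any $0<\epsilon<\epsilon^*$ and for any initial states $x(0)\in\mathbb{R}^n$, $\hat z(0)\in\mathbb{R}^n$, the solution of the closed-loop system formed with the differential observer-based extended PID controller $u(t)=k_1e(t)+k_0\int_0^te(s)\,ds+k_2\hat z_2(t)+\cdots+k_n\hat z_n(t)$, $e(t)=y^*-y(t)$, where $\dot{\hat z}_i=\hat z_{i+1}+\frac{\beta_i}{\epsilon^i}(e-\hat z_1)$ for $1\le i\le n-1$ and $\dot{\hat z}_n=\frac{\beta_n}{\epsilon^n}(e-\hat z_1)$, exists on $[0,\infty)$ and the regulation error $e(t)$ converges to zero exponentially, and in addition there exists $x^*\in\mathbb{R}^n$, depending only on $y^*$ and $\Phi$, such that the state $x(t)$ is bounded and $\lim_{t\to\infty}x(t)=x^*$.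
   Context: $\|\cdot\|$ is the Euclidean norm on vectors and the induced operator norm on matrices. A polynomial is Hurwitz if all its roots have negative real part. The system is the single-input single-output affine nonlinear system $\dot x=f(x)+g(x)u$, $y=h(x)$, where $f,g:\mathbb{R}^n\to\mathbb{R}^n$ are smooth vector fields and $h:\mathbb{R}^n\to\mathbb{R}$ is a smooth function, all unknown. Lie derivatives: $L_f h=\sum_i \frac{\partial h}{\partial x_i}f_i$, $L_f^0h=h$, $L_f^kh=L_f(L_f^{k-1}h)$, $L_gL_f^kh=\sum_i\frac{\partial L_f^kh}{\partial x_i}g_i$. Define $$\Phi(x)=(h(x),L_fh(x),\dots,L_f^{n-1}h(x))^T,\quad F(x)=L_f^nh(x),\quad G(x)=L_gL_f^{n-1}h(x),\quad H(x)=(F(x),G(x)),$$ and $z^*=(y^*,0,\dots,0)^T\in\mathbb{R}^n$, $\Phi^{-1}(z)=\{x\in\mathbb{R}^n:\Phi(x)=z\}$. $J_\Phi(x)$ denotes the Jacobian matrix of $\Phi$ and $J_\Phi^{-1}(x)$ its matrix inverse. Assumption (A): the system has uniform relative degree $n$, i.e. $L_gL_f^ih(x)=0$ for $0\le i\le n-2$ and $G(x)\ne0$ for all $x\in\mathbb{R}^n$; moreover $G(x)\ge\underline{b}>0$ for all $x\in\mathbb{R}^n$. Assumption (B1): (i) $G(x)\le\overline{b}$ and $\|H(x)\|\le\tau(\|\Phi(x)\|)$ for all $x\in\mathbb{R}^n$; (ii) there exists $x^*\in\Phi^{-1}(z^* )$ such that $\|H(x)-H(x^* )\|\le L\|\Phi(x)-\Phi(x^*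 )\|$ for all $x\in\mathbb{R}^n$. Assumption (C): there are constants $N_1>0$, $N_2>0$ (possibly unknown) such that $\|J_\Phi^{-1}(x)\|\le N_1\|x\|\log\|x\|+N_2$ for all $x\in\mathbb{R}^n$ (with $0\log 0=0$). Assumption (C'): $\Phi$ is a global diffeomorphism of $\mathbb{R}^n$, i.e. a bijection with $\Phi$ and its inverse continuously differentiable. The closed loop is the autonomous system in $(x_0,x,\hat z)\in\mathbb{R}^{2n+1}$ with $\dot x_0=y^*-h(x)$, $x_0(0)=0$, $u=k_0x_0+k_1(y^*-h(x))+\sum_{j=2}^nk_j\hat z_j$ and $e=y^*-h(x)$. "$e(t)$ converges to zero exponentially" means there are $C,\alpha>0$ with $|e(t)|\le Ce^{-\alpha t}$ for all $t\ge0$. *)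

theory Defs
  imports "HOL-Analysis.Analysis" "HOL-Computational_Algebra.Polynomial"
begin

text \<open>
  Vectors of \<open>\<real>\<^sup>n\<close> live in \<^typ>\<open>real ^ 'n\<close> with \<open>n = CARD('n)\<close>. Several objects below refer to
  the position of a component, so one numbering of the index type by \<open>1, \<dots>, n\<close> is fixed.
  The notation \<open>v $# i\<close> is meaningful for \<open>1 \<le> i \<le> n\<close> only.
\<close>

definition pos :: "'n::finite \<Rightarrow> nat" where
  "pos = (SOME p. bij_betw p UNIV {1..CARD('n)})"

definition nth_comp :: "real ^ 'n \<Rightarrow> nat \<Rightarrow> real"  (infixl "$#" 90) where
  "v $# i = v $ inv pos i"

definition tuple :: "(nat \<Rightarrow> real) \<Rightarrow> real ^ 'n" where
  "tuple c = (\<chi> j. c (pos j))"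

lemma bij_betw_pos: "bij_betw (pos :: 'n::finite \<Rightarrow> nat) UNIV {1..CARD('n)}"
proof -
  have "\<exists>p. bij_betw p (UNIV :: 'n set) {1..CARD('n)}"
    by (intro finite_same_card_bij) auto
  then show ?thesis
    unfolding pos_def by (rule someI_ex)
qed

lemma tuple_nth_comp:
  assumes "1 \<le> i" "i \<le> CARD('n)"
  shows "(tuple c :: real ^ 'n::finite) $# i = c i"
proof -
  have "pos (inv (pos :: 'n \<Rightarrow> nat) i) = i"
    using assms bij_betw_pos[where 'n = 'n] by (intro f_inv_into_f) (auto simp: bij_betw_def)
  then show ?thesis
    by (simp add: nth_comp_def tuple_def)
qed

lemma tuple_eta: "tuple (\<lambda>i. v $# i) = v"
  using bij_betw_pos[where 'n = 'a]
  by (simp add: vec_eq_iff nth_comp_def tuple_def bij_betw_def)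

text \<open>On a finite-dimensional domain, \<open>C_k k f\<close> says that \<open>f\<close> is of class \<open>C\<^sup>k\<close>.\<close>

primrec C_k :: "nat \<Rightarrow> ('a::real_normed_vector \<Rightarrow> 'b::real_normed_vector) \<Rightarrow> bool" where
  "C_k 0 f \<longleftrightarrow> continuous_on UNIV f"
| "C_k (Suc k) f \<longleftrightarrow>
     (\<forall>x. f differentiable (at x)) \<and> (\<forall>v. C_k k (\<lambda>x. frechet_derivative f (at x) v))"

definition smooth :: "('a::real_normed_vector \<Rightarrow> 'b::real_normed_vector) \<Rightarrow> bool" where
  "smooth f \<longleftrightarrow> (\<forall>k. C_k k f)"

definition partial_deriv :: "'n \<Rightarrow> (real ^ 'n \<Rightarrow> real) \<Rightarrow> real ^ 'n \<Rightarrow> real" where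
  "partial_deriv i h x = frechet_derivative h (at x) (axis i 1)"

definition lie :: "(real ^ 'n \<Rightarrow> real ^ 'n) \<Rightarrow> (real ^ 'n \<Rightarrow> real) \<Rightarrow> real ^ 'n \<Rightarrow> real" where
  "lie f h x = (\<Sum>i\<in>UNIV. partial_deriv i h x * f x $ i)"

definition Phi :: "(real ^ 'n \<Rightarrow> real ^ 'n) \<Rightarrow> (real ^ 'n \<Rightarrow> real) \<Rightarrow> real ^ 'n \<Rightarrow> real ^ 'n" where
  "Phi f h x = tuple (\<lambda>i. (lie f ^^ (i - 1)) h x)"

definition F_fun :: "(real ^ 'n \<Rightarrow> real ^ 'n) \<Rightarrow> (real ^ 'n \<Rightarrow> real) \<Rightarrow> real ^ 'n \<Rightarrow> real" where
  "F_fun f h = (lie f ^^ CARD('n)) h"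

definition G_fun ::
  "(real ^ 'n \<Rightarrow> real ^ 'n) \<Rightarrow> (real ^ 'n \<Rightarrow> real ^ 'n) \<Rightarrow> (real ^ 'n \<Rightarrow> real) \<Rightarrow> real ^ 'n \<Rightarrow> real"
  where "G_fun f g h = lie g ((lie f ^^ (CARD('n) - 1)) h)"

definition H_fun ::
  "(real ^ 'n \<Rightarrow> real ^ 'n) \<Rightarrow> (real ^ 'n \<Rightarrow> real ^ 'n) \<Rightarrow> (real ^ 'n \<Rightarrow> real) \<Rightarrow> real ^ 'n \<Rightarrow> (real \<times> real)"
  where "H_fun f g h x = (F_fun f h x, G_fun f g h x)"

definition z_star :: "real \<Rightarrow> real ^ 'n" where
  "z_star y = tuple (\<lambda>i. if i = 1 then y else 0)"

definition smooth_system ::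
  "(real ^ 'n \<Rightarrow> real ^ 'n) \<Rightarrow> (real ^ 'n \<Rightarrow> real ^ 'n) \<Rightarrow> (real ^ 'n \<Rightarrow> real) \<Rightarrow> bool" where
  "smooth_system f g h \<longleftrightarrow> smooth f \<and> smooth g \<and> smooth h"

definition uniform_relative_degree ::
  "(real ^ 'n \<Rightarrow> real ^ 'n) \<Rightarrow> (real ^ 'n \<Rightarrow> real ^ 'n) \<Rightarrow> (real ^ 'n \<Rightarrow> real) \<Rightarrow> bool" where
  "uniform_relative_degree f g h \<longleftrightarrow>
     (\<forall>x. (\<forall>i. i + 2 \<le> CARD('n) \<longrightarrow> lie g ((lie f ^^ i) h) x = 0) \<and> G_fun f g h x \<noteq> 0)"

definition assumption_A ::
  "real \<Rightarrow> (real ^ 'n \<Rightarrow> real ^ 'n) \<Rightarrow> (real ^ 'n \<Rightarrow> real ^ 'n) \<Rightarrow> (real ^ 'n \<Rightarrow> real) \<Rightarrow> bool" where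
  "assumption_A b_lo f g h \<longleftrightarrow>
     uniform_relative_degree f g h \<and> (\<forall>x. b_lo \<le> G_fun f g h x)"

definition assumption_B1 ::
  "real \<Rightarrow> real \<Rightarrow> real \<Rightarrow> (real \<Rightarrow> real) \<Rightarrow>
   (real ^ 'n \<Rightarrow> real ^ 'n) \<Rightarrow> (real ^ 'n \<Rightarrow> real ^ 'n) \<Rightarrow> (real ^ 'n \<Rightarrow> real) \<Rightarrow> bool" where
  "assumption_B1 y b_hi L \<tau> f g h \<longleftrightarrow>
     (\<forall>x. G_fun f g h x \<le> b_hi \<and> norm (H_fun f g h x) \<le> \<tau> (norm (Phi f h x))) \<and>
     (\<exists>xs \<in> Phi f h -` {z_star y}.
        \<forall>x. norm (H_fun f g h x - H_fun f g h xs) \<le> L * norm (Phi f h x - Phi f h xs))"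

text \<open>
  The matrix inverse below is the true inverse for the systems considered: uniform relative
  degree \<open>n\<close> makes the Jacobian of \<^term>\<open>Phi f h\<close> invertible everywhere.
  The convention \<open>0 log 0 = 0\<close> holds for \<^const>\<open>ln\<close>.
\<close>

definition assumption_C ::
  "(real ^ 'n \<Rightarrow> real ^ 'n) \<Rightarrow> (real ^ 'n \<Rightarrow> real) \<Rightarrow> bool" where
  "assumption_C f h \<longleftrightarrow>
     (\<exists>N1>0. \<exists>N2>0. \<forall>x.
        onorm ((*v) (matrix_inv (jacobian (Phi f h) (at x)))) \<le> N1 * norm x * ln (norm x) + N2)"

definition assumption_C' ::
  "(real ^ 'n \<Rightarrow> real ^ 'n) \<Rightarrow> (real ^ 'n \<Rightarrow> real) \<Rightarrow> bool" where
  "assumption_C' f h \<longleftrightarrow> bij (Phi f h) \<and> C_k 1 (Phi f h) \<and> C_k 1 (inv (Phi f h))"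

definition Hurwitz :: "real poly \<Rightarrow> bool" where
  "Hurwitz p \<longleftrightarrow> (\<forall>s::complex. poly (map_poly complex_of_real p) s = 0 \<longrightarrow> Re s < 0)"

definition observer_poly :: "real ^ 'n \<Rightarrow> real poly" where
  "observer_poly \<beta> =
     monom 1 CARD('n) + (\<Sum>i=1..CARD('n). monom (\<beta> $# i) (CARD('n) - i))"

text \<open>Only the values of \<open>\<tau>\<close> on \<open>[0, \<infinity>)\<close> matter; increasing is understood in the weak sense.\<close>

definition admissible_data ::
  "real \<Rightarrow> real \<Rightarrow> real \<Rightarrow> (real \<Rightarrow> real) \<Rightarrow> real ^ 'n \<Rightarrow> bool" where
  "admissible_data b_lo b_hi L \<tau> \<beta> \<longleftrightarrow>
     b_lo > 0 \<and> b_hi > 0 \<and> L > 0 \<and>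
     (\<forall>r\<ge>0. \<tau> r \<ge> 0) \<and> mono_on {0..} \<tau> \<and>
     Hurwitz (observer_poly \<beta>)"

text \<open>
  The gains \<open>(k\<^sub>0, k\<^sub>1, \<dots>, k\<^sub>n)\<close> are given as a pair of \<open>k0\<close> and the vector \<open>k\<close> of the
  remaining ones, so that \<open>\<real>\<^sup>n\<^sup>+\<^sup>1\<close> is \<^typ>\<open>real \<times> (real ^ 'n)\<close>.
\<close>

definition pid_input :: "real \<Rightarrow> real ^ 'n \<Rightarrow> real \<Rightarrow> real \<Rightarrow> real ^ 'n \<Rightarrow> real" where
  "pid_input k0 k e x0 z = k $# 1 * e + k0 * x0 + (\<Sum>j=2..CARD('n). k $# j * z $# j)"

definition observer_rhs :: "real ^ 'n \<Rightarrow> real \<Rightarrow> real \<Rightarrow> real ^ 'n \<Rightarrow> real ^ 'n" where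
  "observer_rhs \<beta> \<epsilon> e z =
     tuple (\<lambda>i. (if i < CARD('n) then z $# (i + 1) else 0) + \<beta> $# i / \<epsilon> ^ i * (e - z $# 1))"

text \<open>
  Solutions on \<open>[0, \<infinity>)\<close> of the autonomous system in \<open>(x\<^sub>0, x, z)\<close>, where \<open>x\<^sub>0\<close> is the integral
  of the regulation error, starting at \<open>(0, a, b)\<close>. The derivative at time 0 is one-sided.
\<close>

definition closed_loop_solution ::
  "(real ^ 'n \<Rightarrow> real ^ 'n) \<Rightarrow> (real ^ 'n \<Rightarrow> real ^ 'n) \<Rightarrow> (real ^ 'n \<Rightarrow> real) \<Rightarrow> real \<Rightarrow>
   real ^ 'n \<Rightarrow> real \<Rightarrow> real ^ 'n \<Rightarrow> real \<Rightarrow> real ^ 'n \<Rightarrow> real ^ 'n \<Rightarrow>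
   (real \<Rightarrow> real) \<Rightarrow> (real \<Rightarrow> real ^ 'n) \<Rightarrow> (real \<Rightarrow> real ^ 'n) \<Rightarrow> bool" where
  "closed_loop_solution f g h y \<beta> k0 k \<epsilon> a b x0 x z \<longleftrightarrow>
     x0 0 = 0 \<and> x 0 = a \<and> z 0 = b \<and>
     (\<forall>t\<ge>0. let e = y - h (x t) in
        (x0 has_real_derivative e) (at t within {0..}) \<and>
        (x has_vector_derivative f (x t) + pid_input k0 k e (x0 t) (z t) *\<^sub>R g (x t))
          (at t within {0..}) \<and>
        (z has_vector_derivative observer_rhs \<beta> \<epsilon> e (z t)) (at t within {0..}))"

definition converges_to_zero_exponentially :: "(real \<Rightarrow> real) \<Rightarrow> bool" where
  "converges_to_zero_exponentially e \<longleftrightarrow>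
     (\<exists>C>0. \<exists>\<alpha>>0. \<forall>t\<ge>0. \<bar>e t\<bar> \<le> C * exp (- \<alpha> * t))"

end

theory Submission
  imports Defs "HOL-Computational_Algebra.Fundamental_Theorem_Algebra"
begin

text \<open>
Write \<open>E = z\<^sup>* - \<Phi>(x)\<close> for the regulation error and its derivatives. Uniform relative degree \<open>n\<close> turns
the plant into a chain of integrators: \<open>E\<^sub>i' = E\<^sub>i\<^sub>+\<^sub>1\<close> for \<open>i < n\<close> and \<open>E\<^sub>n' = - (F(x) + G(x) u)\<close>. Integral
action shifts the origin: with \<open>u\<^sup>* = - F(x\<^sup>*) / G(x\<^sup>*)\<close>, the input that holds the equilibrium, and
\<open>W = (x\<^sub>0 - u\<^sup>* / k\<^sub>0, E)\<close>, the last equation becomes \<open>E\<^sub>n' = - \<Delta> - \<theta> (K \<bullet> W)\<close> plus the effect of the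
estimation errors, where \<open>\<theta> = G(x)\<close> lies between the two known bounds and the Lipschitz condition
gives \<open>\<bar>\<Delta>\<bar> \<le> \<Lambda> \<bar>W\<bar>\<close> for a constant \<open>\<Lambda>\<close> computed from the data, since \<open>\<tau>\<close> and the lower bound on \<open>G\<close>
bound \<open>u\<^sup>*\<close>.

The gain set consists of all \<open>K\<close> for which one fixed quadratic form \<open>V(W)\<close> decreases at a uniform
rate for every admissible \<open>\<theta>\<close> and \<open>\<Delta>\<close> (\<open>stabilizing_gains\<close>). A strict inequality of this kind
survives small changes of \<open>K\<close>, so the set is open. The form \<open>V\<close> is the sum of squares of the filtered
variables \<open>\<sigma>\<^sub>i = (d/dt + 2)\<^sup>i W\<^sub>0\<close>, which satisfy \<open>\<sigma>\<^sub>i' = - 2 \<sigma>\<^sub>i + \<sigma>\<^sub>i\<^sub>+\<^sub>1\<close>; feeding back \<open>\<kappa> \<sigma>\<^sub>n\<close> with any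
large \<open>\<kappa>\<close> dominates all the cross terms, so the set is unbounded.

The estimation error, rescaled by powers of \<open>\<epsilon>\<close>, obeys \<open>\<eta>' = M \<eta> / \<epsilon> + E\<^sub>n' e\<^sub>n\<close>, where the observer
polynomial annihilates \<open>M\<close>. Such an \<open>M\<close> has a quadratic Lyapunov form \<open>B\<close>
(\<open>lyapunov_form_of_annihilating_poly\<close>). For small \<open>\<epsilon>\<close> the decrease of \<open>B\<close> absorbs the coupling, and
\<open>V(W) + B(\<eta>, \<eta>)\<close> decays exponentially (\<open>observer_loop_decay\<close>). The threshold for \<open>\<epsilon>\<close> and the rate
depend neither on the initial state nor on the length of the time interval.

It remains to return to the original coordinates, where solutions might escape in finite time. Along
any solution \<open>\<Phi>(x)\<close> is bounded and its velocity is bounded by a decaying exponential. If the inverse of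
\<open>\<Phi>\<close> is continuous, this keeps \<open>x\<close> in a compact set and makes it converge to \<open>\<Phi>\<^sup>-\<^sup>1(z\<^sup>*)\<close>. If
instead the inverse Jacobian grows at most like \<open>\<bar>x\<bar> log \<bar>x\<bar>\<close>, then
\<open>log log \<bar>x\<bar>\<close> has an integrable growth rate and \<open>x\<close> stays bounded as well; recovering the velocity of \<open>x\<close>
from that of \<open>\<Phi>(x)\<close> requires an invertible Jacobian, which follows from the relative degree by evaluating the
differentials of \<open>L\<^sub>f\<^sup>i h\<close> on iterated Lie brackets of \<open>f\<close> and \<open>g\<close> (\<open>jacobian_Phi_invertible\<close>). An a
priori bound of this kind gives a global solution, by truncating the vector field outside a large
ball and applying the Picard-Lindeloef theorem (\<open>global_solution_of_bounded\<close>).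
\<close>

section \<open>Smooth functions, Lie derivatives and brackets\<close>

text \<open>
The definition of \<^const>\<open>C_k\<close> speaks of \<^const>\<open>frechet_derivative\<close>; this form accepts whatever expression
the differentiation rules produce.
\<close>

lemma C_k_SucI:
  assumes "\<And>x. (f has_derivative f' x) (at x)" "\<And>v. C_k k (\<lambda>x. f' x v)"
  shows "C_k (Suc k) f"
proof -
  have "frechet_derivative f (at x) = f' x" for x
    using frechet_derivative_at[OF assms(1)] by simp
  then show ?thesis
    using assms by (auto simp: differentiable_def)
qed

lemma C_k_SucD:
  assumes "C_k (Suc k) f"
  shows "(f has_derivative frechet_derivative f (at x)) (at x)"
    "C_k k (\<lambda>x. frechet_derivative f (at x) v)"
  using assms by (auto simp: frechet_derivative_works)

lemma C_k_pred: "C_k (Suc k) f \<Longrightarrow> C_k k f"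
proof (induction k arbitrary: f)
  case 0
  then show ?case
    by (auto intro!: differentiable_imp_continuous_on simp: differentiable_on_def)
next
  case (Suc k)
  then show ?case by (metis C_k.simps(2))
qed

lemma C_k_const: "C_k k (\<lambda>x. c)"
proof (induction k arbitrary: c)
  case (Suc k)
  show ?case by (rule C_k_SucI[where f' = "\<lambda>x v. 0"]) (auto intro: Suc)
qed auto

lemma C_k_add: "C_k k f \<Longrightarrow> C_k k g \<Longrightarrow> C_k k (\<lambda>x. f x + g x)"
proof (induction k arbitrary: f g)
  case (Suc k)
  show ?case
    by (rule C_k_SucI, rule has_derivative_add)
       (use Suc.prems in \<open>auto intro!: C_k_SucD Suc.IH\<close>)
qed (auto intro: continuous_intros)

lemma C_k_sum: "finite A \<Longrightarrow> (\<And>i. i \<in> A \<Longrightarrow> C_k k (f i)) \<Longrightarrow> C_k k (\<lambda>x. \<Sum>i\<in>A. f i x)"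
  by (induction A rule: finite_induct) (auto intro: C_k_const C_k_add)

lemma C_k_bounded_linear:
  assumes "bounded_linear l" shows "C_k k f \<Longrightarrow> C_k k (\<lambda>x. l (f x))"
proof (induction k arbitrary: f)
  case 0
  then show ?case using assms
    by (auto intro: continuous_on_compose2[OF bounded_linear.continuous_on[OF assms continuous_on_id]])
next
  case (Suc k)
  show ?case
    by (rule C_k_SucI, rule bounded_linear.has_derivative[OF assms])
       (use Suc.prems in \<open>auto intro!: C_k_SucD Suc.IH\<close>)
qed

lemma C_k_bounded_bilinear:
  assumes "bounded_bilinear B" shows "C_k k f \<Longrightarrow> C_k k g \<Longrightarrow> C_k k (\<lambda>x. B (f x) (g x))"
proof (induction k arbitrary: f g)
  case 0
  then show ?case using assms
    by (auto intro: bounded_bilinear.continuous_on)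
next
  case (Suc k)
  show ?case
    by (rule C_k_SucI, rule bounded_bilinear.FDERIV[OF assms,
          OF C_k_SucD(1)[OF Suc.prems(1)] C_k_SucD(1)[OF Suc.prems(2)]])
       (intro C_k_add Suc.IH C_k_pred[OF Suc.prems(1)] C_k_pred[OF Suc.prems(2)]
          C_k_SucD(2)[OF Suc.prems(1)] C_k_SucD(2)[OF Suc.prems(2)])
qed

text \<open>
The directional derivative along a vector field, for functions with values in any normed space.
It agrees with \<^const>\<open>lie\<close> on scalar functions, and on vector fields it supplies the two halves of the
Lie bracket.
\<close>

definition along :: "(real ^ 'n \<Rightarrow> real ^ 'n) \<Rightarrow> (real ^ 'n \<Rightarrow> 'b::real_normed_vector) \<Rightarrow> real ^ 'n \<Rightarrow> 'b" where
  "along f \<phi> x = frechet_derivative \<phi> (at x) (f x)"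

lemma linear_expand_axis:
  assumes "linear l" shows "l v = (\<Sum>i\<in>UNIV. v $ i *\<^sub>R l (axis i 1))"
proof -
  have "l v = l (\<Sum>i\<in>UNIV. v $ i *\<^sub>R axis i 1)"
    by (simp only: basis_expansion flip: scalar_mult_eq_scaleR)
  then show ?thesis
    by (simp add: linear_sum[OF assms] linear_scale[OF assms])
qed

lemma smooth_differentiable: "smooth f \<Longrightarrow> (f has_derivative frechet_derivative f (at x)) (at x)"
  unfolding smooth_def using C_k_SucD(1) by blast

lemma smooth_frechet: "smooth f \<Longrightarrow> smooth (\<lambda>x. frechet_derivative f (at x) v)"
  unfolding smooth_def using C_k_SucD(2) by blast

lemma along_expand:
  assumes "smooth \<phi>"
  shows "along f \<phi> x = (\<Sum>i\<in>UNIV. f x $ i *\<^sub>R frechet_derivative \<phi> (at x) (axis i 1))"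
  unfolding along_def
  by (rule linear_expand_axis) (rule has_derivative_linear[OF smooth_differentiable[OF assms]])

text \<open>
The argument \<open>f x\<close> of the derivative varies with the point, whereas smoothness of \<open>\<phi>\<close> only speaks of
derivatives in fixed directions; expanding \<open>f x\<close> in the standard basis reduces the one to the other.
\<close>

lemma smooth_along: assumes "smooth f" "smooth \<phi>" shows "smooth (along f \<phi>)"
proof -
  have "along f \<phi> = (\<lambda>x. \<Sum>i\<in>UNIV. f x $ i *\<^sub>R frechet_derivative \<phi> (at x) (axis i 1))"
    using along_expand[OF assms(2)] by auto
  moreover have "C_k k (\<lambda>x. f x $ i *\<^sub>R frechet_derivative \<phi> (at x) (axis i 1))" for k i
    using assms smooth_frechet[OF assms(2)] unfolding smooth_def
    by (intro C_k_bounded_bilinear[OF bounded_bilinear_scaleR] C_k_bounded_linear[OF bounded_linear_vec_nth]) auto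
  ultimately show ?thesis
    unfolding smooth_def by (auto intro: C_k_sum)
qed

lemma lie_eq_along: "smooth \<phi> \<Longrightarrow> lie f \<phi> = along f \<phi>"
  by (auto simp: fun_eq_iff along_expand lie_def partial_deriv_def mult.commute)

lemma smooth_lie: "smooth f \<Longrightarrow> smooth \<phi> \<Longrightarrow> smooth (lie f \<phi>)"
  by (simp add: lie_eq_along smooth_along)

lemma smooth_lie_pow: "smooth f \<Longrightarrow> smooth \<phi> \<Longrightarrow> smooth ((lie f ^^ i) \<phi>)"
  by (induction i) (auto intro: smooth_lie)

text \<open>
Two applications of the mean value theorem, first along \<open>u\<close> and then along \<open>v\<close>. The left-hand side is
symmetric in \<open>u\<close> and \<open>v\<close> while the right-hand side fixes an order of differentiation.
\<close>

lemma second_difference: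
  fixes \<phi> :: "'a::real_normed_vector \<Rightarrow> real"
  assumes "C_k 2 \<phi>" "0 < h"
  shows "\<exists>s\<in>{0<..<h}. \<exists>t\<in>{0<..<h}. \<phi> (x + h *\<^sub>R u + h *\<^sub>R v) - \<phi> (x + h *\<^sub>R u) - \<phi> (x + h *\<^sub>R v) + \<phi> x =
    h\<^sup>2 * frechet_derivative (\<lambda>x. frechet_derivative \<phi> (at x) u) (at (x + s *\<^sub>R u + t *\<^sub>R v)) v"
proof -
  have C: "C_k (Suc (Suc 0)) \<phi>" using assms by (simp add: numeral_2_eq_2)
  define D where "D = (\<lambda>x. frechet_derivative \<phi> (at x) u)"
  have d1: "(\<phi> has_derivative frechet_derivative \<phi> (at x)) (at x)" for x
    using C by (rule C_k_SucD)
  have d2: "(D has_derivative frechet_derivative D (at x)) (at x)" for x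
    unfolding D_def using C_k_SucD(2)[OF C] by (rule C_k_SucD)
  define g where "g = (\<lambda>s. \<phi> (x + s *\<^sub>R u + h *\<^sub>R v) - \<phi> (x + s *\<^sub>R u))"
  have "DERIV g s :> D (x + s *\<^sub>R u + h *\<^sub>R v) - D (x + s *\<^sub>R u)" for s
  proof -
    have *: "((\<lambda>s. \<phi> (c + s *\<^sub>R u)) has_real_derivative D (c + s *\<^sub>R u)) (at s)" for c s
    proof -
      have "((\<lambda>s. \<phi> (c + s *\<^sub>R u)) has_derivative (\<lambda>r. frechet_derivative \<phi> (at (c + s *\<^sub>R u)) (r *\<^sub>R u))) (at s)"
        by (rule has_derivative_compose[OF _ d1]) (auto intro!: derivative_eq_intros)
      then show ?thesis
        unfolding has_field_derivative_def D_def
        by (simp add: linear_scale[OF has_derivative_linear[OF d1]] mult_commute_abs)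
    qed
    show ?thesis unfolding g_def
      using DERIV_diff[OF *[of "x + h *\<^sub>R v" s] *[of x s]] by (simp add: algebra_simps)
  qed
  from MVT2[OF assms(2) this] obtain s where s: "0 < s" "s < h"
    and gs: "g h - g 0 = h * (D (x + s *\<^sub>R u + h *\<^sub>R v) - D (x + s *\<^sub>R u))" by auto
  have *: "((\<lambda>t. D (c + t *\<^sub>R v)) has_real_derivative frechet_derivative D (at (c + t *\<^sub>R v)) v) (at t)" for c t
  proof -
    have "((\<lambda>t. D (c + t *\<^sub>R v)) has_derivative (\<lambda>r. frechet_derivative D (at (c + t *\<^sub>R v)) (r *\<^sub>R v))) (at t)"
      by (rule has_derivative_compose[OF _ d2]) (auto intro!: derivative_eq_intros)
    then show ?thesis
      unfolding has_field_derivative_def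
      by (simp add: linear_scale[OF has_derivative_linear[OF d2]] mult_commute_abs)
  qed
  from MVT2[OF assms(2) *[of "x + s *\<^sub>R u"]] obtain t where t: "0 < t" "t < h"
    and "D (x + s *\<^sub>R u + h *\<^sub>R v) - D (x + s *\<^sub>R u) = h * frechet_derivative D (at (x + s *\<^sub>R u + t *\<^sub>R v)) v" by auto
  then have "g h - g 0 = h\<^sup>2 * frechet_derivative D (at (x + s *\<^sub>R u + t *\<^sub>R v)) v"
    using gs by (simp add: power2_eq_square)
  moreover have "g h - g 0 = \<phi> (x + h *\<^sub>R u + h *\<^sub>R v) - \<phi> (x + h *\<^sub>R u) - \<phi> (x + h *\<^sub>R v) + \<phi> x"
    by (simp add: g_def)
  ultimately show ?thesis using s t unfolding D_def by (metis greaterThanLessThan_iff)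
qed

text \<open>
Both mixed derivatives are limits of the same second difference divided by \<open>h\<^sup>2\<close>.
\<close>

lemma second_derivative_symmetric:
  fixes \<phi> :: "'a::real_normed_vector \<Rightarrow> real"
  assumes C: "C_k 2 \<phi>"
  shows "frechet_derivative (\<lambda>x. frechet_derivative \<phi> (at x) u) (at x) v =
         frechet_derivative (\<lambda>x. frechet_derivative \<phi> (at x) v) (at x) u"
proof -
  define D where "D u v x = frechet_derivative (\<lambda>x. frechet_derivative \<phi> (at x) u) (at x) v" for u v x
  have C': "C_k (Suc (Suc 0)) \<phi>" using assms by (simp add: numeral_2_eq_2)
  have cont: "isCont (D u v) x" for u v x
    using C_k_SucD(2)[OF C_k_SucD(2)[OF C'], of u v]
    by (simp add: D_def[abs_def] continuous_on_eq_continuous_at)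
  have "\<bar>D u v x - D v u x\<bar> \<le> e + e" if "e > 0" for e
  proof -
    obtain d1 where d1: "d1 > 0" "\<And>y. dist y x < d1 \<Longrightarrow> dist (D u v y) (D u v x) < e"
      using cont[where u = u and v = v and x = x, unfolded continuous_at_eps_delta, rule_format, OF \<open>e > 0\<close>] by auto
    obtain d2 where d2: "d2 > 0" "\<And>y. dist y x < d2 \<Longrightarrow> dist (D v u y) (D v u x) < e"
      using cont[where u = v and v = u and x = x, unfolded continuous_at_eps_delta, rule_format, OF \<open>e > 0\<close>] by auto
    \<comment> \<open>Small enough for every intermediate point to lie within \<open>min d1 d2\<close> of \<open>x\<close>.\<close>
    define h where "h = min d1 d2 / (norm u + norm v + 1)"
    have pos: "norm u + norm v + 1 > 0" by (smt (verit) norm_ge_zero)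
    have h: "h > 0" "h * (norm u + norm v + 1) = min d1 d2"
      using d1(1) d2(1) pos by (auto simp: h_def)
    have close: "dist (x + s *\<^sub>R a + t *\<^sub>R b) x < min d1 d2"
      if "s \<in> {0<..<h}" "t \<in> {0<..<h}" "a = u \<and> b = v \<or> a = v \<and> b = u" for s t a b
    proof -
      have "dist (x + s *\<^sub>R a + t *\<^sub>R b) x \<le> s * norm a + t * norm b"
        using that norm_triangle_ineq[of "s *\<^sub>R a" "t *\<^sub>R b"] by (simp add: dist_norm)
      also have "\<dots> \<le> h * norm a + h * norm b"
        using that by (intro add_mono mult_right_mono) auto
      also have "\<dots> < min d1 d2"
        using that(3) h by (auto simp flip: h(2) simp: algebra_simps)
      finally show ?thesis .
    qed
    obtain s t where 1: "s \<in> {0<..<h}" "t \<in> {0<..<h}"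
      "\<phi> (x + h *\<^sub>R u + h *\<^sub>R v) - \<phi> (x + h *\<^sub>R u) - \<phi> (x + h *\<^sub>R v) + \<phi> x = h\<^sup>2 * D u v (x + s *\<^sub>R u + t *\<^sub>R v)"
      using second_difference[OF C h(1)] unfolding D_def by blast
    obtain s' t' where 2: "s' \<in> {0<..<h}" "t' \<in> {0<..<h}"
      "\<phi> (x + h *\<^sub>R v + h *\<^sub>R u) - \<phi> (x + h *\<^sub>R v) - \<phi> (x + h *\<^sub>R u) + \<phi> x = h\<^sup>2 * D v u (x + s' *\<^sub>R v + t' *\<^sub>R u)"
      using second_difference[OF C h(1)] unfolding D_def by blast
    have "x + h *\<^sub>R v + h *\<^sub>R u = x + h *\<^sub>R u + h *\<^sub>R v" by simp
    then have "h\<^sup>2 * D u v (x + s *\<^sub>R u + t *\<^sub>R v) = h\<^sup>2 * D v u (x + s' *\<^sub>R v + t' *\<^sub>R u)"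
      using 1(3) 2(3) by (smt (verit))
    then have "D u v (x + s *\<^sub>R u + t *\<^sub>R v) = D v u (x + s' *\<^sub>R v + t' *\<^sub>R u)"
      using h(1) by simp
    then show ?thesis
      using d1(2)[of "x + s *\<^sub>R u + t *\<^sub>R v"] d2(2)[of "x + s' *\<^sub>R v + t' *\<^sub>R u"]
        close[OF 1(1,2)] close[OF 2(1,2)]
      unfolding dist_real_def by (smt (verit))
  qed
  then have "\<bar>D u v x - D v u x\<bar> \<le> e" if "e > 0" for e
    by (metis field_sum_of_halves half_gt_zero that)
  then have "\<bar>D u v x - D v u x\<bar> \<le> 0" by (rule field_le_epsilon[of _ 0, simplified])
  then show ?thesis by (simp add: D_def)
qed

definition bracket :: "(real ^ 'n \<Rightarrow> real ^ 'n) \<Rightarrow> (real ^ 'n \<Rightarrow> real ^ 'n) \<Rightarrow> real ^ 'n \<Rightarrow> real ^ 'n" where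
  "bracket f g x = along f g x - along g f x"

lemma smooth_diff: "smooth f \<Longrightarrow> smooth g \<Longrightarrow> smooth (\<lambda>x. f x - g x)"
  unfolding smooth_def using C_k_add[OF _ C_k_bounded_linear[OF bounded_linear_minus[OF bounded_linear_ident]], of _ f g]
  by simp

lemma smooth_bracket: "smooth f \<Longrightarrow> smooth g \<Longrightarrow> smooth (bracket f g)"
  unfolding bracket_def[abs_def] by (intro smooth_diff smooth_along)

lemma smooth_imp_C_k: "smooth f \<Longrightarrow> C_k k f" by (simp add: smooth_def)

text \<open>
Product rule for \<open>x \<mapsto> D\<phi>(x)(g(x))\<close>. Symmetry of the second derivative lets the direction \<open>w\<close> be frozen
inside and \<open>g x\<close> be moved outside, so that the second-order terms cancel in the bracket identity below.
\<close>

lemma frechet_along: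
  assumes g: "smooth g" and \<phi>: "smooth (\<phi> :: real ^ 'n \<Rightarrow> real)"
  shows "frechet_derivative (along g \<phi>) (at x) w =
    frechet_derivative (\<lambda>y. frechet_derivative \<phi> (at y) w) (at x) (g x) +
    frechet_derivative \<phi> (at x) (frechet_derivative g (at x) w)"
proof -
  let ?D = "\<lambda>v y. frechet_derivative \<phi> (at y) v"
  have lin: "linear (frechet_derivative \<phi> (at x))" for x
    by (rule has_derivative_linear[OF smooth_differentiable[OF \<phi>]])
  have sD: "smooth (?D v)" for v by (rule smooth_frechet[OF \<phi>])
  have lin2: "linear (frechet_derivative (?D v) (at x))" for v x
    by (rule has_derivative_linear[OF smooth_differentiable[OF sD]])
  have eq: "along g \<phi> = (\<lambda>x. \<Sum>i\<in>UNIV. g x $ i *\<^sub>R ?D (axis i 1) x)"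
    using along_expand[OF \<phi>] by auto
  have "((\<lambda>x. \<Sum>i\<in>UNIV. g x $ i *\<^sub>R ?D (axis i 1) x) has_derivative
    (\<lambda>w. \<Sum>i\<in>UNIV. g x $ i *\<^sub>R frechet_derivative (?D (axis i 1)) (at x) w + frechet_derivative g (at x) w $ i *\<^sub>R ?D (axis i 1) x)) (at x)"
    by (intro has_derivative_sum has_derivative_scaleR smooth_differentiable[OF sD]
        bounded_linear.has_derivative[OF bounded_linear_vec_nth] smooth_differentiable[OF g])
  then have "frechet_derivative (along g \<phi>) (at x) w = 
    (\<Sum>i\<in>UNIV. g x $ i *\<^sub>R frechet_derivative (?D (axis i 1)) (at x) w) + (\<Sum>i\<in>UNIV. frechet_derivative g (at x) w $ i *\<^sub>R ?D (axis i 1) x)"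
    unfolding eq by (subst frechet_derivative_at[symmetric]) (auto simp: sum.distrib)
  also have "(\<Sum>i\<in>UNIV. frechet_derivative g (at x) w $ i *\<^sub>R ?D (axis i 1) x) = 
      frechet_derivative \<phi> (at x) (frechet_derivative g (at x) w)"
    by (rule linear_expand_axis[OF lin, symmetric])
  also have "(\<Sum>i\<in>UNIV. g x $ i *\<^sub>R frechet_derivative (?D (axis i 1)) (at x) w) = 
     (\<Sum>i\<in>UNIV. g x $ i *\<^sub>R frechet_derivative (?D w) (at x) (axis i 1))"
    by (intro sum.cong refl arg_cong2[where f = scaleR] second_derivative_symmetric smooth_imp_C_k \<phi>)
  also have "\<dots> = frechet_derivative (?D w) (at x) (g x)"
    by (rule linear_expand_axis[OF lin2, symmetric])
  finally show ?thesis .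
qed

lemma along_bracket:
  assumes f: "smooth f" and g: "smooth g" and \<phi>: "smooth (\<phi> :: real ^ 'n \<Rightarrow> real)"
  shows "along (bracket f g) \<phi> x = along f (along g \<phi>) x - along g (along f \<phi>) x"
proof -
  have "along (bracket f g) \<phi> x = frechet_derivative \<phi> (at x) (along f g x) - frechet_derivative \<phi> (at x) (along g f x)"
    unfolding along_def[of "bracket f g"] bracket_def
    by (rule linear_diff[OF has_derivative_linear[OF smooth_differentiable[OF \<phi>]]])
  moreover have "along f (along g \<phi>) x = frechet_derivative (\<lambda>y. frechet_derivative \<phi> (at y) (f x)) (at x) (g x) +
    frechet_derivative \<phi> (at x) (along f g x)"
    unfolding along_def[of f "along g \<phi>"] frechet_along[OF g \<phi>] by (simp add: along_def)
  moreover have "along g (along f \<phi>) x = frechet_derivative (\<lambda>y. frechet_derivative \<phi> (at y) (g x)) (at x) (f x) +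
    frechet_derivative \<phi> (at x) (along g f x)"
    unfolding along_def[of g "along f \<phi>"] frechet_along[OF f \<phi>] by (simp add: along_def)
  ultimately show ?thesis
    using second_derivative_symmetric[OF smooth_imp_C_k[OF \<phi>], of "f x" x "g x"] by simp
qed

section \<open>Coordinates and the Jacobian of the output map\<close>

lemma pos_bounds: "1 \<le> pos (j :: 'n::finite)" "pos (j :: 'n::finite) \<le> CARD('n)"
  using bij_betw_pos[where 'n = 'n] by (auto simp: bij_betw_def)

lemma inv_pos_pos [simp]: "inv pos (pos j) = j"
  by (rule inv_f_f) (use bij_betw_pos in \<open>auto simp: bij_betw_def\<close>)

lemma nth_comp_pos: "v $# pos j = v $ j"
  by (simp add: nth_comp_def)

lemma nth_comp_simps [simp]:
  "(u + v) $# i = u $# i + v $# i" "(u - v) $# i = u $# i - v $# i"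
  "(c *\<^sub>R v) $# i = c * v $# i" "(0 :: real ^ 'n) $# i = 0" "(- v) $# i = - (v $# i)"
  by (auto simp: nth_comp_def)

lemma vec_eqI_nth_comp:
  assumes "\<And>i. 1 \<le> i \<Longrightarrow> i \<le> CARD('n) \<Longrightarrow> u $# i = (v :: real ^ 'n) $# i"
  shows "u = v"
  using assms[OF pos_bounds] by (simp add: vec_eq_iff nth_comp_pos)

lemma sum_nth_comp: "(\<Sum>i=1..CARD('n). q i) = (\<Sum>j\<in>UNIV. q (pos (j :: 'n::finite)))"
  using sum.reindex_bij_betw[OF bij_betw_pos[where 'n = 'n], of q] by simp

lemma inner_nth_comp: "u \<bullet> (v :: real ^ 'n) = (\<Sum>i=1..CARD('n). u $# i * v $# i)"
  unfolding sum_nth_comp by (simp add: nth_comp_pos inner_vec_def)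

lemma norm_nth_comp: "(norm (v :: real ^ 'n))\<^sup>2 = (\<Sum>i=1..CARD('n). (v $# i)\<^sup>2)"
  unfolding power2_norm_eq_inner inner_nth_comp by (simp add: power2_eq_square)

lemma abs_nth_comp_le: "\<bar>v $# i\<bar> \<le> norm v"
  by (simp add: nth_comp_def component_le_norm_cart)

text \<open>
Componentwise differentiation, in the numbering by \<open>1, \<dots>, n\<close>.
\<close>

lemma has_derivative_tuple:
  assumes "\<And>i. 1 \<le> i \<Longrightarrow> i \<le> CARD('n) \<Longrightarrow> ((\<lambda>x. c x i) has_derivative c' i) F"
  shows "((\<lambda>x. tuple (c x) :: real ^ 'n) has_derivative (\<lambda>v. tuple (\<lambda>i. c' i v))) F"
proof -
  have eq: "tuple q = (\<Sum>j\<in>UNIV. q (pos j) *\<^sub>R (axis j 1 :: real ^ 'n))" for q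
    by (simp add: vec_eq_iff tuple_def axis_def if_distrib[of "\<lambda>x. _ * x"] cong: if_cong)
  show ?thesis
    unfolding eq by (intro has_derivative_sum has_derivative_scaleR_left assms pos_bounds)
qed

lemma linear_tupleI:
  assumes "\<And>i. linear (\<lambda>v. c v i)"
  shows "linear (\<lambda>v. tuple (c v) :: real ^ 'n)"
  by (rule linearI) (auto simp: vec_eq_iff tuple_def linear_add[OF assms] linear_scale[OF assms])

text \<open>
The velocity of a chain of \<open>n\<close> integrators in state \<open>z\<close> whose last integrator is driven by \<open>v\<close>. Plant and
observer share this structure.
\<close>

definition shift :: "real ^ 'n \<Rightarrow> real \<Rightarrow> real ^ 'n" where
  "shift z v = tuple (\<lambda>i. if i < CARD('n) then z $# (i + 1) else v)"

lemma shift_nth_comp: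
  "1 \<le> i \<Longrightarrow> i \<le> CARD('n) \<Longrightarrow> shift z v $# i = (if i < CARD('n) then (z :: real ^ 'n) $# (i + 1) else v)"
  by (simp add: shift_def tuple_nth_comp)

lemma Phi_nth_comp:
  "1 \<le> i \<Longrightarrow> i \<le> CARD('n) \<Longrightarrow> (Phi f h x :: real ^ 'n) $# i = (lie f ^^ (i - 1)) h x"
  by (simp add: Phi_def tuple_nth_comp)

lemma Phi_has_derivative:
  assumes "smooth f" "smooth h"
  shows "(Phi f h has_derivative
    (\<lambda>v. tuple (\<lambda>i. frechet_derivative ((lie f ^^ (i - 1)) h) (at x) v))) (at x)"
  unfolding Phi_def[abs_def]
  by (intro has_derivative_tuple smooth_differentiable smooth_lie_pow assms)

text \<open>
Relative degree \<open>n\<close> means that the input enters only the last component, so \<open>\<Phi>\<close> maps the controlled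
plant to an integrator chain driven by \<open>F + u G\<close>.
\<close>

lemma Phi_derivative_control:
  assumes f: "smooth f" and h: "smooth (h :: real ^ 'n \<Rightarrow> real)"
    and rel: "uniform_relative_degree f g h"
  shows "frechet_derivative (Phi f h) (at x) (f x + u *\<^sub>R g x) =
    shift (Phi f h x) (F_fun f h x + u * G_fun f g h x)"
proof (rule vec_eqI_nth_comp)
  fix i assume i: "1 \<le> i" "i \<le> CARD('n)"
  let ?\<phi> = "(lie f ^^ (i - 1)) h"
  have s: "smooth ?\<phi>" by (intro smooth_lie_pow f h)
  have "frechet_derivative (Phi f h) (at x) = (\<lambda>v. tuple (\<lambda>i. frechet_derivative ((lie f ^^ (i - 1)) h) (at x) v))"
    by (rule frechet_derivative_at[symmetric]) (rule Phi_has_derivative[OF f h])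
  then have "frechet_derivative (Phi f h) (at x) (f x + u *\<^sub>R g x) $# i = frechet_derivative ?\<phi> (at x) (f x + u *\<^sub>R g x)"
    by (simp add: tuple_nth_comp i del: One_nat_def)
  also have "\<dots> = lie f ?\<phi> x + u * lie g ?\<phi> x"
    using has_derivative_linear[OF smooth_differentiable[OF s]]
    unfolding lie_eq_along[OF s] along_def by (simp add: linear_add linear_scale)
  also have "lie f ?\<phi> = (lie f ^^ i) h"
    using i by (cases i) auto
  also have "lie g ?\<phi> x = (if i < CARD('n) then 0 else G_fun f g h x)"
    using i rel by (auto simp: uniform_relative_degree_def G_fun_def)
  finally show "frechet_derivative (Phi f h) (at x) (f x + u *\<^sub>R g x) $# i =
      shift (Phi f h x) (F_fun f h x + u * G_fun f g h x) $# i"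
    using i by (auto simp: shift_nth_comp Phi_nth_comp F_fun_def)
qed

text \<open>
Induction on \<open>k\<close> with \<open>L\<^bsub>[f,b]\<^esub> = L\<^sub>f L\<^sub>b - L\<^sub>b L\<^sub>f\<close>: the first term differentiates a function that vanishes
identically, the second one trades a bracket for a Lie derivative of \<open>h\<close> and a sign.
\<close>

lemma lie_iterated_bracket:
  assumes f: "smooth f" and g: "smooth g" and h: "smooth (h :: real ^ 'n \<Rightarrow> real)"
    and rel: "uniform_relative_degree f g h"
  shows "(i + k + 2 \<le> CARD('n) \<longrightarrow> along ((bracket f ^^ k) g) ((lie f ^^ i) h) = (\<lambda>x. 0)) \<and>
    (i + k + 1 = CARD('n) \<longrightarrow> along ((bracket f ^^ k) g) ((lie f ^^ i) h) = (\<lambda>x. (-1) ^ k * G_fun f g h x))"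
proof (induction k arbitrary: i)
  case 0
  have "i = CARD('n) - 1" if "i + 1 = CARD('n)" using that by simp
  then show ?case
    using rel lie_eq_along[OF smooth_lie_pow[OF f h, of i], of g, symmetric]
    by (auto simp: uniform_relative_degree_def G_fun_def fun_eq_iff simp del: One_nat_def)
next
  case (Suc k)
  let ?b = "(bracket f ^^ k) g" and ?\<phi> = "(lie f ^^ i) h"
  have b: "smooth ?b" by (induction k) (auto intro: smooth_bracket f g)
  have s: "smooth ?\<phi>" by (intro smooth_lie_pow f h)
  have *: "along ((bracket f ^^ Suc k) g) ?\<phi> x = along f (along ?b ?\<phi>) x - along ?b ((lie f ^^ Suc i) h) x" for x
    using along_bracket[OF f b s, of x] by (simp add: lie_eq_along[OF s])
  show ?case
  proof (intro conjI impI ext)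
    fix x assume "i + Suc k + 2 \<le> CARD('n)"
    then have "along ?b ?\<phi> = (\<lambda>x. 0)" "along ?b ((lie f ^^ Suc i) h) = (\<lambda>x. 0)"
      using Suc.IH[of i] Suc.IH[of "Suc i"] by auto
    then show "along ((bracket f ^^ Suc k) g) ?\<phi> x = 0"
      unfolding * by (simp add: along_def)
  next
    fix x assume "i + Suc k + 1 = CARD('n)"
    then have "along ?b ?\<phi> = (\<lambda>x. 0)" "along ?b ((lie f ^^ Suc i) h) = (\<lambda>x. (-1) ^ k * G_fun f g h x)"
      using Suc.IH[of i] Suc.IH[of "Suc i"] by auto
    then show "along ((bracket f ^^ Suc k) g) ?\<phi> x = (-1) ^ Suc k * G_fun f g h x"
      unfolding * by (simp add: along_def)
  qed
qed

text \<open>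
The differentials of \<open>h, L\<^sub>f h, \<dots>\<close> evaluated on \<open>g, [f,g], [f,[f,g]], \<dots>\<close> form a matrix that is triangular
with respect to the antidiagonal and has \<open>\<plusminus>G\<close> there. A covector that annihilates the range of the
Jacobian therefore has vanishing components, the last one first.
\<close>

lemma jacobian_Phi_invertible:
  assumes f: "smooth f" and g: "smooth g" and h: "smooth (h :: real ^ 'n \<Rightarrow> real)"
    and rel: "uniform_relative_degree f g h"
  shows "invertible (jacobian (Phi f h) (at x))"
proof -
  define J where "J = jacobian (Phi f h) (at x)"
  define D where "D = (\<lambda>v. tuple (\<lambda>i. frechet_derivative ((lie f ^^ (i - 1)) h) (at x) v) :: real ^ 'n)"
  have D: "frechet_derivative (Phi f h) (at x) = D"
    unfolding D_def by (rule frechet_derivative_at[symmetric]) (rule Phi_has_derivative[OF f h])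
  have "linear D"
    unfolding D_def by (rule has_derivative_linear[OF Phi_has_derivative[OF f h]])
  then have J: "J *v v = D v" for v
    by (simp add: J_def jacobian_def D matrix_works)
  have "c = 0" if c: "transpose J *v c = 0" for c
  proof -
    have ort: "c \<bullet> D v = 0" for v
      using c by (simp flip: J dot_lmul_matrix)
    have zero: "c $# (CARD('n) - k) = 0" if "k < CARD('n)" for k
      using that
    proof (induction k rule: less_induct)
      case (less k)
      let ?b = "(bracket f ^^ k) g"
      have "c $# i * D (?b x) $# i = (if i = CARD('n) - k then c $# i * ((-1) ^ k * G_fun f g h x) else 0)"
        if i: "i \<in> {1..CARD('n)}" for i
      proof -
        have eq: "D (?b x) $# i = along ?b ((lie f ^^ (i - 1)) h) x"
          using i by (simp add: D_def tuple_nth_comp along_def)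
        consider "i < CARD('n) - k" | "i = CARD('n) - k" | "i > CARD('n) - k" by linarith
        then show ?thesis
        proof cases
          case 3
          then show ?thesis using less.IH[of "CARD('n) - i"] less.prems i by auto
        next
          case 2
          then show ?thesis
            using i lie_iterated_bracket[OF f g h rel, of "i - 1" k] unfolding eq by simp
        qed (use i less.prems lie_iterated_bracket[OF f g h rel, of "i - 1" k] in \<open>auto simp: eq\<close>)
      qed
      then have "c \<bullet> D (?b x) = (\<Sum>i=1..CARD('n). if i = CARD('n) - k then c $# i * ((-1) ^ k * G_fun f g h x) else 0)"
        unfolding inner_nth_comp by (intro sum.cong) auto
      then have "c $# (CARD('n) - k) * ((-1) ^ k * G_fun f g h x) = 0"
        using less.prems ort by (simp split: if_splits)
      then show ?case
        using rel by (auto simp: uniform_relative_degree_def)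
    qed
    show "c = 0"
    proof (rule vec_eqI_nth_comp)
      fix i assume "1 \<le> i" "i \<le> CARD('n)"
      then show "c $# i = 0 $# i" using zero[of "CARD('n) - i"] by simp
    qed
  qed
  then have "invertible (transpose J)"
    by (auto simp: invertible_left_inverse matrix_left_invertible_ker)
  then show ?thesis
    unfolding J_def[symmetric] using transpose_invertible[of "transpose J"] by simp
qed

section \<open>Lyapunov forms from Hurwitz polynomials\<close>

text \<open>
The complexification of a real space \<open>'a\<close> is carried by \<^typ>\<open>'a \<times> 'a\<close>; this is multiplication by a complex
scalar there. An endomorphism \<open>M\<close> extends to it as \<^term>\<open>map_prod M M\<close>.
\<close>

definition cmul :: "complex \<Rightarrow> 'a \<times> 'a \<Rightarrow> 'a::real_vector \<times> 'a" where
  "cmul l v = (Re l *\<^sub>R fst v - Im l *\<^sub>R snd v, Re l *\<^sub>R snd v + Im l *\<^sub>R fst v)"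

lemma cmul_simps:
  "cmul (a * b) v = cmul a (cmul b v)" "cmul (a - b) v = cmul a v - cmul b v" "cmul 0 v = 0"
  by (auto simp: cmul_def prod_eq_iff algebra_simps)

lemma cmul_linear: "linear (cmul l)"
  by (rule linearI) (auto simp: cmul_def prod_eq_iff algebra_simps)

lemma inner_cmul: "v \<bullet> cmul l v = Re l * (norm (v :: 'a::real_inner \<times> 'a))\<^sup>2"
  unfolding power2_norm_eq_inner
  by (auto simp: cmul_def inner_prod_def inner_add inner_diff algebra_simps inner_commute)

text \<open>
The operator \<open>q(M)\<close> on the complexification.
\<close>

definition poly_map :: "('a::real_vector \<Rightarrow> 'a) \<Rightarrow> complex poly \<Rightarrow> 'a \<times> 'a \<Rightarrow> 'a \<times> 'a" where
  "poly_map M q v = (\<Sum>i\<le>degree q. cmul (coeff q i) ((map_prod M M ^^ i) v))"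

lemma poly_map_degree_le:
  assumes "degree q \<le> N"
  shows "poly_map M q v = (\<Sum>i\<le>N. cmul (coeff q i) ((map_prod M M ^^ i) v))"
  unfolding poly_map_def using assms
  by (intro sum.mono_neutral_left) (auto simp: coeff_eq_0 cmul_simps)

lemma linear_map_prod: "linear M \<Longrightarrow> linear (map_prod M M)"
  by (rule linearI) (auto simp: map_prod_def linear_add linear_scale split: prod.splits)

lemma linear_funpow: "linear M \<Longrightarrow> linear ((M :: 'a::real_vector \<Rightarrow> 'a) ^^ i)"
  by (induction i) (auto intro!: linearI simp: linear_add linear_scale)

lemma map_prod_cmul: "linear M \<Longrightarrow> map_prod M M (cmul l v) = cmul l (map_prod M M v)"
  by (auto simp: cmul_def map_prod_def linear_add linear_diff linear_scale split: prod.splits)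

lemma poly_map_linear_factor:
  assumes M: "linear M"
  shows "poly_map M ([:-l, 1:] * q) v = poly_map M q (map_prod M M v - cmul l v)"
proof -
  let ?N = "degree q" and ?M = "map_prod M M"
  have comm: "(?M ^^ i) (cmul l v) = cmul l ((?M ^^ i) v)" for i
    by (induction i) (auto simp: map_prod_cmul[OF M])
  have lin: "linear (?M ^^ i)" for i by (intro linear_funpow linear_map_prod M)
  have "degree ([:-l, 1:] * q) \<le> Suc ?N"
    using degree_mult_le[of "[:-l, 1:]" q] by simp
  then have "poly_map M ([:-l, 1:] * q) v = (\<Sum>i\<le>Suc ?N. cmul (coeff ([:-l, 1:] * q) i) ((?M ^^ i) v))"
    by (rule poly_map_degree_le)
  also have "\<dots> = (\<Sum>i\<le>Suc ?N. cmul (coeff (pCons 0 q) i) ((?M ^^ i) v)) - (\<Sum>i\<le>Suc ?N. cmul (l * coeff q i) ((?M ^^ i) v))"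
    unfolding sum_subtractf[symmetric] by (intro sum.cong refl) (simp add: cmul_simps(2)[symmetric])
  also have "(\<Sum>i\<le>Suc ?N. cmul (coeff (pCons 0 q) i) ((?M ^^ i) v)) = (\<Sum>i\<le>?N. cmul (coeff q i) ((?M ^^ i) (?M v)))"
    unfolding sum.atMost_Suc_shift by (simp add: cmul_simps funpow_swap1)
  also have "(\<Sum>i\<le>Suc ?N. cmul (l * coeff q i) ((?M ^^ i) v)) = (\<Sum>i\<le>?N. cmul (coeff q i) ((?M ^^ i) (cmul l v)))"
    by (simp add: coeff_eq_0 cmul_simps comm mult.commute[of l])
  finally show ?thesis
    unfolding poly_map_def by (simp add: sum_subtractf linear_diff[OF lin] linear_diff[OF cmul_linear])
qed

text \<open>
A Lyapunov function is built from the roots of \<open>q\<close> without eigenvectors or normal forms. For a root \<open>l\<close>,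
the vector \<open>b = (M - l) v\<close> follows the same dynamics as \<open>v\<close>, and \<open>v\<close> itself obeys \<open>v' = l v + b\<close>, a
stable equation with input \<open>b\<close>. Hence a form for the remaining factor of \<open>q\<close>, evaluated at \<open>b\<close> and given
enough weight, can be added to \<open>\<bar>v\<bar>\<^sup>2\<close>. The defect term in \<open>q(M) v\<close> makes the induction on the degree
possible and vanishes when \<open>q\<close> annihilates \<open>M\<close>.
\<close>

lemma lyapunov_form_complex:
  fixes M :: "'a::euclidean_space \<Rightarrow> 'a"
  assumes M: "linear M" and "q \<noteq> 0" "\<And>s. poly q s = 0 \<Longrightarrow> Re s < 0"
  shows "\<exists>B c C. bilinear B \<and> (\<forall>v w. B v w = B w v) \<and> (\<forall>v. (norm v)\<^sup>2 \<le> B v v) \<and> c > 0 \<and> C \<ge> 0 \<and>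
    (\<forall>v. B v (map_prod M M v) \<le> - c * (norm v)\<^sup>2 + C * (norm (poly_map M q v))\<^sup>2)"
  using assms(2,3)
proof (induction "degree q" arbitrary: q)
  case 0
  then obtain a where q: "q = [:a:]" by (metis degree_eq_zeroE)
  then have a: "a \<noteq> 0" using 0 by auto
  obtain K where K: "\<And>v. norm (map_prod M M v) \<le> K * norm v" "K > 0"
    using linear_bounded_pos[OF linear_map_prod[OF M]] by blast
  have norm: "norm (poly_map M q v) = cmod a * norm v" for v
  proof -
    have "(norm (cmul a v))\<^sup>2 = (cmod a)\<^sup>2 * (norm v)\<^sup>2"
      unfolding cmod_power2 power2_norm_eq_inner
      by (simp add: cmul_def inner_prod_def inner_add inner_diff algebra_simps power2_eq_square inner_commute)
    then show ?thesis
      by (simp add: q poly_map_def flip: power_mult_distrib)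
  qed
  \<comment> \<open>For a nonzero constant polynomial the defect term dominates everything.\<close>
  have "v \<bullet> map_prod M M v \<le> - 1 * (norm v)\<^sup>2 + ((K + 1) / (cmod a)\<^sup>2) * (norm (poly_map M q v))\<^sup>2" for v
  proof -
    have "v \<bullet> map_prod M M v \<le> norm v * (K * norm v)"
      using norm_cauchy_schwarz[of v "map_prod M M v"] K(1)[of v] by (meson mult_left_mono norm_ge_zero order_trans)
    then show ?thesis
      using a by (simp add: norm power_mult_distrib field_simps power2_eq_square)
  qed
  then show ?case
    using K(2) by (intro exI[of _ "(\<bullet>)"] exI[of _ 1] exI[of _ "(K + 1) / (cmod a)\<^sup>2"])
      (auto simp: bilinear_conv_bounded_bilinear bounded_bilinear_inner inner_commute power2_norm_eq_inner)
next
  case (Suc d)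
  then have "\<not> constant (poly q)" by (simp add: constant_degree)
  then obtain l where l: "poly q l = 0"
    using fundamental_theorem_of_algebra by blast
  then obtain q' where q': "q = [:-l, 1:] * q'" by (metis poly_eq_0_iff_dvd dvdE)
  have q'0: "q' \<noteq> 0" using Suc.prems q' by auto
  have "degree q = degree q' + 1"
    unfolding q' using q'0 by (subst degree_mult_eq) auto
  then obtain B c C where B: "bilinear B" "\<And>v w. B v w = B w v" "\<And>v. (norm v)\<^sup>2 \<le> B v v" "c > 0" "C \<ge> 0"
    and decay: "\<And>v. B v (map_prod M M v) \<le> - c * (norm v)\<^sup>2 + C * (norm (poly_map M q' v))\<^sup>2"
    using Suc.hyps(1)[of q'] Suc.hyps(2) Suc.prems(2) q'0 unfolding q' poly_mult by (auto simp del: mult_pCons_left)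
  define \<mu> where "\<mu> = - Re l"
  have \<mu>: "\<mu> > 0" using Suc.prems(2)[OF l] by (simp add: \<mu>_def)
  \<comment> \<open>This weight makes the decrease of the old form cancel \<open>\<bar>b\<bar>\<^sup>2 / (2 \<mu>)\<close> from the cross term exactly.\<close>
  define D where "D = 1 / (2 * \<mu> * c)"
  have D: "D > 0" using \<mu> B(4) by (simp add: D_def)
  define b where "b v = map_prod M M v - cmul l v" for v
  have lin_b: "linear b"
    unfolding b_def by (intro linear_compose_sub linear_map_prod M cmul_linear)
  have b_comm: "b (map_prod M M v) = map_prod M M (b v)" for v
    unfolding b_def by (simp add: linear_diff[OF linear_map_prod[OF M]] map_prod_cmul[OF M])
  define B' where "B' v w = v \<bullet> w + D * B (b v) (b w)" for v w
  have "bilinear B'"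
    unfolding bilinear_def B'_def
    by (intro conjI allI linearI)
      (simp_all add: inner_add linear_add[OF lin_b] linear_scale[OF lin_b] bilinear_ladd[OF B(1)]
        bilinear_radd[OF B(1)] bilinear_lmul[OF B(1)] bilinear_rmul[OF B(1)] algebra_simps)
  moreover have "B' v w = B' w v" for v w
    by (simp add: B'_def B(2)[of "b v"] inner_commute)
  moreover have "(norm v)\<^sup>2 \<le> B' v v" for v
    using D B(3)[of "b v"] order_trans[OF zero_le_power2 B(3)] by (simp add: B'_def power2_norm_eq_inner)
  moreover have "B' v (map_prod M M v) \<le> - (\<mu> / 2) * (norm v)\<^sup>2 + (D * C) * (norm (poly_map M q v))\<^sup>2" for v
  proof -
    have "v \<bullet> map_prod M M v = v \<bullet> b v - \<mu> * (norm v)\<^sup>2"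
      by (simp add: b_def inner_diff inner_cmul \<mu>_def)
    also have "v \<bullet> b v \<le> norm v * norm (b v)" by (rule norm_cauchy_schwarz)
    also have "norm v * norm (b v) \<le> \<mu> / 2 * (norm v)\<^sup>2 + (norm (b v))\<^sup>2 / (2 * \<mu>)"
    proof -
      have "0 \<le> (\<mu> * norm v - norm (b v))\<^sup>2 / (2 * \<mu>)" using \<mu> by simp
      then show ?thesis using \<mu> by (simp add: field_simps power2_eq_square)
    qed
    finally have 1: "v \<bullet> map_prod M M v \<le> - (\<mu> / 2) * (norm v)\<^sup>2 + (norm (b v))\<^sup>2 / (2 * \<mu>)" by simp
    have "D * B (b v) (b (map_prod M M v)) \<le> D * (- c * (norm (b v))\<^sup>2 + C * (norm (poly_map M q v))\<^sup>2)"
      using decay[of "b v"] D unfolding b_comm q' poly_map_linear_factor[OF M] b_def[symmetric]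
      by (intro mult_left_mono) auto
    also have "\<dots> = - ((norm (b v))\<^sup>2 / (2 * \<mu>)) + (D * C) * (norm (poly_map M q v))\<^sup>2"
      using B(4) \<mu> by (simp add: D_def field_simps)
    finally show ?thesis using 1 by (simp add: B'_def)
  qed
  ultimately show ?case
    using \<mu> D B(5) by (intro exI[of _ B'] exI[of _ "\<mu> / 2"] exI[of _ "D * C"]) auto
qed

text \<open>
The complex form restricted to real vectors.
\<close>

lemma lyapunov_form_of_annihilating_poly:
  fixes M :: "'a::euclidean_space \<Rightarrow> 'a"
  assumes M: "linear M" and p: "p \<noteq> 0" "Hurwitz p"
    and ann: "\<And>v. (\<Sum>i\<le>degree p. coeff p i *\<^sub>R (M ^^ i) v) = 0"
  shows "\<exists>B c. bilinear B \<and> (\<forall>v w. B v w = B w v) \<and> (\<forall>v. (norm v)\<^sup>2 \<le> B v v) \<and> c > 0 \<and>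
    (\<forall>v. B v (M v) \<le> - c * (norm v)\<^sup>2)"
proof -
  let ?q = "map_poly complex_of_real p"
  have "?q \<noteq> 0" using p by (simp add: map_poly_eq_0_iff)
  from lyapunov_form_complex[OF M this] obtain B c C where B: "bilinear B" "\<And>v w. B v w = B w v"
    "\<And>v. (norm v)\<^sup>2 \<le> B v v" "c > 0" 
    and decay: "\<And>v. B v (map_prod M M v) \<le> - c * (norm v)\<^sup>2 + C * (norm (poly_map M ?q v))\<^sup>2"
    using p(2) unfolding Hurwitz_def by blast
  have M0: "M 0 = 0" by (rule linear_0[OF M])
  have pow: "(map_prod M M ^^ i) (v, 0) = ((M ^^ i) v, 0)" for i v
    by (induction i) (auto simp: M0)
  have zero: "poly_map M ?q (v, 0) = 0" for v
  proof -
    have "poly_map M ?q (v, 0) = (\<Sum>i\<le>degree p. (coeff p i *\<^sub>R (M ^^ i) v, 0))"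
      unfolding poly_map_def by (simp add: degree_map_poly coeff_map_poly pow cmul_def)
    then show ?thesis using ann[of v] by (simp add: prod_eq_iff fst_sum snd_sum)
  qed
  define B' where "B' v w = B (v, 0) (w, 0)" for v w
  have lin: "linear (\<lambda>v :: 'a. (v, 0 :: 'a))" by (rule linearI) auto
  have "bilinear B'"
    using B(1) unfolding bilinear_def B'_def
    using linear_compose[OF lin, unfolded o_def] by blast
  moreover have "B' v (M v) \<le> - c * (norm v)\<^sup>2" for v
    using decay[of "(v, 0)"] by (simp add: B'_def zero M0 norm_Pair)
  moreover have "(norm v)\<^sup>2 \<le> B' v v" for v
    using B(3)[of "(v, 0)"] by (simp add: B'_def norm_Pair)
  ultimately show ?thesis using B(2,4) unfolding B'_def by blast
qed

text \<open>
The estimation error dynamics in the time scale of the observer, with \<open>\<epsilon>\<close> scaled away. It is the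
companion matrix of \<^const>\<open>observer_poly\<close> in observer form.
\<close>

definition observer_map :: "real ^ 'n \<Rightarrow> real ^ 'n \<Rightarrow> real ^ 'n" where
  "observer_map \<beta> v = shift v 0 - v $# 1 *\<^sub>R \<beta>"

lemma linear_shift: "linear (\<lambda>z. shift z 0)"
  unfolding shift_def by (intro linear_tupleI) (auto intro!: linearI)

lemma linear_observer_map: "linear (observer_map \<beta>)"
  unfolding observer_map_def
  by (intro linear_compose_sub linear_shift) (auto intro!: linearI simp: algebra_simps)

lemma coeff_observer_poly:
  "coeff (observer_poly (\<beta> :: real ^ 'n)) i = (if i < CARD('n) then \<beta> $# (CARD('n) - i) else if i = CARD('n) then 1 else 0)"
proof -
  have "(\<Sum>j=1..CARD('n). coeff (monom (\<beta> $# j) (CARD('n) - j)) i) =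
    (\<Sum>j=1..CARD('n). if j = CARD('n) - i \<and> i \<le> CARD('n) then \<beta> $# j else 0)"
    by (intro sum.cong) auto
  also have "\<dots> = (if i < CARD('n) then \<beta> $# (CARD('n) - i) else 0)"
    by (cases "i < CARD('n)") (auto simp: sum.delta)
  finally show ?thesis
    unfolding observer_poly_def by (auto simp: coeff_sum)
qed

lemma degree_observer_poly: "degree (observer_poly (\<beta> :: real ^ 'n)) = CARD('n)"
  by (intro antisym degree_le le_degree) (auto simp: coeff_observer_poly)

abbreviation unit_vec :: "nat \<Rightarrow> real ^ 'n" where
  "unit_vec i \<equiv> tuple (\<lambda>j. if j = i then 1 else 0)"

lemma nth_comp_sum: "(\<Sum>a\<in>A. f a) $# i = (\<Sum>a\<in>A. f a $# i)"
  by (simp add: nth_comp_def)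

lemma unit_vec_expand: "(v :: real ^ 'n) = (\<Sum>i=1..CARD('n). v $# i *\<^sub>R unit_vec i)"
  by (rule vec_eqI_nth_comp)
    (simp add: nth_comp_sum tuple_nth_comp sum.delta if_distrib[of "\<lambda>x. _ * x"] del: One_nat_def cong: if_cong)

lemma observer_map_unit_vec:
  assumes "1 \<le> i" "i \<le> CARD('n)"
  shows "observer_map \<beta> (unit_vec i :: real ^ 'n) = (if i = 1 then - \<beta> else unit_vec (i - 1))"
  using assms
  by (intro vec_eqI_nth_comp) (auto simp: observer_map_def shift_nth_comp tuple_nth_comp Suc_le_eq)

lemma observer_map_pow:
  "k < CARD('n) \<Longrightarrow> (observer_map \<beta> ^^ k) (unit_vec CARD('n) :: real ^ 'n) = unit_vec (CARD('n) - k)"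
proof (induction k)
  case (Suc k)
  then have "CARD('n) - k \<noteq> 1" by linarith
  with Suc show ?case
    using observer_map_unit_vec[of "CARD('n) - k" \<beta>] by simp
qed simp

text \<open>
Cayley-Hamilton for the companion matrix, directly: the last unit vector is cyclic because each
application of the map moves it one place down, and after \<open>n\<close> steps it arrives at \<open>- \<beta>\<close>.
\<close>

lemma observer_poly_annihilates:
  fixes \<beta> :: "real ^ 'n"
  shows "(\<Sum>i\<le>CARD('n). coeff (observer_poly \<beta>) i *\<^sub>R (observer_map \<beta> ^^ i) v) = 0"
proof -
  let ?n = "CARD('n)" and ?M = "observer_map \<beta>"
  define P where "P v = (\<Sum>i\<le>?n. coeff (observer_poly \<beta>) i *\<^sub>R (?M ^^ i) v)" for v
  have P_lin: "linear P"
    unfolding P_def by (intro linear_compose_sum ballI linear_compose_scale_right linear_funpow linear_observer_map)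
  have P_comm: "P ((?M ^^ k) v) = (?M ^^ k) (P v)" for k v
  proof -
    have lin: "linear (?M ^^ k)" by (intro linear_funpow linear_observer_map)
    show ?thesis
      unfolding P_def linear_sum[OF lin] linear_scale[OF lin]
      by (simp flip: funpow_add comp_apply[of "_ ^^ _"] add: add.commute)
  qed
  have n: "?n = Suc (?n - 1)" by simp
  have "(?M ^^ ?n) (unit_vec ?n) = - \<beta>"
    by (subst n, subst funpow.simps) (simp add: observer_map_pow observer_map_unit_vec)
  then have "P (unit_vec ?n) = (\<Sum>i<?n. \<beta> $# (?n - i) *\<^sub>R unit_vec (?n - i)) - \<beta>"
    unfolding P_def by (simp add: lessThan_Suc_atMost[symmetric] coeff_observer_poly observer_map_pow)
  also have "(\<Sum>i<?n. \<beta> $# (?n - i) *\<^sub>R unit_vec (?n - i)) = (\<Sum>i=1..?n. \<beta> $# i *\<^sub>R unit_vec i)"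
    by (rule sum.reindex_bij_witness[of _ "\<lambda>i. ?n - i" "\<lambda>i. ?n - i"]) auto
  also have "\<dots> = \<beta>" by (rule unit_vec_expand[symmetric])
  finally have "P (unit_vec ?n) = 0" by simp
  have unit: "P (unit_vec i) = 0" if i: "i \<in> {1..?n}" for i
  proof -
    have "unit_vec i = (?M ^^ (?n - i)) (unit_vec ?n)"
      using i observer_map_pow[of "?n - i" \<beta>] by simp
    then show ?thesis
      by (simp add: P_comm \<open>P (unit_vec ?n) = 0\<close> linear_0[OF linear_funpow[OF linear_observer_map]])
  qed
  have "P v = P (\<Sum>i=1..?n. v $# i *\<^sub>R unit_vec i)"
    using unit_vec_expand[of v] by simp
  also have "\<dots> = 0"
    unfolding linear_sum[OF P_lin] linear_scale[OF P_lin] by (intro sum.neutral) (simp add: unit)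
  finally show ?thesis by (simp add: P_def)
qed

lemma observer_lyapunov_form:
  fixes \<beta> :: "real ^ 'n"
  assumes "Hurwitz (observer_poly \<beta>)"
  shows "\<exists>B c. bilinear B \<and> (\<forall>v w. B v w = B w v) \<and> (\<forall>v. (norm v)\<^sup>2 \<le> B v v) \<and> c > 0 \<and>
    (\<forall>v. B v (observer_map \<beta> v) \<le> - c * (norm v)\<^sup>2)"
  using assms observer_poly_annihilates[of \<beta>] degree_observer_poly[of \<beta>]
  by (intro lyapunov_form_of_annihilating_poly[OF linear_observer_map, of "observer_poly \<beta>"]) auto

section \<open>Integral state feedback for an uncertain integrator chain\<close>

text \<open>
The constants are chosen before the curve and the interval: this uniformity is what later turns a
decay estimate into an a priori bound for solutions that are only known to exist on \<open>[0, T]\<close>.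
\<close>

lemma bilinear_form_decay:
  fixes Q :: "'a::euclidean_space \<Rightarrow> 'a \<Rightarrow> real"
  assumes Q: "bilinear Q" "\<And>v w. Q v w = Q w v" and l: "l > 0" "\<And>v. l * (norm v)\<^sup>2 \<le> Q v v" and c: "c > 0"
  shows "\<exists>C \<alpha>. C > 0 \<and> \<alpha> > 0 \<and> (\<forall>T Y Y'. (\<forall>t\<in>{0..T}. (Y has_vector_derivative Y' t) (at t within {0..T}) \<and>
    Q (Y t) (Y' t) \<le> - c * (norm (Y t))\<^sup>2) \<longrightarrow> (\<forall>t\<in>{0..T}. norm (Y t) \<le> C * norm (Y 0) * exp (- \<alpha> * t)))"
proof -
  have bb: "bounded_bilinear Q" using Q(1) by (simp add: bilinear_conv_bounded_bilinear)
  obtain K where K: "K > 0" "\<And>v w. norm (Q v w) \<le> norm v * norm w * K"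
    using bounded_bilinear.pos_bounded[OF bb] by blast
  define \<alpha> where "\<alpha> = c / K"
  define C where "C = sqrt (K / l)"
  have pos: "C > 0" "\<alpha> > 0" using K l c by (auto simp: C_def \<alpha>_def)
  have "norm (Y t) \<le> C * norm (Y 0) * exp (- \<alpha> * t)"
    if Y: "\<And>t. t \<in> {0..T} \<Longrightarrow> (Y has_vector_derivative Y' t) (at t within {0..T})"
      "\<And>t. t \<in> {0..T} \<Longrightarrow> Q (Y t) (Y' t) \<le> - c * (norm (Y t))\<^sup>2" and t: "t \<in> {0..T}" for T Y Y' t
  proof -
    \<comment> \<open>The form multiplied by the inverse of the expected decay is nonincreasing.\<close>
    define V where "V s = exp (2 * \<alpha> * s) * Q (Y s) (Y s)" for s
    have up: "Q v v \<le> K * (norm v)\<^sup>2" for v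
      using K(2)[of v v] by (simp add: power2_eq_square mult.commute)
    have V': "(V has_real_derivative exp (2 * \<alpha> * s) * (2 * \<alpha> * Q (Y s) (Y s) + 2 * Q (Y s) (Y' s))) (at s within {0..T})"
      if "s \<in> {0..T}" for s
    proof -
      have "((\<lambda>s. Q (Y s) (Y s)) has_vector_derivative Q (Y s) (Y' s) + Q (Y' s) (Y s)) (at s within {0..T})"
        by (rule bounded_bilinear.has_vector_derivative[OF bb Y(1)[OF that] Y(1)[OF that]])
      then have "((\<lambda>s. Q (Y s) (Y s)) has_real_derivative 2 * Q (Y s) (Y' s)) (at s within {0..T})"
        using Q(2)[of "Y' s" "Y s"] by (simp add: has_real_derivative_iff_has_vector_derivative)
      then show ?thesis
        unfolding V_def by (auto intro!: derivative_eq_intros simp: algebra_simps)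
    qed
    have "V t \<le> V 0"
    proof (rule DERIV_nonpos_imp_decreasing_open[where f = V])
      show "continuous_on {0..t} V"
        using V' t by (intro continuous_on_subset[of "{0..T}" V "{0..t}"] DERIV_continuous_on) auto
      show "\<exists>y. (V has_real_derivative y) (at s) \<and> y \<le> 0" if s: "0 < s" "s < t" for s
      proof -
        have "\<alpha> * Q (Y s) (Y s) \<le> c * (norm (Y s))\<^sup>2"
          using up[of "Y s"] K c by (simp add: \<alpha>_def field_simps)
        then have "exp (2 * \<alpha> * s) * (2 * \<alpha> * Q (Y s) (Y s) + 2 * Q (Y s) (Y' s)) \<le> 0"
          using Y(2)[of s] s t by (intro mult_nonneg_nonpos) auto
        moreover have "at s within {0..T} = at s"
          using s t by (intro at_within_interior) auto
        ultimately show ?thesis using V'[of s] s t by auto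
      qed
    qed (use t in auto)
    moreover have "l * (norm (Y t))\<^sup>2 * exp (2 * \<alpha> * t) \<le> Q (Y t) (Y t) * exp (2 * \<alpha> * t)"
      by (intro mult_right_mono l(2)) simp
    ultimately have "l * (norm (Y t))\<^sup>2 * exp (2 * \<alpha> * t) \<le> K * (norm (Y 0))\<^sup>2"
      using up[of "Y 0"] unfolding V_def by (simp only: mult.commute mult_zero_left mult_zero_right exp_zero mult_1_left mult_1_right)
    then have "(norm (Y t))\<^sup>2 \<le> (K / l) * (norm (Y 0))\<^sup>2 * exp (- (2 * \<alpha> * t))"
      using l(1) by (simp add: exp_minus field_simps)
    also have "\<dots> = (C * norm (Y 0) * exp (- \<alpha> * t))\<^sup>2"
      using K l by (simp add: C_def power_mult_distrib exp_double[symmetric] flip: exp_add)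
    finally show ?thesis
      by (rule power2_le_imp_le) (use pos in auto)
  qed
  then show ?thesis using pos by blast
qed

text \<open>
If \<open>s j\<close> is the \<open>j\<close>-th derivative of a signal, then \<^term>\<open>filt i s\<close> is the result of applying
\<open>(d/dt + 2)\<^sup>i\<close> to that signal.
\<close>

primrec filt :: "nat \<Rightarrow> (nat \<Rightarrow> real) \<Rightarrow> real" where
  "filt 0 s = s 0"
| "filt (Suc i) s = filt i (\<lambda>j. s (Suc j)) + 2 * filt i s"

lemma filt_add: "filt i (\<lambda>j. s j + t j) = filt i s + filt i t"
  by (induction i arbitrary: s t) auto

lemma filt_scale: "filt i (\<lambda>j. c * s j) = c * filt i s"
  by (induction i arbitrary: s) (auto simp: algebra_simps)

lemma filt_cong: "(\<And>j. j \<le> i \<Longrightarrow> s j = t j) \<Longrightarrow> filt i s = filt i t"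
proof (induction i arbitrary: s t)
  case (Suc i)
  have "filt i (\<lambda>j. s (Suc j)) = filt i (\<lambda>j. t (Suc j))" "filt i s = filt i t"
    by (rule Suc.IH; use Suc.prems in force)+
  then show ?case by simp
qed auto

lemma filt_impulse: "i \<le> n \<Longrightarrow> filt i (\<lambda>j. if j = n then v else 0) = (if i = n then v else 0)"
proof (induction i arbitrary: n)
  case (Suc i)
  then obtain m where "n = Suc m" "i \<le> m" by (cases n) auto
  then show ?case
    using Suc.IH[of m] Suc.IH[of n] by simp
qed auto

text \<open>
The transformation to filtered variables is invertible, since \<open>d/dt = (d/dt + 2) - 2\<close>; each step
costs at most a factor 3.
\<close>

lemma abs_le_filt_sum: "\<bar>s i\<bar> \<le> 3 ^ i * (\<Sum>j\<le>i. \<bar>filt j s\<bar>)"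
proof (induction i arbitrary: s)
  case (Suc i)
  have shifted: "filt j (\<lambda>j. s (Suc j)) = filt (Suc j) s - 2 * filt j s" for j by simp
  have "\<bar>s (Suc i)\<bar> \<le> 3 ^ i * (\<Sum>j\<le>i. \<bar>filt j (\<lambda>j. s (Suc j))\<bar>)"
    by (rule Suc.IH)
  also have "(\<Sum>j\<le>i. \<bar>filt j (\<lambda>j. s (Suc j))\<bar>) \<le> (\<Sum>j\<le>i. \<bar>filt (Suc j) s\<bar> + 2 * \<bar>filt j s\<bar>)"
    unfolding shifted by (intro sum_mono) linarith
  also have "\<dots> = (\<Sum>j\<le>i. \<bar>filt (Suc j) s\<bar>) + 2 * (\<Sum>j\<le>i. \<bar>filt j s\<bar>)"
    by (simp add: sum.distrib sum_distrib_left)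
  also have "(\<Sum>j\<le>i. \<bar>filt (Suc j) s\<bar>) \<le> (\<Sum>j\<le>Suc i. \<bar>filt j s\<bar>)"
    unfolding sum.atMost_Suc_shift[of _ i] by simp
  also have "(\<Sum>j\<le>i. \<bar>filt j s\<bar>) \<le> (\<Sum>j\<le>Suc i. \<bar>filt j s\<bar>)"
    by simp
  finally show ?case by (simp add: algebra_simps)
qed simp

text \<open>
A state of the augmented chain, the integrator state being entry 0, as a sequence padded by zeros.
The padding makes the shift of sequences compatible with \<open>chain\<close> below.
\<close>

definition entries :: "real \<times> (real ^ 'n) \<Rightarrow> nat \<Rightarrow> real" where
  "entries W i = (if i = 0 then fst W else if i \<le> CARD('n) then snd W $# i else 0)"

definition chain :: "real \<times> (real ^ 'n) \<Rightarrow> real \<Rightarrow> real \<times> (real ^ 'n)" where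
  "chain W v = (snd W $# 1, shift (snd W) v)"

lemma entries_chain:
  "entries (chain W v) i = entries (W :: real \<times> (real ^ 'n)) (Suc i) + (if i = CARD('n) then v else 0)"
  by (auto simp: entries_def chain_def shift_nth_comp Suc_le_eq)

lemma norm_entries: "(norm (W :: real \<times> (real ^ 'n)))\<^sup>2 = (\<Sum>i\<le>CARD('n). (entries W i)\<^sup>2)"
proof -
  have "{..CARD('n)} = insert 0 {1..CARD('n)}" by auto
  moreover have "(\<Sum>i=1..CARD('n). (entries W i)\<^sup>2) = (\<Sum>i=1..CARD('n). (snd W $# i)\<^sup>2)"
    by (intro sum.cong) (auto simp: entries_def)
  ultimately show ?thesis
    by (simp add: entries_def norm_prod_def norm_nth_comp sum_nonneg)
qed

definition filtered :: "nat \<Rightarrow> real \<times> (real ^ 'n) \<Rightarrow> real" where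
  "filtered i W = filt i (entries W)"

lemma filtered_linear: "linear (filtered i)"
proof (rule linearI)
  show "filtered i (V + W) = filtered i V + filtered i W" for V W
    unfolding filtered_def filt_add[symmetric] by (intro filt_cong) (auto simp: entries_def)
  show "filtered i (c *\<^sub>R W) = c *\<^sub>R filtered i W" for c W
    unfolding filtered_def real_scaleR_def filt_scale[symmetric] by (intro filt_cong) (auto simp: entries_def)
qed

lemma filtered_chain:
  assumes "i \<le> CARD('n)"
  shows "filtered i (chain W v) = filtered (Suc i) (W :: real \<times> (real ^ 'n)) - 2 * filtered i W + (if i = CARD('n) then v else 0)"
proof -
  have "filtered i (chain W v) = filt i (\<lambda>j. entries W (Suc j) + (if j = CARD('n) then v else 0))"
    unfolding filtered_def by (intro filt_cong) (rule entries_chain)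
  then show ?thesis
    using assms by (simp add: filt_add filt_impulse filtered_def)
qed

definition chain_form :: "real \<times> (real ^ 'n) \<Rightarrow> real \<times> (real ^ 'n) \<Rightarrow> real" where
  "chain_form V W = (\<Sum>i\<le>CARD('n). filtered i V * filtered i W)"

lemma bilinear_chain_form: "bilinear chain_form"
  unfolding bilinear_def chain_form_def
  by (intro conjI allI linearI)
    (simp_all add: linear_add[OF filtered_linear] linear_scale[OF filtered_linear] sum.distrib sum_distrib_left algebra_simps)

text \<open>
Positive definiteness, because every entry of \<open>W\<close> is bounded by the filtered variables.
\<close>

lemma chain_form_lower_bound:
  "\<exists>l>0. \<forall>W :: real \<times> (real ^ 'n). l * (norm W)\<^sup>2 \<le> chain_form W W"
proof -
  let ?n = "CARD('n)"
  define m where "m = 3 ^ ?n * (real ?n + 1)"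
  have m: "m > 0" by (simp add: m_def)
  have "(norm W)\<^sup>2 \<le> (real ?n + 1) * m\<^sup>2 * chain_form W W" for W :: "real \<times> (real ^ 'n)"
  proof -
    have le: "\<bar>filtered j W\<bar> \<le> sqrt (chain_form W W)" if "j \<le> ?n" for j
    proof -
      have "(filtered j W)\<^sup>2 \<le> chain_form W W"
        unfolding chain_form_def power2_eq_square using that
        by (intro member_le_sum[of j "{..?n}" "\<lambda>i. filtered i W * filtered i W"]) auto
      then show ?thesis using real_sqrt_le_mono by fastforce
    qed
    have nn: "chain_form W W \<ge> 0" unfolding chain_form_def by (intro sum_nonneg) auto
    have "(entries W i)\<^sup>2 \<le> m\<^sup>2 * chain_form W W" if "i \<le> ?n" for i
    proof -
      have "\<bar>entries W i\<bar> \<le> 3 ^ i * (\<Sum>j\<le>i. \<bar>filtered j W\<bar>)"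
        unfolding filtered_def by (rule abs_le_filt_sum)
      also have "\<dots> \<le> 3 ^ ?n * ((real ?n + 1) * sqrt (chain_form W W))"
      proof (intro mult_mono)
        have "(\<Sum>j\<le>i. \<bar>filtered j W\<bar>) \<le> (\<Sum>j\<le>i. sqrt (chain_form W W))"
          using that by (intro sum_mono le) auto
        also have "\<dots> \<le> (real ?n + 1) * sqrt (chain_form W W)"
          using that nn by (auto intro!: mult_right_mono)
        finally show "(\<Sum>j\<le>i. \<bar>filtered j W\<bar>) \<le> (real ?n + 1) * sqrt (chain_form W W)" .
      qed (use that in \<open>auto intro: power_increasing sum_nonneg\<close>)
      finally have "\<bar>entries W i\<bar> \<le> m * sqrt (chain_form W W)" by (simp add: m_def)
      then have "\<bar>entries W i\<bar>\<^sup>2 \<le> (m * sqrt (chain_form W W))\<^sup>2" by (intro power_mono) auto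
      then show ?thesis using nn by (simp add: power_mult_distrib)
    qed
    then have "(norm W)\<^sup>2 \<le> (\<Sum>i\<le>?n. m\<^sup>2 * chain_form W W)"
      unfolding norm_entries by (intro sum_mono) auto
    then show ?thesis by (simp add: algebra_simps)
  qed
  then have "1 / ((real ?n + 1) * m\<^sup>2) * (norm W)\<^sup>2 \<le> chain_form W W" for W :: "real \<times> (real ^ 'n)"
    using m by (simp add: divide_le_eq mult.commute)
  moreover have "1 / ((real ?n + 1) * m\<^sup>2) > 0" using m by simp
  ultimately show ?thesis by blast
qed

lemma chain_form_chain:
  "chain_form W (chain W v) = chain_form W (chain W 0) + v * filtered CARD('n) (W :: real \<times> (real ^ 'n))"
proof -
  have "{..CARD('n)} = insert CARD('n) {..<CARD('n)}" by auto
  then show ?thesis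
    unfolding chain_form_def by (simp add: filtered_chain algebra_simps)
qed

text \<open>
Each filtered variable but the last obeys \<open>\<sigma>\<^sub>i' = - 2 \<sigma>\<^sub>i + \<sigma>\<^sub>i\<^sub>+\<^sub>1\<close>, and half a square of the input
suffices to bound each cross term, so the sum telescopes. What remains is the term of the last
variable, where the feedback acts.
\<close>

lemma chain_form_nominal:
  "chain_form W (chain W 0) \<le> - chain_form W W + filtered CARD('n) W * filtered (Suc CARD('n)) (W :: real \<times> (real ^ 'n))"
proof -
  let ?n = "CARD('n)" and ?s = "\<lambda>i. filtered i W"
  have n: "{..?n} = insert ?n {..<?n}" by auto
  have "(\<Sum>i<?n. ?s i * (?s (Suc i) - 2 * ?s i)) \<le> (\<Sum>i<?n. - (?s i * ?s i) + ((?s (Suc i))\<^sup>2 / 2 - (?s i)\<^sup>2 / 2))"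
  proof (rule sum_mono)
    fix i
    have "0 \<le> (?s i - ?s (Suc i))\<^sup>2 / 2" by simp
    then show "?s i * (?s (Suc i) - 2 * ?s i) \<le> - (?s i * ?s i) + ((?s (Suc i))\<^sup>2 / 2 - (?s i)\<^sup>2 / 2)"
      by (simp add: power2_eq_square algebra_simps)
  qed
  also have "\<dots> = - (\<Sum>i<?n. ?s i * ?s i) + ((?s ?n)\<^sup>2 / 2 - (?s 0)\<^sup>2 / 2)"
    unfolding sum.distrib sum_negf using sum_lessThan_telescope[of "\<lambda>i. (?s i)\<^sup>2 / 2" ?n] by simp
  finally have "(\<Sum>i<?n. ?s i * (?s (Suc i) - 2 * ?s i)) \<le> - (\<Sum>i<?n. ?s i * ?s i) + ?s ?n * ?s ?n"
    using zero_le_square[of "?s 0"] zero_le_square[of "?s ?n"] unfolding power2_eq_square by linarith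
  then show ?thesis
    unfolding chain_form_def n by (simp add: filtered_chain algebra_simps)
qed

text \<open>
\<open>\<theta>\<close> stands for the unknown input gain and \<open>\<Delta>\<close> for the unknown drift, both of which may vary
arbitrarily in time; only these bounds are known. The quadratic form is the same for all of them.
\<close>

definition stabilizing_gains :: "real \<Rightarrow> real \<Rightarrow> real \<Rightarrow> (real \<times> (real ^ 'n)) set" where
  "stabilizing_gains b_lo b_hi \<Lambda> = {K. \<exists>c>0. \<forall>W \<theta> \<Delta>. b_lo \<le> \<theta> \<and> \<theta> \<le> b_hi \<and> \<bar>\<Delta>\<bar> \<le> \<Lambda> * norm W \<longrightarrow>
     chain_form W (chain W (- \<Delta> - \<theta> * (K \<bullet> W))) \<le> - c * (norm W)\<^sup>2}"

text \<open>
The gain enters the derivative of the form linearly, so a small change of it costs at most half of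
the rate \<open>c\<close>.
\<close>

lemma open_stabilizing_gains:
  assumes "0 < b_lo" "0 < b_hi"
  shows "open (stabilizing_gains b_lo b_hi \<Lambda> :: (real \<times> (real ^ 'n)) set)"
  unfolding open_dist
proof
  fix K :: "real \<times> (real ^ 'n)" assume "K \<in> stabilizing_gains b_lo b_hi \<Lambda>"
  then obtain c where c: "c > 0" "\<And>W \<theta> \<Delta>. b_lo \<le> \<theta> \<Longrightarrow> \<theta> \<le> b_hi \<Longrightarrow> \<bar>\<Delta>\<bar> \<le> \<Lambda> * norm W \<Longrightarrow>
     chain_form W (chain W (- \<Delta> - \<theta> * (K \<bullet> W))) \<le> - c * (norm W)\<^sup>2"
    unfolding stabilizing_gains_def by blast
  obtain s where s: "s > 0" "\<And>W :: real \<times> (real ^ 'n). norm (filtered CARD('n) W) \<le> s * norm W"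
    using linear_bounded_pos[OF filtered_linear[of "CARD('n)"]] by metis
  define e where "e = c / (2 * b_hi * s)"
  have "K' \<in> stabilizing_gains b_lo b_hi \<Lambda>" if "dist K' K < e" for K'
  proof -
    have "chain_form W (chain W (- \<Delta> - \<theta> * (K' \<bullet> W))) \<le> - (c / 2) * (norm W)\<^sup>2"
      if "b_lo \<le> \<theta>" "\<theta> \<le> b_hi" "\<bar>\<Delta>\<bar> \<le> \<Lambda> * norm W" for W \<theta> \<Delta>
    proof -
      have "\<bar>(\<theta> * ((K - K') \<bullet> W)) * filtered CARD('n) W\<bar> \<le> (b_hi * (e * norm W)) * (s * norm W)"
        unfolding abs_mult
      proof (intro mult_mono)
        have "\<bar>(K - K') \<bullet> W\<bar> \<le> norm (K - K') * norm W" by (rule Cauchy_Schwarz_ineq2)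
        also have "\<dots> \<le> e * norm W"
          using \<open>dist K' K < e\<close> by (intro mult_right_mono) (auto simp: dist_norm norm_minus_commute)
        finally show "\<bar>(K - K') \<bullet> W\<bar> \<le> e * norm W" .
      qed (use that assms s c in \<open>auto simp: e_def\<close>)
      also have "\<dots> = c / 2 * (norm W)\<^sup>2"
        using assms s by (simp add: e_def power2_eq_square)
      finally have "(\<theta> * ((K - K') \<bullet> W)) * filtered CARD('n) W \<le> c / 2 * (norm W)\<^sup>2" by linarith
      then show ?thesis
        using c(2)[OF that] unfolding chain_form_chain[of W "_ - _"] by (simp add: inner_diff algebra_simps)
    qed
    then show ?thesis using c(1) unfolding stabilizing_gains_def by (intro CollectI exI[of _ "c / 2"]) auto
  qed
  then show "\<exists>e>0. \<forall>K'. dist K' K < e \<longrightarrow> K' \<in> stabilizing_gains b_lo b_hi \<Lambda>"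
    using assms s c by (intro exI[of _ e]) (auto simp: e_def)
qed

text \<open>
Let \<open>k\<close> represent the last filtered variable, that is \<open>k \<bullet> W = \<sigma>\<^sub>n\<close>. The feedback \<open>\<kappa> k\<close> contributes
\<open>- \<theta> \<kappa> \<sigma>\<^sub>n\<^sup>2\<close>, while all terms that are not already negative carry a factor \<open>\<bar>\<sigma>\<^sub>n\<bar>\<close>. Hence the whole ray
of sufficiently large \<open>\<kappa>\<close> is stabilizing.
\<close>

lemma unbounded_stabilizing_gains:
  assumes "0 < b_lo" "0 \<le> \<Lambda>"
  shows "\<not> bounded (stabilizing_gains b_lo b_hi \<Lambda> :: (real \<times> (real ^ 'n)) set)"
proof -
  let ?n = "CARD('n)"
  \<comment> \<open>Riesz representation of the last filtered variable.\<close>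
  define k where "k = (\<Sum>b\<in>Basis. filtered ?n b *\<^sub>R (b :: real \<times> (real ^ 'n)))"
  have k: "k \<bullet> W = filtered ?n W" for W
  proof -
    have "filtered ?n W = filtered ?n (\<Sum>b\<in>Basis. (W \<bullet> b) *\<^sub>R b)" by (simp add: euclidean_representation)
    then show ?thesis
      unfolding linear_sum[OF filtered_linear] linear_scale[OF filtered_linear] k_def
      by (simp add: inner_sum_left inner_commute[of W] mult.commute)
  qed
  have "k \<bullet> chain 0 1 = 1"
    unfolding k by (simp add: filtered_chain linear_0[OF filtered_linear])
  then have k0: "norm k > 0" by auto
  obtain l where l: "l > 0" "\<And>W :: real \<times> (real ^ 'n). l * (norm W)\<^sup>2 \<le> chain_form W W"
    using chain_form_lower_bound by blast
  obtain s where s: "s > 0" "\<And>W :: real \<times> (real ^ 'n). norm (filtered (Suc ?n) W) \<le> s * norm W"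
    using linear_bounded_pos[OF filtered_linear[of "Suc ?n"]] by metis
  define m where "m = s + \<Lambda>"
  define \<kappa>\<^sub>0 where "\<kappa>\<^sub>0 = m\<^sup>2 / (2 * l * b_lo)"
  have large: "\<kappa> *\<^sub>R k \<in> stabilizing_gains b_lo b_hi \<Lambda>" if \<kappa>: "\<kappa> \<ge> \<kappa>\<^sub>0" "\<kappa> \<ge> 0" for \<kappa>
  proof -
    have "chain_form W (chain W (- \<Delta> - \<theta> * ((\<kappa> *\<^sub>R k) \<bullet> W))) \<le> - (l / 2) * (norm W)\<^sup>2"
      if A: "b_lo \<le> \<theta>" "\<bar>\<Delta>\<bar> \<le> \<Lambda> * norm W" for W \<theta> \<Delta>
    proof -
      let ?S = "filtered ?n W"
      have 1: "?S * filtered (Suc ?n) W \<le> \<bar>?S\<bar> * (s * norm W)"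
      proof -
        have "?S * filtered (Suc ?n) W \<le> \<bar>?S\<bar> * \<bar>filtered (Suc ?n) W\<bar>"
          unfolding abs_mult[symmetric] by (rule abs_ge_self)
        also have "\<dots> \<le> \<bar>?S\<bar> * (s * norm W)"
          using s(2)[of W] by (intro mult_left_mono) auto
        finally show ?thesis .
      qed
      have 2: "- \<Delta> * ?S \<le> \<bar>?S\<bar> * (\<Lambda> * norm W)"
      proof -
        have "- \<Delta> * ?S \<le> \<bar>?S\<bar> * \<bar>\<Delta>\<bar>"
          unfolding abs_mult[symmetric] by (metis abs_ge_self abs_minus_cancel minus_mult_left mult.commute)
        also have "\<dots> \<le> \<bar>?S\<bar> * (\<Lambda> * norm W)"
          using A(2) by (intro mult_left_mono) auto
        finally show ?thesis .
      qed
      have "\<kappa>\<^sub>0 * b_lo \<le> \<kappa> * \<theta>"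
        using \<kappa> A assms by (intro mult_mono) (auto simp: \<kappa>\<^sub>0_def)
      then have "m\<^sup>2 / (2 * l) \<le> \<theta> * \<kappa>"
        using assms l by (simp add: \<kappa>\<^sub>0_def field_simps)
      then have 3: "m\<^sup>2 / (2 * l) * ?S\<^sup>2 \<le> \<theta> * \<kappa> * ?S\<^sup>2"
        by (rule mult_right_mono) simp
      \<comment> \<open>Young's inequality for the cross term \<open>m \<bar>W\<bar> \<bar>\<sigma>\<^sub>n\<bar>\<close>.\<close>
      have "0 \<le> (l * norm W - m * \<bar>?S\<bar>)\<^sup>2 / (2 * l)" using l by simp
      also have "\<dots> = l / 2 * (norm W)\<^sup>2 - \<bar>?S\<bar> * (m * norm W) + m\<^sup>2 / (2 * l) * ?S\<^sup>2"
        using l by (simp add: power2_diff power_mult_distrib field_simps) (simp add: power2_eq_square)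
      finally have 4: "\<bar>?S\<bar> * (s * norm W) + \<bar>?S\<bar> * (\<Lambda> * norm W) \<le> l / 2 * (norm W)\<^sup>2 + m\<^sup>2 / (2 * l) * ?S\<^sup>2"
        by (simp add: m_def algebra_simps)
      have 5: "- (\<theta> * (\<kappa> * ?S)) * ?S = - (\<theta> * \<kappa> * ?S\<^sup>2)" by (simp add: power2_eq_square)
      have "chain_form W (chain W (- \<Delta> - \<theta> * (\<kappa> * ?S))) \<le> - chain_form W W + ?S * filtered (Suc ?n) W
         + - \<Delta> * ?S + - (\<theta> * (\<kappa> * ?S)) * ?S"
        using chain_form_nominal[of W] unfolding chain_form_chain[of W "_ - _"] by (simp add: algebra_simps)
      then show ?thesis
        using l(2)[of W] 1 2 3 4 unfolding 5 by (simp add: k)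
    qed
    then show ?thesis using l(1) unfolding stabilizing_gains_def by (intro CollectI exI[of _ "l / 2"]) auto
  qed
  show ?thesis
  proof
    assume "bounded (stabilizing_gains b_lo b_hi \<Lambda> :: (real \<times> (real ^ 'n)) set)"
    then obtain R where R: "\<And>K. K \<in> (stabilizing_gains b_lo b_hi \<Lambda> :: (real \<times> (real ^ 'n)) set) \<Longrightarrow> norm K \<le> R"
      unfolding bounded_iff by blast
    define \<kappa> where "\<kappa> = max (max \<kappa>\<^sub>0 0) ((R + 1) / norm k)"
    have "norm (\<kappa> *\<^sub>R k) \<le> R" by (intro R large) (auto simp: \<kappa>_def)
    moreover have "R + 1 \<le> \<kappa> * norm k"
      using k0 by (simp add: \<kappa>_def flip: pos_divide_le_eq)
    moreover have "\<kappa> \<ge> 0" by (simp add: \<kappa>_def)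
    ultimately show False by simp
  qed
qed

text \<open>
Without integral action the chain at rest with a nonzero integrator state would be an equilibrium.
\<close>

lemma stabilizing_gains_integral_nonzero:
  assumes "(k0, k) \<in> stabilizing_gains b_lo b_hi \<Lambda>" "b_lo \<le> b_hi" "0 \<le> \<Lambda>"
  shows "k0 \<noteq> 0"
proof
  assume "k0 = 0"
  \<comment> \<open>At this state \<open>K \<bullet> W = k0\<close>.\<close>
  let ?W = "(1, 0) :: real \<times> (real ^ 'a)"
  have "chain ?W 0 = 0" by (auto simp: chain_def linear_0[OF linear_shift] zero_prod_def)
  then have "chain_form ?W (chain ?W (- 0 - b_lo * ((k0, k) \<bullet> ?W))) = 0"
    using \<open>k0 = 0\<close> by (simp add: chain_form_def linear_0[OF filtered_linear])
  moreover obtain c where c: "c > 0" "\<And>W \<theta> \<Delta>. b_lo \<le> \<theta> \<Longrightarrow> \<theta> \<le> b_hi \<Longrightarrow> \<bar>\<Delta>\<bar> \<le> \<Lambda> * norm W \<Longrightarrow>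
     chain_form W (chain W (- \<Delta> - \<theta> * ((k0, k) \<bullet> W))) \<le> - c * (norm W)\<^sup>2"
    using assms(1) unfolding stabilizing_gains_def by blast
  moreover have "\<bar>0\<bar> \<le> \<Lambda> * norm ?W" using assms(3) by simp
  ultimately show False
    using c(2)[of b_lo 0 ?W] assms(2) by (simp add: norm_Pair)
qed

section \<open>Feedback of the observer state\<close>

text \<open>
In these coordinates the gains \<open>\<beta>\<^sub>i / \<epsilon>\<^sup>i\<close> of the observer become \<open>\<beta>\<^sub>i\<close>, at the price of a factor
\<open>1 / \<epsilon>\<close> in front of the dynamics.
\<close>

definition scale_error :: "real \<Rightarrow> real ^ 'n \<Rightarrow> real ^ 'n" where
  "scale_error \<epsilon> \<xi> = tuple (\<lambda>i. \<xi> $# i / \<epsilon> ^ (CARD('n) - i))"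

lemma scale_error_linear: "linear (scale_error \<epsilon>)"
  unfolding scale_error_def by (intro linear_tupleI linearI) (auto simp: add_divide_distrib)

lemma scale_error_nth_comp:
  "1 \<le> i \<Longrightarrow> i \<le> CARD('n) \<Longrightarrow> scale_error \<epsilon> \<xi> $# i = (\<xi> :: real ^ 'n) $# i / \<epsilon> ^ (CARD('n) - i)"
  by (simp add: scale_error_def tuple_nth_comp)

lemma norm_le_scale_error:
  assumes "0 < \<epsilon>" "\<epsilon> \<le> 1"
  shows "norm \<xi> \<le> norm (scale_error \<epsilon> (\<xi> :: real ^ 'n))"
proof -
  have "(\<xi> $# i)\<^sup>2 \<le> (scale_error \<epsilon> \<xi> $# i)\<^sup>2" if i: "i \<in> {1..CARD('n)}" for i
  proof -
    have "\<bar>\<xi> $# i\<bar> * \<epsilon> ^ (CARD('n) - i) \<le> \<bar>\<xi> $# i\<bar>"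
      using assms by (intro mult_right_le_one_le) (auto intro: power_le_one)
    then have "\<bar>\<xi> $# i\<bar> \<le> \<bar>\<xi> $# i / \<epsilon> ^ (CARD('n) - i)\<bar>"
      using assms by (simp add: abs_divide field_simps)
    then show ?thesis
      unfolding abs_le_square_iff[symmetric] using i by (simp add: scale_error_nth_comp)
  qed
  then have "(norm \<xi>)\<^sup>2 \<le> (norm (scale_error \<epsilon> \<xi>))\<^sup>2"
    unfolding norm_nth_comp by (rule sum_mono)
  then show ?thesis by (rule power2_le_imp_le) simp
qed

lemma scale_error_dynamics:
  assumes "\<epsilon> > 0"
  shows "scale_error \<epsilon> (shift E v - observer_rhs \<beta> \<epsilon> (E $# 1) z) =
    (1 / \<epsilon>) *\<^sub>R observer_map \<beta> (scale_error \<epsilon> (E - z)) + v *\<^sub>R (unit_vec CARD('n) :: real ^ 'n)"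
proof (rule vec_eqI_nth_comp)
  fix i assume i: "1 \<le> i" "i \<le> CARD('n)"
  let ?n = "CARD('n)"
  have n: "\<epsilon> * \<epsilon> ^ (?n - 1) = \<epsilon> ^ i * \<epsilon> ^ (?n - i)"
    using i by (simp flip: power_add power_Suc)
  have b: "\<beta> $# i / \<epsilon> ^ i * (E $# 1 - z $# 1) / \<epsilon> ^ (?n - i) = (1 / \<epsilon>) * ((E $# 1 - z $# 1) / \<epsilon> ^ (?n - 1) * \<beta> $# i)"
    using n by (simp add: field_simps)
  show "scale_error \<epsilon> (shift E v - observer_rhs \<beta> \<epsilon> (E $# 1) z) $# i =
    ((1 / \<epsilon>) *\<^sub>R observer_map \<beta> (scale_error \<epsilon> (E - z)) + v *\<^sub>R unit_vec ?n) $# i"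
  proof -
    have one: "Suc 0 \<le> ?n" by (simp add: Suc_le_eq)
    have "scale_error \<epsilon> (shift E v - observer_rhs \<beta> \<epsilon> (E $# 1) z) $# i =
      ((if i < ?n then E $# (i + 1) - z $# (i + 1) else v) - \<beta> $# i / \<epsilon> ^ i * (E $# 1 - z $# 1)) / \<epsilon> ^ (?n - i)"
      using i by (auto simp: scale_error_nth_comp shift_nth_comp observer_rhs_def tuple_nth_comp)
    also have "\<dots> = (if i < ?n then E $# (i + 1) - z $# (i + 1) else v) / \<epsilon> ^ (?n - i)
      - (1 / \<epsilon>) * ((E $# 1 - z $# 1) / \<epsilon> ^ (?n - 1) * \<beta> $# i)"
      unfolding diff_divide_distrib b ..
    also have "(if i < ?n then E $# (i + 1) - z $# (i + 1) else v) / \<epsilon> ^ (?n - i) =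
      (1 / \<epsilon>) * (if i < ?n then (E - z) $# (i + 1) / \<epsilon> ^ (?n - (i + 1)) else 0) + (if i = ?n then v else 0)"
    proof (cases "i < ?n")
      case True
      then have "\<epsilon> ^ (?n - i) = \<epsilon> * \<epsilon> ^ (?n - (i + 1))"
        by (metis Suc_diff_Suc Suc_eq_plus1 power_Suc)
      then show ?thesis using True by simp
    qed (use i in auto)
    finally show ?thesis
      using i one by (simp add: scale_error_nth_comp shift_nth_comp observer_map_def tuple_nth_comp algebra_simps)
  qed
qed

text \<open>
The part of the input that is due to estimation errors. The sum starts at 2 because the controller
uses the measured error itself, not its estimate.
\<close>

definition estimation_gap :: "real ^ 'n \<Rightarrow> real ^ 'n \<Rightarrow> real" where
  "estimation_gap k \<xi> = (\<Sum>j=2..CARD('n). k $# j * \<xi> $# j)"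

lemma estimation_gap_bound: "\<bar>estimation_gap k \<xi>\<bar> \<le> CARD('n) * norm k * norm (\<xi> :: real ^ 'n)"
proof -
  have "\<bar>estimation_gap k \<xi>\<bar> \<le> (\<Sum>j=2..CARD('n). norm k * norm \<xi>)"
    unfolding estimation_gap_def
    by (intro order_trans[OF sum_abs] sum_mono) (auto simp: abs_mult intro!: mult_mono abs_nth_comp_le)
  also have "\<dots> \<le> (\<Sum>j=1..CARD('n). norm k * norm \<xi>)"
    by (intro sum_mono2) auto
  finally show ?thesis by simp
qed

lemma pid_input_eq:
  fixes k :: "real ^ 'n"
  assumes "fst W = x0 - xs" "snd W = E"
  shows "pid_input k0 k (E $# 1) x0 z = (k0, k) \<bullet> W - estimation_gap k (E - z) + k0 * xs"
proof -
  have "{1..CARD('n)} = insert 1 {2..CARD('n)}"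
    by (auto simp: Suc_le_eq)
  then have "k \<bullet> E = k $# 1 * E $# 1 + (\<Sum>j=2..CARD('n). k $# j * E $# j)"
    unfolding inner_nth_comp by simp
  moreover have "x0 = fst W + xs" using assms by simp
  ultimately show ?thesis
    using assms(2) by (simp add: pid_input_def estimation_gap_def inner_prod_def sum_subtractf algebra_simps)
qed

text \<open>
The closed loop with the plant reduced to what is known about it: an integrator chain whose input gain
\<open>\<theta>\<close> and drift \<open>\<Delta>\<close> are arbitrary within their bounds at each instant.
\<close>

definition observer_loop ::
  "real \<Rightarrow> real \<Rightarrow> real \<Rightarrow> real ^ 'n \<Rightarrow> real \<times> (real ^ 'n) \<Rightarrow> real \<Rightarrow> real \<Rightarrow>
   (real \<Rightarrow> real \<times> (real ^ 'n)) \<Rightarrow> (real \<Rightarrow> real ^ 'n) \<Rightarrow> (real \<Rightarrow> real) \<Rightarrow> bool" where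
  "observer_loop b_lo b_hi \<Lambda> \<beta> K \<epsilon> T W z v \<longleftrightarrow> (\<forall>t\<in>{0..T}.
     (W has_vector_derivative chain (W t) (v t)) (at t within {0..T}) \<and>
     (z has_vector_derivative observer_rhs \<beta> \<epsilon> (snd (W t) $# 1) (z t)) (at t within {0..T}) \<and>
     (\<exists>\<theta> \<Delta>. b_lo \<le> \<theta> \<and> \<theta> \<le> b_hi \<and> \<bar>\<Delta>\<bar> \<le> \<Lambda> * norm (W t) \<and>
        v t = - \<Delta> - \<theta> * (K \<bullet> W t - estimation_gap (snd K) (snd (W t) - z t))))"

text \<open>
The sum of the two Lyapunov forms is a Lyapunov function for the interconnection. The coupling
terms are bounded by multiples of \<open>\<bar>W\<bar> \<bar>\<eta>\<bar>\<close> and \<open>\<bar>\<eta>\<bar>\<^sup>2\<close> that do not depend on \<open>\<epsilon>\<close>, whereas the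
observer contributes \<open>- (c\<^sub>1 / \<epsilon>) \<bar>\<eta>\<bar>\<^sup>2\<close>. The input \<open>v\<close> is included in the estimate because it is the last
component of the velocity of \<open>\<Phi>(x)\<close>.
\<close>

lemma observer_loop_decay:
  fixes \<beta> :: "real ^ 'n"
  assumes K: "K \<in> stabilizing_gains b_lo b_hi \<Lambda>" and b: "0 < b_lo" "0 < b_hi" and \<Lambda>: "0 \<le> \<Lambda>"
    and hurwitz: "Hurwitz (observer_poly \<beta>)"
  shows "\<exists>\<epsilon>_star>0. \<forall>\<epsilon>. 0 < \<epsilon> \<and> \<epsilon> < \<epsilon>_star \<longrightarrow> (\<exists>C \<alpha>. C > 0 \<and> \<alpha> > 0 \<and>
    (\<forall>T W z v. observer_loop b_lo b_hi \<Lambda> \<beta> K \<epsilon> T W z v \<longrightarrow>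
      (\<forall>t\<in>{0..T}. norm (W t) + norm (z t) + \<bar>v t\<bar> \<le> C * (norm (W 0) + norm (z 0)) * exp (- \<alpha> * t))))"
proof -
  let ?n = "CARD('n)" and ?A = "chain_form :: real \<times> (real ^ 'n) \<Rightarrow> _" and ?u = "unit_vec CARD('n) :: real ^ 'n"
  obtain c0 where c0: "c0 > 0" "\<And>W \<theta> \<Delta>. b_lo \<le> \<theta> \<Longrightarrow> \<theta> \<le> b_hi \<Longrightarrow> \<bar>\<Delta>\<bar> \<le> \<Lambda> * norm W \<Longrightarrow>
     chain_form W (chain W (- \<Delta> - \<theta> * (K \<bullet> W))) \<le> - c0 * (norm W)\<^sup>2"
    using K unfolding stabilizing_gains_def by blast
  obtain l where l: "l > 0" "\<And>W :: real \<times> (real ^ 'n). l * (norm W)\<^sup>2 \<le> chain_form W W"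
    using chain_form_lower_bound by blast
  obtain s where s: "s > 0" "\<And>W :: real \<times> (real ^ 'n). norm (filtered ?n W) \<le> s * norm W"
    using linear_bounded_pos[OF filtered_linear[of ?n]] by metis
  obtain B c1 where B: "bilinear B" "\<And>v w. B v w = B w v" "\<And>v. (norm v)\<^sup>2 \<le> B v v" "c1 > 0"
    and B_decay: "\<And>v. B v (observer_map \<beta> v) \<le> - c1 * (norm v)\<^sup>2"
    using observer_lyapunov_form[OF hurwitz] by blast
  have bbB: "bounded_bilinear B" using B(1) by (simp add: bilinear_conv_bounded_bilinear)
  obtain b' where b': "b' > 0" "\<And>v. norm (B v ?u) \<le> norm v * b'"
    using bounded_linear.pos_bounded[OF bounded_bilinear.bounded_linear_left[OF bbB, of ?u]] by blast
  define m where "m = ?n * norm (snd K)"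
  define p where "p = \<Lambda> + b_hi * (norm K + m)"
  define r where "r = b_hi * m * s + p * b'"
  have m: "m \<ge> 0" and p: "p \<ge> 0" using b \<Lambda> by (auto simp: m_def p_def)
  \<comment> \<open>The rate that the observer has to provide: \<open>r\<close> collects the coefficients of \<open>\<bar>W\<bar> \<bar>\<eta>\<bar>\<close>, the first
    term pays for it by Young's inequality, the second for the direct effect of \<open>\<eta>\<close> on its own
    input, and the third is the decrease that remains.\<close>
  define d where "d = r\<^sup>2 / (2 * c0) + p * b' + c0 / 2"
  have d: "d > 0" using c0 p b' by (auto simp: d_def intro!: add_nonneg_pos)
  \<comment> \<open>The bound by 1 makes the rescaled estimation error dominate the original one.\<close>
  define \<epsilon>_star where "\<epsilon>_star = min 1 (c1 / d)"
  define Q where "Q Y Z = ?A (fst Y) (fst Z) + B (snd Y) (snd Z)" for Y Z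
  have Q: "bilinear Q"
    unfolding bilinear_def Q_def
    by (intro conjI allI linearI)
      (simp_all add: bilinear_ladd[OF B(1)] bilinear_radd[OF B(1)] bilinear_lmul[OF B(1)] bilinear_rmul[OF B(1)]
        bilinear_ladd[OF bilinear_chain_form] bilinear_radd[OF bilinear_chain_form]
        bilinear_lmul[OF bilinear_chain_form] bilinear_rmul[OF bilinear_chain_form] algebra_simps)
  have Q_sym: "Q Y Z = Q Z Y" for Y Z
    unfolding Q_def using B(2) by (simp add: chain_form_def mult.commute)
  have Q_pos: "min l 1 * (norm Y)\<^sup>2 \<le> Q Y Y" for Y
  proof -
    have "min l 1 * (norm Y)\<^sup>2 = min l 1 * (norm (fst Y))\<^sup>2 + min l 1 * (norm (snd Y))\<^sup>2"
      by (simp add: norm_prod_def algebra_simps)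
    also have "\<dots> \<le> l * (norm (fst Y))\<^sup>2 + 1 * (norm (snd Y))\<^sup>2"
      by (intro add_mono mult_right_mono) auto
    also have "\<dots> \<le> Q Y Y" unfolding Q_def using l(2)[of "fst Y"] B(3)[of "snd Y"] by simp
    finally show ?thesis .
  qed
  have "min l 1 > 0" "c0 / 2 > 0" using l(1) c0(1) by auto
  from bilinear_form_decay[OF Q Q_sym this(1) Q_pos this(2)]
  obtain C \<alpha> where C: "C > 0" "\<alpha> > 0" and decay_all: "\<forall>T Y Y'. (\<forall>t\<in>{0..T}. (Y has_vector_derivative Y' t) (at t within {0..T}) \<and>
      Q (Y t) (Y' t) \<le> - (c0 / 2) * (norm (Y t))\<^sup>2) \<longrightarrow> (\<forall>t\<in>{0..T}. norm (Y t) \<le> C * norm (Y 0) * exp (- \<alpha> * t))"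
    by (elim exE conjE) (rule that)
  have decay: "norm (Y t) \<le> C * norm (Y 0) * exp (- \<alpha> * t)"
    if "\<And>t. t \<in> {0..T} \<Longrightarrow> (Y has_vector_derivative Y' t) (at t within {0..T})"
      "\<And>t. t \<in> {0..T} \<Longrightarrow> Q (Y t) (Y' t) \<le> - (c0 / 2) * (norm (Y t))\<^sup>2" "t \<in> {0..T}" for T Y Y' t
    using decay_all[rule_format, of T Y Y' t] that by simp
  have input_bound: "\<bar>v\<bar> \<le> p * (norm W + norm \<eta>)" and
    dissipation: "?A W (chain W v) + B \<eta> ((1 / \<epsilon>) *\<^sub>R observer_map \<beta> \<eta> + v *\<^sub>R ?u) \<le> - (c0 / 2) * ((norm W)\<^sup>2 + (norm \<eta>)\<^sup>2)"
    if \<epsilon>: "0 < \<epsilon>" "\<epsilon> < \<epsilon>_star" and \<theta>: "b_lo \<le> \<theta>" "\<theta> \<le> b_hi" and \<Delta>: "\<bar>\<Delta>\<bar> \<le> \<Lambda> * norm W"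
      and q: "\<bar>q\<bar> \<le> m * norm \<eta>" and v: "v = - \<Delta> - \<theta> * (K \<bullet> W - q)" for \<epsilon> \<theta> \<Delta> q v W \<eta>
  proof -
    have "\<bar>v\<bar> \<le> \<bar>\<Delta>\<bar> + \<bar>\<theta> * (K \<bullet> W - q)\<bar>" unfolding v by linarith
    also have "\<bar>\<theta> * (K \<bullet> W - q)\<bar> \<le> b_hi * (norm K * norm W + m * norm \<eta>)"
      unfolding abs_mult
    proof (rule mult_mono)
      show "\<bar>K \<bullet> W - q\<bar> \<le> norm K * norm W + m * norm \<eta>"
        using Cauchy_Schwarz_ineq2[of K W] q by linarith
    qed (use \<theta> b in auto)
    finally have "\<bar>v\<bar> \<le> \<Lambda> * norm W + b_hi * (norm K * norm W + m * norm \<eta>)" using \<Delta> by simp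
    also have "\<dots> \<le> p * (norm W + norm \<eta>)"
      using \<Lambda> b m by (simp add: p_def algebra_simps)
    finally show v_bound: "\<bar>v\<bar> \<le> p * (norm W + norm \<eta>)" .
    let ?X = "norm W" and ?Y = "norm \<eta>"
    have "?A W (chain W v) = ?A W (chain W (- \<Delta> - \<theta> * (K \<bullet> W))) + \<theta> * q * filtered ?n W"
      unfolding chain_form_chain[of W v] chain_form_chain[of W "_ - _"] v by (simp add: algebra_simps)
    moreover have "\<theta> * q * filtered ?n W \<le> (b_hi * (m * ?Y)) * (s * ?X)"
    proof -
      have "\<theta> * q * filtered ?n W \<le> \<bar>\<theta>\<bar> * \<bar>q\<bar> * \<bar>filtered ?n W\<bar>"
        by (metis abs_ge_self abs_mult)
      also have "\<dots> \<le> (b_hi * (m * ?Y)) * (s * ?X)"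
        using \<theta> b q s m by (intro mult_mono) auto
      finally show ?thesis .
    qed
    ultimately have 1: "?A W (chain W v) \<le> - c0 * ?X\<^sup>2 + b_hi * m * s * (?X * ?Y)"
      using c0(2)[OF \<theta> \<Delta>] by (simp add: algebra_simps)
    have "B \<eta> ((1 / \<epsilon>) *\<^sub>R observer_map \<beta> \<eta> + v *\<^sub>R ?u) = (1 / \<epsilon>) * B \<eta> (observer_map \<beta> \<eta>) + v * B \<eta> ?u"
      by (simp add: bilinear_radd[OF B(1)] bilinear_rmul[OF B(1)])
    moreover have "(1 / \<epsilon>) * B \<eta> (observer_map \<beta> \<eta>) \<le> - d * ?Y\<^sup>2"
    proof -
      have "\<epsilon> * d \<le> c1" using \<epsilon> d by (simp add: \<epsilon>_star_def pos_less_divide_eq)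
      then have "\<epsilon> * d * ?Y\<^sup>2 \<le> c1 * ?Y\<^sup>2" by (rule mult_right_mono) simp
      then have "B \<eta> (observer_map \<beta> \<eta>) \<le> - (\<epsilon> * d * ?Y\<^sup>2)" using B_decay[of \<eta>] by linarith
      then have "(1 / \<epsilon>) * B \<eta> (observer_map \<beta> \<eta>) \<le> (1 / \<epsilon>) * - (\<epsilon> * d * ?Y\<^sup>2)"
        using \<epsilon> by (intro mult_left_mono) auto
      then show ?thesis using \<epsilon> by simp
    qed
    moreover have "v * B \<eta> ?u \<le> (p * (?X + ?Y)) * (?Y * b')"
    proof -
      have "v * B \<eta> ?u \<le> \<bar>v\<bar> * \<bar>B \<eta> ?u\<bar>" by (metis abs_ge_self abs_mult)
      also have "\<dots> \<le> (p * (?X + ?Y)) * (?Y * b')"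
        using b'(2)[of \<eta>] v_bound p by (intro mult_mono) auto
      finally show ?thesis .
    qed
    ultimately have 2: "B \<eta> ((1 / \<epsilon>) *\<^sub>R observer_map \<beta> \<eta> + v *\<^sub>R ?u) \<le> - d * ?Y\<^sup>2 + p * b' * (?X * ?Y) + p * b' * ?Y\<^sup>2"
      by (simp add: algebra_simps power2_eq_square)
    have "0 \<le> (c0 * ?X - r * ?Y)\<^sup>2 / (2 * c0)" using c0 by simp
    also have "\<dots> = c0 / 2 * ?X\<^sup>2 - r * (?X * ?Y) + r\<^sup>2 / (2 * c0) * ?Y\<^sup>2"
      using c0 by (simp add: power2_diff power_mult_distrib field_simps) (simp add: power2_eq_square)
    finally have 3: "r * (?X * ?Y) \<le> c0 / 2 * ?X\<^sup>2 + r\<^sup>2 / (2 * c0) * ?Y\<^sup>2" by simp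
    have 4: "r * (?X * ?Y) = b_hi * m * s * (?X * ?Y) + p * b' * (?X * ?Y)"
      by (simp add: r_def algebra_simps)
    have 5: "d * ?Y\<^sup>2 = r\<^sup>2 / (2 * c0) * ?Y\<^sup>2 + p * b' * ?Y\<^sup>2 + c0 / 2 * ?Y\<^sup>2"
      by (simp add: d_def algebra_simps)
    show "?A W (chain W v) + B \<eta> ((1 / \<epsilon>) *\<^sub>R observer_map \<beta> \<eta> + v *\<^sub>R ?u) \<le> - (c0 / 2) * (?X\<^sup>2 + ?Y\<^sup>2)"
      using 1 2 3 4 5 by (simp add: algebra_simps)
  qed
  have "\<exists>C \<alpha>. C > 0 \<and> \<alpha> > 0 \<and> (\<forall>T W z v. observer_loop b_lo b_hi \<Lambda> \<beta> K \<epsilon> T W z v \<longrightarrow>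
      (\<forall>t\<in>{0..T}. norm (W t) + norm (z t) + \<bar>v t\<bar> \<le> C * (norm (W 0) + norm (z 0)) * exp (- \<alpha> * t)))"
    if \<epsilon>: "0 < \<epsilon>" "\<epsilon> < \<epsilon>_star" for \<epsilon>
  proof -
    have \<epsilon>1: "\<epsilon> \<le> 1" using \<epsilon> by (simp add: \<epsilon>_star_def)
    obtain S where S: "S > 0" "\<And>\<xi> :: real ^ 'n. norm (scale_error \<epsilon> \<xi>) \<le> S * norm \<xi>"
      using linear_bounded_pos[OF scale_error_linear[of \<epsilon>]] by metis
    define C' where "C' = (3 + 2 * p) * C * (1 + S)"
    have "norm (W t) + norm (z t) + \<bar>v t\<bar> \<le> C' * (norm (W 0) + norm (z 0)) * exp (- \<alpha> * t)"
      if loop: "observer_loop b_lo b_hi \<Lambda> \<beta> K \<epsilon> T W z v" and t: "t \<in> {0..T}" for T W z v t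
    proof -
      define \<eta> where "\<eta> t = scale_error \<epsilon> (snd (W t) - z t)" for t
      define Y' where "Y' t = (chain (W t) (v t), (1 / \<epsilon>) *\<^sub>R observer_map \<beta> (\<eta> t) + v t *\<^sub>R ?u)" for t
      have gap: "\<bar>estimation_gap (snd K) (snd (W t) - z t)\<bar> \<le> m * norm (\<eta> t)" for t
        unfolding m_def \<eta>_def
        by (rule order_trans[OF estimation_gap_bound], rule mult_left_mono[OF norm_le_scale_error[OF \<epsilon>(1) \<epsilon>1]]) simp
      have *: "\<bar>v t\<bar> \<le> p * (norm (W t) + norm (\<eta> t))"
          "Q (W t, \<eta> t) (Y' t) \<le> - (c0 / 2) * (norm (W t, \<eta> t))\<^sup>2" if "t \<in> {0..T}" for t
      proof -
        have "\<exists>\<theta> \<Delta>. b_lo \<le> \<theta> \<and> \<theta> \<le> b_hi \<and> \<bar>\<Delta>\<bar> \<le> \<Lambda> * norm (W t) \<and>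
          v t = - \<Delta> - \<theta> * (K \<bullet> W t - estimation_gap (snd K) (snd (W t) - z t))"
          using loop[unfolded observer_loop_def, THEN bspec, OF that] by (elim conjE)
        then obtain \<theta> \<Delta> where "b_lo \<le> \<theta>" "\<theta> \<le> b_hi" "\<bar>\<Delta>\<bar> \<le> \<Lambda> * norm (W t)"
          "v t = - \<Delta> - \<theta> * (K \<bullet> W t - estimation_gap (snd K) (snd (W t) - z t))"
          by (elim exE conjE) (rule that)
        note x = \<epsilon> this(1-3) gap this(4)
        show "\<bar>v t\<bar> \<le> p * (norm (W t) + norm (\<eta> t))" by (rule input_bound[OF x])
        show "Q (W t, \<eta> t) (Y' t) \<le> - (c0 / 2) * (norm (W t, \<eta> t))\<^sup>2"
          using dissipation[OF x] by (simp add: Q_def Y'_def norm_Pair)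
      qed
      have "((\<lambda>t. (W t, \<eta> t)) has_vector_derivative Y' t) (at t within {0..T})" if "t \<in> {0..T}" for t
      proof -
        have W': "(W has_vector_derivative chain (W t) (v t)) (at t within {0..T})"
          and z': "(z has_vector_derivative observer_rhs \<beta> \<epsilon> (snd (W t) $# 1) (z t)) (at t within {0..T})"
          using loop that unfolding observer_loop_def by auto
        have "((\<lambda>t. snd (W t) - z t) has_vector_derivative shift (snd (W t)) (v t) - observer_rhs \<beta> \<epsilon> (snd (W t) $# 1) (z t)) (at t within {0..T})"
          using has_vector_derivative_diff[OF bounded_linear.has_vector_derivative[OF bounded_linear_snd W'] z']
          by (simp add: chain_def)
        then have "(\<eta> has_vector_derivative (1 / \<epsilon>) *\<^sub>R observer_map \<beta> (\<eta> t) + v t *\<^sub>R ?u) (at t within {0..T})"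
          unfolding \<eta>_def scale_error_dynamics[OF \<epsilon>(1), symmetric]
          by (rule bounded_linear.has_vector_derivative[OF linear_conv_bounded_linear[THEN iffD1, OF scale_error_linear]])
        then show ?thesis unfolding Y'_def by (intro has_vector_derivative_Pair W')
      qed
      from decay[of T "\<lambda>t. (W t, \<eta> t)" Y' t, OF this *(2) t]
      have Y: "norm (W t, \<eta> t) \<le> C * norm (W 0, \<eta> 0) * exp (- \<alpha> * t)" by simp
      have WY: "norm (W t) \<le> norm (W t, \<eta> t)" "norm (\<eta> t) \<le> norm (W t, \<eta> t)"
        using norm_fst_le[of "W t" "\<eta> t"] norm_snd_le[of "\<eta> t" "W t"] by auto
      have z: "norm (z t) \<le> norm (W t) + norm (\<eta> t)"
      proof -
        have "norm (z t) \<le> norm (snd (W t)) + norm (snd (W t) - z t)"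
          using norm_triangle_ineq4[of "snd (W t)" "snd (W t) - z t"] by simp
        also have "\<dots> \<le> norm (W t) + norm (\<eta> t)"
          unfolding \<eta>_def using norm_le_scale_error[OF \<epsilon>(1) \<epsilon>1] norm_snd_le[of "snd (W t)" "fst (W t)"]
          by (intro add_mono) auto
        finally show ?thesis .
      qed
      have "p * (norm (W t) + norm (\<eta> t)) \<le> p * (2 * norm (W t, \<eta> t))"
        using WY p by (intro mult_left_mono) auto
      then have "norm (W t) + norm (z t) + \<bar>v t\<bar> \<le> (3 + 2 * p) * norm (W t, \<eta> t)"
        using z *(1)[OF t] WY by (simp add: algebra_simps)
      also have "\<dots> \<le> (3 + 2 * p) * (C * norm (W 0, \<eta> 0) * exp (- \<alpha> * t))"
        using Y p by (intro mult_left_mono) auto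
      also have "norm (W 0, \<eta> 0) \<le> (1 + S) * (norm (W 0) + norm (z 0))"
      proof -
        have "norm (W 0, \<eta> 0) \<le> norm (W 0) + norm (\<eta> 0)" by (rule norm_Pair_le)
        also have "norm (\<eta> 0) \<le> S * (norm (W 0) + norm (z 0))"
        proof -
          have "norm (\<eta> 0) \<le> S * norm (snd (W 0) - z 0)" unfolding \<eta>_def by (rule S)
          also have "\<dots> \<le> S * (norm (W 0) + norm (z 0))"
            using S(1) norm_triangle_ineq4[of "snd (W 0)" "z 0"] norm_snd_le[of "snd (W 0)" "fst (W 0)"]
            by (intro mult_left_mono) auto
          finally show ?thesis .
        qed
        also have "norm (W 0) + S * (norm (W 0) + norm (z 0)) \<le> (1 + S) * (norm (W 0) + norm (z 0))"
          by (simp add: algebra_simps)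
        finally show ?thesis by simp
      qed
      then have "(3 + 2 * p) * (C * norm (W 0, \<eta> 0) * exp (- \<alpha> * t)) \<le>
          (3 + 2 * p) * (C * ((1 + S) * (norm (W 0) + norm (z 0))) * exp (- \<alpha> * t))"
        using p C by (intro mult_left_mono mult_right_mono) auto
      finally show ?thesis by (simp add: C'_def algebra_simps)
    qed
    moreover have "C' > 0" using p C S by (simp add: C'_def)
    ultimately show ?thesis using C(2) by blast
  qed
  moreover have "\<epsilon>_star > 0" using B(4) d by (simp add: \<epsilon>_star_def)
  ultimately show ?thesis by blast
qed

section \<open>Global solutions from a priori bounds\<close>

lemma at_within_segment: "t \<ge> 0 \<Longrightarrow> at t within {0..t + 1} = at t within {0 :: real..}"
  by (rule at_within_nhd[of _ "{..<t + 1}"]) auto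

text \<open>
Picard-Lindeloef on the whole half-line. With \<open>y(t) = exp(- \<mu> t) x(t)\<close> the integral equation becomes a
fixed point problem for bounded continuous functions, and for \<open>\<mu> = 2 L + 1\<close> it is a contraction. The
operator is extended to negative times by its value at 0.
\<close>

lemma picard_global:
  fixes X :: "'a::euclidean_space \<Rightarrow> 'a"
  assumes lip: "L-lipschitz_on UNIV X"
  shows "\<exists>x. x 0 = a \<and> (\<forall>t\<ge>0. (x has_vector_derivative X (x t)) (at t within {0..}))"
proof -
  define \<mu> where "\<mu> = 2 * L + 1"
  have L: "L \<ge> 0" using lip by (rule lipschitz_on_nonneg)
  have \<mu>: "\<mu> > 0" using L by (simp add: \<mu>_def)
  have lipn: "norm (X u - X v) \<le> L * norm (u - v)" for u v
    using lipschitz_on_normD[OF lip] by auto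
  have X_cont: "continuous_on UNIV X" by (rule lipschitz_on_continuous_on[OF lip])
  define P where "P y t = a + integral {0..t} (\<lambda>s. X (exp (\<mu> * s) *\<^sub>R y s))" for y t
  define T where "T y t = exp (- \<mu> * max 0 t) *\<^sub>R P y (max 0 t)" for y t
  have int: "(\<lambda>s. X (exp (\<mu> * s) *\<^sub>R apply_bcontfun y s)) integrable_on {0..t}" for y t
    by (intro integrable_continuous_interval continuous_on_compose2[OF X_cont] continuous_intros) auto
  have int_exp: "((\<lambda>s. exp (\<mu> * s)) has_integral ((exp (\<mu> * t) - 1) / \<mu>)) {0..t}" if "t \<ge> 0" for t
  proof -
    have "((\<lambda>s. exp (\<mu> * s)) has_integral (exp (\<mu> * t) / \<mu> - exp (\<mu> * 0) / \<mu>)) {0..t}"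
      using \<mu> that by (intro fundamental_theorem_of_calculus)
        (auto intro!: derivative_eq_intros simp flip: has_real_derivative_iff_has_vector_derivative)
    then show ?thesis by (simp add: diff_divide_distrib)
  qed
  have P_cont: "continuous_on {0..} (P (apply_bcontfun y))" for y
  proof -
    have cont: "continuous_on {0..b} (P (apply_bcontfun y))" for b
      unfolding P_def by (intro continuous_intros indefinite_integral_continuous_1 int)
    show ?thesis
      unfolding continuous_on_eq_continuous_within
    proof
      fix t :: real assume "t \<in> {0..}"
      then have t: "t \<ge> 0" by simp
      then show "continuous (at t within {0..}) (P (apply_bcontfun y))"
        using cont[of "t + 1"] unfolding continuous_on_eq_continuous_within at_within_segment[OF t, symmetric] by simp
    qed
  qed
  have T_bd: "T (apply_bcontfun y) \<in> bcontfun" for y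
  proof (rule bcontfun_normI)
    show "continuous_on UNIV (T (apply_bcontfun y))"
      unfolding T_def by (intro continuous_intros continuous_on_compose2[OF P_cont]) auto
    fix t :: real
    let ?t = "max 0 t"
    have "norm (integral {0..?t} (\<lambda>s. X (exp (\<mu> * s) *\<^sub>R apply_bcontfun y s))) \<le>
      integral {0..?t} (\<lambda>s. (norm (X 0) + L * norm y) * exp (\<mu> * s))"
    proof (rule integral_norm_bound_integral[OF int])
      fix s assume s: "s \<in> {0..?t}"
      have "norm (X (exp (\<mu> * s) *\<^sub>R apply_bcontfun y s)) \<le> norm (X 0) + L * norm (exp (\<mu> * s) *\<^sub>R apply_bcontfun y s)"
        using lipn[of "exp (\<mu> * s) *\<^sub>R apply_bcontfun y s" 0] norm_triangle_sub[of "X (exp (\<mu> * s) *\<^sub>R apply_bcontfun y s)" "X 0"] by simp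
      also have "L * norm (exp (\<mu> * s) *\<^sub>R apply_bcontfun y s) \<le> L * (exp (\<mu> * s) * norm y)"
        using L norm_bounded[of y s] by (intro mult_left_mono) auto
      also have "norm (X 0) \<le> norm (X 0) * exp (\<mu> * s)"
        using s \<mu> by (simp add: mult_le_cancel_left1)
      finally show "norm (X (exp (\<mu> * s) *\<^sub>R apply_bcontfun y s)) \<le> (norm (X 0) + L * norm y) * exp (\<mu> * s)"
        by (simp add: algebra_simps)
    qed (intro integrable_continuous_interval continuous_intros)
    also have "\<dots> = (norm (X 0) + L * norm y) * ((exp (\<mu> * ?t) - 1) / \<mu>)"
      using int_exp[of ?t] by (simp add: integral_unique)
    also have "\<dots> \<le> (norm (X 0) + L * norm y) * (exp (\<mu> * ?t) / \<mu>)"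
      using L \<mu> by (intro mult_left_mono divide_right_mono) auto
    finally have "norm (P (apply_bcontfun y) ?t) \<le> norm a + (norm (X 0) + L * norm y) * (exp (\<mu> * ?t) / \<mu>)"
      unfolding P_def using norm_triangle_ineq by (smt (verit))
    then have "norm (T (apply_bcontfun y) t) \<le> exp (- \<mu> * ?t) * (norm a + (norm (X 0) + L * norm y) * (exp (\<mu> * ?t) / \<mu>))"
      unfolding T_def by simp
    also have "\<dots> = exp (- \<mu> * ?t) * norm a + (norm (X 0) + L * norm y) / \<mu>"
      by (simp add: algebra_simps exp_minus field_simps)
    also have "\<dots> \<le> norm a + (norm (X 0) + L * norm y) / \<mu>"
      using \<mu> by (simp add: mult_left_le_one_le)
    finally show "norm (T (apply_bcontfun y) t) \<le> norm a + (norm (X 0) + L * norm y) / \<mu>" .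
  qed
  define Q where "Q y = Bcontfun (T (apply_bcontfun y))" for y
  have Q: "apply_bcontfun (Q y) = T (apply_bcontfun y)" for y
    unfolding Q_def by (rule Bcontfun_inverse[OF T_bd])
  have "dist (Q y) (Q z) \<le> 1/2 * dist y z" for y z
  proof (rule dist_bound)
    fix t :: real
    let ?t = "max 0 t" and ?f = "\<lambda>y s. X (exp (\<mu> * s) *\<^sub>R apply_bcontfun y s)"
    have "norm (integral {0..?t} (\<lambda>s. ?f y s - ?f z s)) \<le> integral {0..?t} (\<lambda>s. (L * dist y z) * exp (\<mu> * s))"
    proof (rule integral_norm_bound_integral)
      fix s assume s: "s \<in> {0..?t}"
      have "norm (?f y s - ?f z s) \<le> L * norm (exp (\<mu> * s) *\<^sub>R (apply_bcontfun y s - apply_bcontfun z s))"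
        using lipn[of "exp (\<mu> * s) *\<^sub>R apply_bcontfun y s" "exp (\<mu> * s) *\<^sub>R apply_bcontfun z s"]
        by (simp add: scaleR_diff_right)
      also have "\<dots> \<le> L * (exp (\<mu> * s) * dist y z)"
        using L dist_bounded[of y s z] by (intro mult_left_mono) (auto simp: dist_norm)
      finally show "norm (?f y s - ?f z s) \<le> (L * dist y z) * exp (\<mu> * s)" by (simp add: algebra_simps)
    qed (intro integrable_diff int integrable_continuous_interval continuous_intros)+
    also have "\<dots> = (L * dist y z) * ((exp (\<mu> * ?t) - 1) / \<mu>)"
      using int_exp[of ?t] by (simp add: integral_unique)
    also have "\<dots> \<le> (L * dist y z) * (exp (\<mu> * ?t) / \<mu>)"
      using L \<mu> by (intro mult_left_mono divide_right_mono) auto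
    finally have *: "norm (P (apply_bcontfun y) ?t - P (apply_bcontfun z) ?t) \<le> (L * dist y z) * (exp (\<mu> * ?t) / \<mu>)"
      unfolding P_def by (simp add: integral_diff[OF int int])
    have "dist (apply_bcontfun (Q y) t) (apply_bcontfun (Q z) t) = exp (- \<mu> * ?t) * norm (P (apply_bcontfun y) ?t - P (apply_bcontfun z) ?t)"
      unfolding Q T_def dist_norm scaleR_diff_right[symmetric] by simp
    also have "\<dots> \<le> exp (- \<mu> * ?t) * ((L * dist y z) * (exp (\<mu> * ?t) / \<mu>))"
      using * by (intro mult_left_mono) auto
    also have "\<dots> = L / \<mu> * dist y z" by (simp add: exp_minus field_simps)
    also have "\<dots> \<le> 1/2 * dist y z"
      using L \<mu> by (intro mult_right_mono) (auto simp: \<mu>_def field_simps)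
    finally show "dist (apply_bcontfun (Q y) t) (apply_bcontfun (Q z) t) \<le> 1/2 * dist y z" .
  qed
  then obtain y where y: "Q y = y"
    using banach_fix_type[of "1/2" Q] by auto
  define x where "x t = exp (\<mu> * t) *\<^sub>R apply_bcontfun y t" for t
  have x: "x t = a + integral {0..t} (\<lambda>s. X (x s))" if "t \<ge> 0" for t
  proof -
    have "apply_bcontfun y t = exp (- \<mu> * t) *\<^sub>R P (apply_bcontfun y) t"
      using fun_cong[OF Q[of y], of t] that unfolding y T_def by simp
    then show ?thesis by (simp add: x_def P_def exp_minus)
  qed
  have x_cont: "continuous_on UNIV x" unfolding x_def by (intro continuous_intros continuous_on_apply_bcontfun)
  have "(x has_vector_derivative X (x t)) (at t within {0..})" if "t \<ge> 0" for t
  proof -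
    have "((\<lambda>t. integral {0..t} (\<lambda>s. X (x s))) has_vector_derivative X (x t)) (at t within {0..t+1})"
      using that by (intro integral_has_vector_derivative continuous_on_compose2[OF X_cont] continuous_on_subset[OF x_cont]) auto
    then have "((\<lambda>t. a + integral {0..t} (\<lambda>s. X (x s))) has_vector_derivative X (x t)) (at t within {0..t+1})"
      by (auto intro!: derivative_eq_intros)
    then have "(x has_vector_derivative X (x t)) (at t within {0..t+1})"
      using that by (auto elim!: has_vector_derivative_transform[rotated 2] simp: x)
    then show ?thesis unfolding at_within_segment[OF that] .
  qed
  moreover have "x 0 = a" using x[of 0] by simp
  ultimately show ?thesis by blast
qed

text \<open>
Composing the field with the projection onto a ball of radius \<open>R + 1\<close> makes it globally Lipschitz.
The solution of the truncated equation solves the original one until it leaves that ball, and up to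
then it satisfies the a priori bound \<open>R\<close>; so it never leaves.
\<close>

lemma global_solution_of_bounded:
  fixes X :: "'a::euclidean_space \<Rightarrow> 'a"
  assumes lip: "\<And>R. \<exists>L. L-lipschitz_on (cball 0 R) X"
    and bound: "\<And>T x. 0 \<le> T \<Longrightarrow> x 0 = a \<Longrightarrow>
      (\<And>t. t \<in> {0..T} \<Longrightarrow> (x has_vector_derivative X (x t)) (at t within {0..T})) \<Longrightarrow> norm (x T) \<le> R"
  shows "\<exists>x. x 0 = a \<and> (\<forall>t\<ge>0. (x has_vector_derivative X (x t)) (at t within {0..}))"
proof -
  have a: "norm a \<le> R"
  proof -
    have "((\<lambda>t. a + t *\<^sub>R X a) has_vector_derivative X a) (at 0 within {0..0})"
      by (auto intro!: derivative_eq_intros)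
    then show ?thesis
      using bound[of 0 "\<lambda>t. a + t *\<^sub>R X a"] by auto
  qed
  let ?p = "closest_point (cball 0 (R + 1) :: 'a set)"
  have ne: "cball 0 (R + 1) \<noteq> ({} :: 'a set)" using a norm_ge_zero[of a] by (simp del: norm_ge_zero)
  obtain L where "L-lipschitz_on (cball 0 (R + 1)) X" using lip by blast
  moreover have "1-lipschitz_on UNIV ?p"
    using closest_point_lipschitz[OF convex_cball closed_cball ne] by (intro lipschitz_onI) auto
  moreover have "range ?p \<subseteq> cball 0 (R + 1)"
    using closest_point_in_set[OF closed_cball ne] by auto
  ultimately have "(L * 1)-lipschitz_on UNIV (\<lambda>x. X (?p x))"
    by (intro lipschitz_on_compose2) (auto intro: lipschitz_on_subset)
  from picard_global[OF this] obtain x where x0: "x 0 = a"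
    and x: "\<And>t. t \<ge> 0 \<Longrightarrow> (x has_vector_derivative X (?p (x t))) (at t within {0..})" by auto
  have cont: "continuous_on {0..} x"
    using x by (auto simp: continuous_on_eq_continuous_within intro: has_vector_derivative_continuous)
  have small: "norm (x T) \<le> R" if "T \<ge> 0" "\<And>t. t \<in> {0..T} \<Longrightarrow> norm (x t) \<le> R + 1" for T
  proof (rule bound[where x = x, OF that(1) x0])
    fix t assume "t \<in> {0..T}"
    then show "(x has_vector_derivative X (x t)) (at t within {0..T})"
      using x[of t] closest_point_self[of "x t" "cball 0 (R+1)"] that(2)[of t]
      by (auto intro: has_vector_derivative_within_subset)
  qed
  have "norm (x T) \<le> R + 1" if T: "T \<ge> 0" for T
  proof (rule ccontr)
    assume nT: "\<not> norm (x T) \<le> R + 1"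
    \<comment> \<open>The first time at which the solution reaches the sphere of radius \<open>R + 1\<close> is \<open>Inf S\<close>.\<close>
    define S where "S = {t\<in>{0..T}. norm (x t) \<ge> R + 1}"
    have cT: "continuous_on {0..T} (\<lambda>t. norm (x t))"
      by (intro continuous_intros continuous_on_subset[OF cont]) auto
    have "S = {0..T} \<inter> (\<lambda>t. norm (x t)) -` {R + 1..}" by (auto simp: S_def)
    then have "closed S" using continuous_closed_preimage[OF cT] by simp
    moreover have ne: "S \<noteq> {}" using nT T by (auto simp: S_def)
    moreover have bd: "bdd_below S" by (auto simp: S_def bdd_below_def)
    ultimately have inS: "Inf S \<in> S" by (intro closed_contains_Inf)
    have before: "norm (x t) \<le> R + 1" if "t \<in> {0..<Inf S}" for t
      using that inS cInf_lower[OF _ bd, of t] by (force simp: S_def)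
    have "norm (x (Inf S)) \<le> R + 1"
    proof (cases "Inf S = 0")
      case True then show ?thesis using x0 a by simp
    next
      case False
      then have pos: "Inf S > 0" using inS by (auto simp: S_def)
      have "continuous_on {0..Inf S} (\<lambda>t. norm (x t))"
        by (rule continuous_on_subset[OF cT]) (use inS in \<open>auto simp: S_def\<close>)
      moreover have "Inf S \<in> closure {0..<Inf S}" using pos by simp
      ultimately show ?thesis
        using continuous_le_on_closure[of "{0..<Inf S}" "\<lambda>t. norm (x t)" "Inf S" "R + 1"] before pos by simp
    qed
    then have "norm (x (Inf S)) \<le> R"
      using before inS by (intro small) (auto simp: S_def order_le_less)
    then show False using inS by (auto simp: S_def)
  qed
  then have "norm (x t) \<le> R + 1" if "t \<ge> 0" for t using that by blast
  then have "(x has_vector_derivative X (x t)) (at t within {0..})" if "t \<ge> 0" for t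
    using x[OF that] closest_point_self[of "x t" "cball 0 (R+1)"] that by auto
  then show ?thesis using x0 by blast
qed

definition lipschitz_on_balls :: "('a::real_normed_vector \<Rightarrow> 'b::real_normed_vector) \<Rightarrow> bool" where
  "lipschitz_on_balls f \<longleftrightarrow> (\<forall>R. \<exists>L. L-lipschitz_on (cball 0 R) f)"

text \<open>
Compactness bounds the finitely many directional derivatives along the basis, hence the derivative.
\<close>

lemma lipschitz_on_balls_C_1:
  fixes f :: "'a::euclidean_space \<Rightarrow> 'b::real_normed_vector"
  assumes "C_k (Suc 0) f"
  shows "lipschitz_on_balls f"
  unfolding lipschitz_on_balls_def
proof
  fix R
  let ?D = "\<lambda>x. frechet_derivative f (at x)"
  have "\<exists>M\<ge>0. \<forall>x\<in>cball 0 R. norm (?D x b) \<le> M" for b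
  proof -
    have "continuous_on (cball 0 R) (\<lambda>x. ?D x b)"
      using C_k_SucD(2)[OF assms, of b] by (auto intro: continuous_on_subset)
    then have "bounded ((\<lambda>x. ?D x b) ` cball 0 R)"
      by (intro compact_imp_bounded compact_continuous_image) auto
    then show ?thesis unfolding bounded_pos by (auto intro: less_imp_le)
  qed
  then obtain M where M: "\<And>b. M b \<ge> 0" "\<And>b x. x \<in> cball 0 R \<Longrightarrow> norm (?D x b) \<le> M b" by metis
  have "onorm (?D x) \<le> (\<Sum>b\<in>Basis. M b)" if x: "x \<in> cball 0 R" for x
  proof (rule onorm_bound)
    fix v
    have lin: "linear (?D x)" by (rule has_derivative_linear[OF C_k_SucD(1)[OF assms]])
    have "?D x v = ?D x (\<Sum>b\<in>Basis. (v \<bullet> b) *\<^sub>R b)" by (simp add: euclidean_representation)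
    also have "\<dots> = (\<Sum>b\<in>Basis. (v \<bullet> b) *\<^sub>R ?D x b)"
      by (simp add: linear_sum[OF lin] linear_scale[OF lin])
    also have "norm \<dots> \<le> (\<Sum>b\<in>Basis. norm v * M b)"
      using M x by (intro order_trans[OF norm_sum] sum_mono) (auto intro!: mult_mono Basis_le_norm)
    finally show "norm (?D x v) \<le> (\<Sum>b\<in>Basis. M b) * norm v"
      by (simp add: sum_distrib_left mult.commute)
  qed (use M in \<open>auto intro: sum_nonneg\<close>)
  then have "norm (f x - f y) \<le> (\<Sum>b\<in>Basis. M b) * norm (x - y)" if "x \<in> cball 0 R" "y \<in> cball 0 R" for x y
    by (rule differentiable_bound[OF convex_cball has_derivative_at_withinI[OF C_k_SucD(1)[OF assms]] _ that])
  then have "(\<Sum>b\<in>Basis. M b)-lipschitz_on (cball 0 R) f"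
    using M by (intro lipschitz_onI) (auto simp: dist_norm intro: sum_nonneg)
  then show "\<exists>L. L-lipschitz_on (cball 0 R) f" by blast
qed

lemma lipschitz_on_balls_bound:
  fixes f :: "'a::real_normed_vector \<Rightarrow> 'b::real_normed_vector"
  assumes "L-lipschitz_on (cball 0 R) f" "x \<in> cball 0 R"
  shows "norm (f x) \<le> norm (f 0) + L * \<bar>R\<bar>"
proof -
  have "0 \<in> cball 0 R" using assms(2) norm_ge_zero[of x] by (simp del: norm_ge_zero)
  then have "norm (f x - f 0) \<le> L * norm x"
    using lipschitz_on_normD[OF assms(1,2), of 0] by simp
  also have "\<dots> \<le> L * \<bar>R\<bar>"
    using assms(2) by (intro mult_left_mono lipschitz_on_nonneg[OF assms(1)]) auto
  finally show ?thesis using norm_triangle_sub[of "f x" "f 0"] by linarith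
qed

lemma lipschitz_on_balls_bounded_linear: "bounded_linear f \<Longrightarrow> lipschitz_on_balls f"
  unfolding lipschitz_on_balls_def
  by (metis bounded_linear.lipschitz_boundE)

lemma lipschitz_on_balls_compose:
  assumes "lipschitz_on_balls g" "lipschitz_on_balls f"
  shows "lipschitz_on_balls (\<lambda>x. g (f x))"
  unfolding lipschitz_on_balls_def
proof
  fix R
  obtain L where L: "L-lipschitz_on (cball 0 R) f" using assms(2) unfolding lipschitz_on_balls_def by blast
  obtain M where "M-lipschitz_on (cball 0 (norm (f 0) + L * \<bar>R\<bar>)) g"
    using assms(1) unfolding lipschitz_on_balls_def by blast
  then have "M-lipschitz_on (f ` cball 0 R) g"
    by (rule lipschitz_on_subset) (use lipschitz_on_balls_bound[OF L] in auto)
  then show "\<exists>L. L-lipschitz_on (cball 0 R) (\<lambda>x. g (f x))"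
    using lipschitz_on_compose2[OF L] by blast
qed

lemma lipschitz_on_balls_Pair:
  "lipschitz_on_balls f \<Longrightarrow> lipschitz_on_balls g \<Longrightarrow> lipschitz_on_balls (\<lambda>x. (f x, g x))"
  unfolding lipschitz_on_balls_def by (fast intro: lipschitz_on_Pair)

lemma lipschitz_on_balls_add:
  "lipschitz_on_balls f \<Longrightarrow> lipschitz_on_balls g \<Longrightarrow> lipschitz_on_balls (\<lambda>x. f x + g x)"
  unfolding lipschitz_on_balls_def by (fast intro: lipschitz_on_add)

lemma lipschitz_on_balls_scaleR:
  assumes "lipschitz_on_balls a" "lipschitz_on_balls f"
  shows "lipschitz_on_balls (\<lambda>x. a x *\<^sub>R f x)"
  unfolding lipschitz_on_balls_def
proof
  fix R
  obtain A F where A: "A-lipschitz_on (cball 0 R) a" and F: "F-lipschitz_on (cball 0 R) f"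
    using assms unfolding lipschitz_on_balls_def by blast
  define m where "m = \<bar>a 0\<bar> + A * \<bar>R\<bar>"
  define p where "p = norm (f 0) + F * \<bar>R\<bar>"
  have pos: "m \<ge> 0" "p \<ge> 0" "A \<ge> 0" "F \<ge> 0"
    using lipschitz_on_nonneg[OF A] lipschitz_on_nonneg[OF F] by (auto simp: m_def p_def)
  have "norm (a x *\<^sub>R f x - a y *\<^sub>R f y) \<le> (A * p + m * F) * norm (x - y)"
    if x: "x \<in> cball 0 R" and y: "y \<in> cball 0 R" for x y
  proof -
    have "a x *\<^sub>R f x - a y *\<^sub>R f y = (a x - a y) *\<^sub>R f x + a y *\<^sub>R (f x - f y)"
      by (simp add: algebra_simps)
    also have "norm \<dots> \<le> \<bar>a x - a y\<bar> * norm (f x) + \<bar>a y\<bar> * norm (f x - f y)"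
      by (rule order_trans[OF norm_triangle_ineq]) simp
    also have "\<dots> \<le> (A * norm (x - y)) * p + m * (F * norm (x - y))"
      using lipschitz_on_normD[OF A x y] lipschitz_on_normD[OF F x y] pos
        lipschitz_on_balls_bound[OF A y] lipschitz_on_balls_bound[OF F x]
      by (intro add_mono mult_mono) (auto simp: m_def p_def)
    finally show ?thesis by (simp add: algebra_simps)
  qed
  then have "(A * p + m * F)-lipschitz_on (cball 0 R) (\<lambda>x. a x *\<^sub>R f x)"
    using pos by (intro lipschitz_onI) (auto simp: dist_norm)
  then show "\<exists>L. L-lipschitz_on (cball 0 R) (\<lambda>x. a x *\<^sub>R f x)" by blast
qed

section \<open>Maps that confine trajectories\<close>

text \<open>
The only property of \<open>\<Phi>\<close> that the existence of closed-loop solutions needs: a curve whose image is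
bounded and has exponentially decaying speed cannot escape, with a bound independent of \<open>T\<close>.
\<close>

definition confines_trajectories :: "(real ^ 'n \<Rightarrow> real ^ 'n) \<Rightarrow> bool" where
  "confines_trajectories \<Phi> \<longleftrightarrow> (\<forall>a M \<alpha>. \<alpha> > 0 \<longrightarrow> (\<exists>R. \<forall>T x x'. 0 \<le> T \<and> x 0 = a \<and>
     (\<forall>t\<in>{0..T}. (x has_vector_derivative x' t) (at t within {0..T}) \<and> norm (\<Phi> (x t)) \<le> M \<and>
        norm (frechet_derivative \<Phi> (at (x t)) (x' t)) \<le> M * exp (- \<alpha> * t)) \<longrightarrow> norm (x T) \<le> R))"

lemma confines_of_homeomorphism:
  assumes "bij \<Phi>" "continuous_on UNIV (inv \<Phi>)"
  shows "confines_trajectories \<Phi>"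
  unfolding confines_trajectories_def
proof (intro allI impI)
  fix a M and \<alpha> :: real
  have "bounded (inv \<Phi> ` cball 0 M)"
    by (intro compact_imp_bounded compact_continuous_image) (auto intro: continuous_on_subset[OF assms(2)])
  then have "\<exists>R. \<forall>p. norm p \<le> M \<longrightarrow> norm (inv \<Phi> p) \<le> R"
    unfolding bounded_iff ball_simps(9) by (simp only: mem_cball_0 Ball_def)
  then obtain R where R: "\<And>p. norm p \<le> M \<Longrightarrow> norm (inv \<Phi> p) \<le> R" by blast
  have "norm x \<le> R" if "norm (\<Phi> x) \<le> M" for x
    using R[OF that] assms(1) by (simp add: bij_is_inj)
  then show "\<exists>R. \<forall>T x x'. 0 \<le> T \<and> x 0 = a \<and>
     (\<forall>t\<in>{0..T}. (x has_vector_derivative x' t) (at t within {0..T}) \<and> norm (\<Phi> (x t)) \<le> M \<and>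
        norm (frechet_derivative \<Phi> (at (x t)) (x' t)) \<le> M * exp (- \<alpha> * t)) \<longrightarrow> norm (x T) \<le> R"
    by (intro exI[of _ R]) auto
qed

lemma matrix_inv_mul_vec:
  assumes "invertible (A :: real ^ 'n ^ 'n)"
  shows "matrix_inv A *v (A *v v) = v"
proof -
  have "matrix_inv A ** A = mat 1"
    using someI_ex[OF assms[unfolded invertible_def]] unfolding matrix_inv_def by blast
  then show ?thesis by (simp add: matrix_vector_mul_assoc)
qed

text \<open>
Comparison of \<open>r log r\<close> with the smooth function \<open>q log q\<close>, where \<open>q = e + r\<^sup>2\<close> is chosen so that
\<open>log log q\<close> is defined and nonnegative everywhere. The values \<open>r \<le> 1\<close>, where the left-hand side is
not positive, include \<open>r = 0\<close> with \<open>ln 0 = 0\<close>.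
\<close>

lemma log_growth_bound:
  assumes "0 \<le> (r :: real)" "q = exp 1 + r\<^sup>2"
  shows "1 \<le> ln q" "2 * r\<^sup>2 * ln r \<le> q * ln q" "2 * r \<le> q * ln q"
proof -
  have q: "q \<ge> exp 1" "q \<ge> r\<^sup>2" "q \<ge> 1 + r\<^sup>2" using assms exp_ge_add_one_self[of 1] by auto
  have q0: "q > 0" using q(3) by (smt (verit) zero_le_power2)
  show ln: "1 \<le> ln q" using q(1) q0 by (simp add: ln_ge_iff)
  have qln: "q * 1 \<le> q * ln q" using ln q0 by (intro mult_left_mono) auto
  show "2 * r\<^sup>2 * ln r \<le> q * ln q"
  proof (cases "r \<le> 1")
    case True
    then have "ln r \<le> 0" using assms(1) by (cases "r = 0") auto
    then have "2 * r\<^sup>2 * ln r \<le> 0" by (intro mult_nonneg_nonpos) auto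
    then show ?thesis using qln q0 by linarith
  next
    case False
    then have "2 * ln r = ln (r\<^sup>2)" by (simp add: ln_realpow)
    also have "\<dots> \<le> ln q" using False q q0 by simp
    finally have "r\<^sup>2 * (2 * ln r) \<le> q * ln q" using False q q0 by (intro mult_mono) auto
    then show ?thesis by (simp add: mult.assoc mult.left_commute)
  qed
  have "0 \<le> (1 - r)\<^sup>2" by simp
  then have "2 * r \<le> 1 + r\<^sup>2" by (simp add: power2_diff)
  then show "2 * r \<le> q * ln q" using q(3) qln by linarith
qed

text \<open>
With \<open>q = e + \<bar>x\<bar>\<^sup>2\<close> the growth condition gives \<open>q' \<le> (N\<^sub>1 + N\<^sub>2) M exp(- \<alpha> t) q log q\<close>. Thus the
derivative of \<open>log log q\<close> is bounded by an integrable function of time.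
\<close>

lemma confines_of_log_growth:
  fixes \<Phi> :: "real ^ 'n \<Rightarrow> real ^ 'n"
  assumes diff: "\<And>x. \<Phi> differentiable (at x)" and inv: "\<And>x. invertible (jacobian \<Phi> (at x))"
    and N: "N1 > 0" "N2 > 0"
    and growth: "\<And>x. onorm ((*v) (matrix_inv (jacobian \<Phi> (at x)))) \<le> N1 * norm x * ln (norm x) + N2"
  shows "confines_trajectories \<Phi>"
  unfolding confines_trajectories_def
proof (intro allI impI)
  fix a :: "real ^ 'n" and M \<alpha> :: real assume \<alpha>: "\<alpha> > 0"
  define c where "c = (N1 + N2) * M / \<alpha>"
  have c\<alpha>: "c * \<alpha> = (N1 + N2) * M" using \<alpha> by (simp add: c_def)
  define R where "R = sqrt (exp (exp (ln (ln (exp 1 + (norm a)\<^sup>2)) + c)))"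
  have "norm (x T) \<le> R"
    if T: "0 \<le> T" and a: "x 0 = a" and x': "\<And>t. t \<in> {0..T} \<Longrightarrow> (x has_vector_derivative x' t) (at t within {0..T})"
      and \<Phi>': "\<And>t. t \<in> {0..T} \<Longrightarrow> norm (frechet_derivative \<Phi> (at (x t)) (x' t)) \<le> M * exp (- \<alpha> * t)" for T x x'
  proof -
    have M: "M \<ge> 0" using order_trans[OF norm_ge_zero \<Phi>'[of 0]] T by simp
    define q where "q t = exp 1 + (norm (x t))\<^sup>2" for t
    have speed: "norm (x' t) \<le> (N1 * norm (x t) * ln (norm (x t)) + N2) * (M * exp (- \<alpha> * t))" if t: "t \<in> {0..T}" for t
    proof -
      let ?J = "jacobian \<Phi> (at (x t))"
      have "x' t = matrix_inv ?J *v (?J *v x' t)" by (rule matrix_inv_mul_vec[OF inv, symmetric])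
      also have "?J *v x' t = frechet_derivative \<Phi> (at (x t)) (x' t)"
        using linear_frechet_derivative[OF diff] by (simp add: jacobian_def matrix_works)
      finally have "norm (x' t) \<le> onorm ((*v) (matrix_inv ?J)) * norm (frechet_derivative \<Phi> (at (x t)) (x' t))"
        using onorm[OF matrix_vector_mul_bounded_linear[of "matrix_inv ?J"], of "frechet_derivative \<Phi> (at (x t)) (x' t)"] by simp
      also have "\<dots> \<le> (N1 * norm (x t) * ln (norm (x t)) + N2) * (M * exp (- \<alpha> * t))"
        using growth \<Phi>'[OF t] onorm_pos_le[OF matrix_vector_mul_bounded_linear[of "matrix_inv ?J"]]
        by (intro mult_mono) (auto intro: order_trans)
      finally show ?thesis .
    qed
    \<comment> \<open>The added exponential compensates the integrable growth rate, so that \<open>\<psi>\<close> is nonincreasing.\<close>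
    define \<psi> where "\<psi> t = ln (ln (q t)) + c * exp (- \<alpha> * t)" for t
    have ln_q: "1 \<le> ln (q t)" for t by (rule log_growth_bound(1)[OF norm_ge_zero q_def])
    have q_1: "q t > 1" for t by (simp add: q_def add_strict_increasing2[OF zero_le_power2] add.commute[of "exp 1"])
    have q_pos: "q t > 0" for t by (simp add: q_def add_pos_nonneg)
    have \<psi>': "(\<psi> has_real_derivative (2 * (x t \<bullet> x' t)) / q t / ln (q t) - c * \<alpha> * exp (- \<alpha> * t)) (at t within {0..T})"
      if "t \<in> {0..T}" for t
    proof -
      have "((\<lambda>t. x t \<bullet> x t) has_vector_derivative x t \<bullet> x' t + x' t \<bullet> x t) (at t within {0..T})"
        by (rule bounded_bilinear.has_vector_derivative[OF bounded_bilinear_inner x'[OF that] x'[OF that]])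
      then have "((\<lambda>t. (norm (x t))\<^sup>2) has_real_derivative 2 * (x t \<bullet> x' t)) (at t within {0..T})"
        by (simp add: has_real_derivative_iff_has_vector_derivative power2_norm_eq_inner inner_commute)
      from DERIV_add[OF DERIV_const[of "exp 1"] this]
      have "(q has_real_derivative 2 * (x t \<bullet> x' t)) (at t within {0..T})"
        unfolding q_def by simp
      then show ?thesis
        unfolding \<psi>_def using ln_q[of t] q_1[of t]
        by (auto intro!: derivative_eq_intros simp: field_simps)
    qed
    have decreasing: "(2 * (x t \<bullet> x' t)) / q t / ln (q t) - c * \<alpha> * exp (- \<alpha> * t) \<le> 0" if t: "t \<in> {0..T}" for t
    proof -
      let ?r = "norm (x t)" and ?m = "M * exp (- \<alpha> * t)"
      have m: "?m \<ge> 0" using M by simp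
      have "2 * (x t \<bullet> x' t) \<le> 2 * (?r * norm (x' t))" using norm_cauchy_schwarz[of "x t" "x' t"] by simp
      also have "\<dots> \<le> 2 * (?r * ((N1 * ?r * ln ?r + N2) * ?m))"
        using speed[OF t] by (intro mult_left_mono) auto
      also have "\<dots> = (N1 * (2 * ?r\<^sup>2 * ln ?r) + N2 * (2 * ?r)) * ?m"
        by (simp add: power2_eq_square algebra_simps)
      also have "\<dots> \<le> (N1 * (q t * ln (q t)) + N2 * (q t * ln (q t))) * ?m"
        using N m log_growth_bound(2,3)[OF norm_ge_zero q_def[of t]]
        by (intro mult_right_mono add_mono mult_left_mono) auto
      also have "\<dots> = c * \<alpha> * exp (- \<alpha> * t) * (q t * ln (q t))"
        unfolding c\<alpha> by (simp add: algebra_simps)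
      finally have "2 * (x t \<bullet> x' t) / (q t * ln (q t)) \<le> c * \<alpha> * exp (- \<alpha> * t)"
        using mult_pos_pos[OF q_pos[of t] less_le_trans[OF zero_less_one ln_q[of t]]]
        by (simp only: pos_divide_le_eq)
      then show ?thesis by simp
    qed
    have "\<psi> T \<le> \<psi> 0"
    proof (rule DERIV_nonpos_imp_decreasing_open[where f = \<psi>])
      show "continuous_on {0..T} \<psi>" by (rule DERIV_continuous_on[OF \<psi>'])
      show "\<exists>y. (\<psi> has_real_derivative y) (at t) \<and> y \<le> 0" if "0 < t" "t < T" for t
      proof -
        have "at t within {0..T} = at t" using that by (intro at_within_interior) auto
        then show ?thesis using \<psi>'[of t] decreasing[of t] that by auto
      qed
    qed (rule T)
    moreover have "c * exp (- \<alpha> * T) \<ge> 0" using N M \<alpha> by (simp add: c_def)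
    ultimately have "ln (ln (q T)) \<le> ln (ln (exp 1 + (norm a)\<^sup>2)) + c"
      by (simp add: \<psi>_def q_def a)
    then have "ln (q T) \<le> exp (ln (ln (exp 1 + (norm a)\<^sup>2)) + c)"
      using ln_q[of T] by (metis exp_le_cancel_iff exp_ln less_le_trans zero_less_one)
    then have "q T \<le> exp (exp (ln (ln (exp 1 + (norm a)\<^sup>2)) + c))"
      using q_pos[of T] by (metis exp_le_cancel_iff exp_ln)
    then have "(norm (x T))\<^sup>2 \<le> exp (exp (ln (ln (exp 1 + (norm a)\<^sup>2)) + c))"
      unfolding q_def using exp_gt_zero[of "1 :: real"] by linarith
    then show ?thesis unfolding R_def by (rule real_le_rsqrt)
  qed
  then show "\<exists>R. \<forall>T x x'. 0 \<le> T \<and> x 0 = a \<and>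
     (\<forall>t\<in>{0..T}. (x has_vector_derivative x' t) (at t within {0..T}) \<and> norm (\<Phi> (x t)) \<le> M \<and>
        norm (frechet_derivative \<Phi> (at (x t)) (x' t)) \<le> M * exp (- \<alpha> * t)) \<longrightarrow> norm (x T) \<le> R"
    by blast
qed

section \<open>The closed loop\<close>

definition closed_loop_field ::
  "(real ^ 'n \<Rightarrow> real ^ 'n) \<Rightarrow> (real ^ 'n \<Rightarrow> real ^ 'n) \<Rightarrow> (real ^ 'n \<Rightarrow> real) \<Rightarrow> real \<Rightarrow>
   real ^ 'n \<Rightarrow> real \<Rightarrow> real ^ 'n \<Rightarrow> real \<Rightarrow> real \<times> (real ^ 'n) \<times> (real ^ 'n) \<Rightarrow> real \<times> (real ^ 'n) \<times> (real ^ 'n)" where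
  "closed_loop_field f g h y \<beta> k0 k \<epsilon> w = (let x0 = fst w; x = fst (snd w); z = snd (snd w); e = y - h x in
     (e, f x + pid_input k0 k e x0 z *\<^sub>R g x, observer_rhs \<beta> \<epsilon> e z))"

lemma observer_rhs_eq: "observer_rhs \<beta> \<epsilon> e z = shift z 0 + (e - z $# 1) *\<^sub>R tuple (\<lambda>i. \<beta> $# i / \<epsilon> ^ i)"
  by (rule vec_eqI_nth_comp) (simp add: observer_rhs_def shift_nth_comp tuple_nth_comp)

lemma lipschitz_on_balls_closed_loop_field:
  fixes f g :: "real ^ 'n \<Rightarrow> real ^ 'n"
  assumes "smooth f" "smooth g" "smooth h"
  shows "lipschitz_on_balls (closed_loop_field f g h y \<beta> k0 k \<epsilon>)"
proof -
  note rules = lipschitz_on_balls_Pair lipschitz_on_balls_add lipschitz_on_balls_scaleR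
  have x: "lipschitz_on_balls (\<lambda>w :: real \<times> (real ^ 'n) \<times> (real ^ 'n). F (fst (snd w)))"
    if "C_k (Suc 0) F" for F :: "real ^ 'n \<Rightarrow> 'c::real_normed_vector"
    by (rule lipschitz_on_balls_compose[OF lipschitz_on_balls_C_1[OF that]])
      (intro lipschitz_on_balls_bounded_linear bounded_linear_fst_comp bounded_linear_snd)
  have lin: "lipschitz_on_balls (\<lambda>w :: real \<times> (real ^ 'n) \<times> (real ^ 'n). F (snd (snd w)))"
    if "linear F" for F :: "real ^ 'n \<Rightarrow> 'c::euclidean_space"
    by (rule lipschitz_on_balls_compose[OF lipschitz_on_balls_bounded_linear])
      (use that in \<open>auto intro!: lipschitz_on_balls_bounded_linear bounded_linear_snd_comp bounded_linear_snd simp: linear_conv_bounded_linear\<close>)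
  have const: "lipschitz_on_balls (\<lambda>w :: real \<times> (real ^ 'n) \<times> (real ^ 'n). c)" for c :: "'c::real_normed_vector"
    unfolding lipschitz_on_balls_def by (fast intro: lipschitz_on_constant)
  have e: "lipschitz_on_balls (\<lambda>w :: real \<times> (real ^ 'n) \<times> (real ^ 'n). y - h (fst (snd w)))"
    using lipschitz_on_balls_add[OF const[of y] lipschitz_on_balls_scaleR[OF const[of "-1"] x[OF smooth_imp_C_k[OF assms(3)]]]]
    by simp
  have z1: "linear (\<lambda>z :: real ^ 'n. - (z $# 1))" by (rule linearI) auto
  have pid: "linear (\<lambda>z :: real ^ 'n. \<Sum>j=2..CARD('n). k $# j * z $# j)"
    by (intro linear_compose_sum ballI linearI) (auto simp: algebra_simps)
  have fst: "lipschitz_on_balls (\<lambda>w :: real \<times> (real ^ 'n) \<times> (real ^ 'n). fst w)"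
    by (intro lipschitz_on_balls_bounded_linear bounded_linear_fst)
  have input: "lipschitz_on_balls (\<lambda>w. pid_input k0 k (y - h (fst (snd w))) (fst w) (snd (snd w)))"
    using lipschitz_on_balls_add[OF lipschitz_on_balls_add[OF lipschitz_on_balls_scaleR[OF const[of "k $# 1"] e]
        lipschitz_on_balls_scaleR[OF const[of k0] fst]] lin[OF pid]]
    by (simp add: pid_input_def)
  have innov: "lipschitz_on_balls (\<lambda>w :: real \<times> (real ^ 'n) \<times> (real ^ 'n). y - h (fst (snd w)) - snd (snd w) $# 1)"
    using lipschitz_on_balls_add[OF e lin[OF z1]] by simp
  show ?thesis
    unfolding closed_loop_field_def[abs_def] Let_def observer_rhs_eq
    by (intro rules e x input lin[OF linear_shift] innov const assms[THEN smooth_imp_C_k])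
qed


lemma closed_loop_solution_iff:
  "closed_loop_solution f g h y \<beta> k0 k \<epsilon> a b x0 x z \<longleftrightarrow> x0 0 = 0 \<and> x 0 = a \<and> z 0 = b \<and>
    (\<forall>t\<ge>0. ((\<lambda>t. (x0 t, x t, z t)) has_vector_derivative closed_loop_field f g h y \<beta> k0 k \<epsilon> (x0 t, x t, z t))
      (at t within {0..}))"
proof -
  have "(w has_vector_derivative (p, q, r)) (at s within S) \<longleftrightarrow> ((\<lambda>t. fst (w t)) has_real_derivative p) (at s within S) \<and>
    ((\<lambda>t. fst (snd (w t))) has_vector_derivative q) (at s within S) \<and> ((\<lambda>t. snd (snd (w t))) has_vector_derivative r) (at s within S)"
    for w :: "real \<Rightarrow> real \<times> (real ^ 'a) \<times> (real ^ 'a)" and p q r s S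
    unfolding has_real_derivative_iff_has_vector_derivative
  proof (intro iffI conjI; (elim conjE)?)
    assume w: "(w has_vector_derivative (p, q, r)) (at s within S)"
    show "((\<lambda>t. fst (w t)) has_vector_derivative p) (at s within S)"
      "((\<lambda>t. fst (snd (w t))) has_vector_derivative q) (at s within S)" "((\<lambda>t. snd (snd (w t))) has_vector_derivative r) (at s within S)"
      using bounded_linear.has_vector_derivative[OF bounded_linear_fst w]
        bounded_linear.has_vector_derivative[OF bounded_linear_fst_comp[OF bounded_linear_snd] w]
        bounded_linear.has_vector_derivative[OF bounded_linear_snd_comp[OF bounded_linear_snd] w] by simp_all
  next
    assume "((\<lambda>t. fst (w t)) has_vector_derivative p) (at s within S)" "((\<lambda>t. fst (snd (w t))) has_vector_derivative q) (at s within S)"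
      "((\<lambda>t. snd (snd (w t))) has_vector_derivative r) (at s within S)"
    from has_vector_derivative_Pair[OF this(1) has_vector_derivative_Pair[OF this(2,3)]]
    show "(w has_vector_derivative (p, q, r)) (at s within S)" by simp
  qed
  from this[of "\<lambda>t. (x0 t, x t, z t)"] show ?thesis
    unfolding closed_loop_solution_def closed_loop_field_def Let_def by simp
qed

lemma shift_bound: "\<exists>c>0. \<forall>(E :: real ^ 'n) v. norm (shift E v) \<le> c * (norm E + \<bar>v\<bar>)"
proof -
  have "linear (\<lambda>p :: (real ^ 'n) \<times> real. shift (fst p) (snd p))"
    unfolding shift_def by (intro linear_tupleI linearI) auto
  from linear_bounded_pos[OF this] obtain c where c: "c > 0" "\<And>p. norm (shift (fst p :: real ^ 'n) (snd p)) \<le> c * norm p"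
    by metis
  have "norm (shift E v) \<le> c * (norm E + \<bar>v\<bar>)" for E :: "real ^ 'n" and v
    using order_trans[OF c(2)[of "(E, v)"] mult_left_mono[OF norm_Pair_le[of E v], of c]] c(1) by simp
  then show ?thesis using c(1) by blast
qed

text \<open>
The setpoint \<open>z\<^sup>*\<close> has only its first component different from zero, and the shift discards that one.
\<close>

lemma shift_error: "shift \<zeta> s = - shift (z_star y - \<zeta>) (- s)"
  by (rule vec_eqI_nth_comp) (auto simp: shift_nth_comp z_star_def tuple_nth_comp)

lemma Phi_trajectory:
  fixes f g :: "real ^ 'n \<Rightarrow> real ^ 'n"
  assumes f: "smooth f" and h: "smooth h" and rel: "uniform_relative_degree f g h"
    and x: "(x has_vector_derivative f (x t) + u *\<^sub>R g (x t)) (at t within S)"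
  shows "((\<lambda>t. Phi f h (x t)) has_vector_derivative
    shift (Phi f h (x t)) (F_fun f h (x t) + u * G_fun f g h (x t))) (at t within S)"
proof -
  have "Phi f h differentiable (at (x t))"
    using Phi_has_derivative[OF f h] unfolding differentiable_def by blast
  then have "(Phi f h has_derivative frechet_derivative (Phi f h) (at (x t))) (at (x t) within x ` S)"
    by (rule has_derivative_at_withinI[OF frechet_derivative_works[THEN iffD1]])
  from vector_derivative_diff_chain_within[OF x this] show ?thesis
    by (simp add: Phi_derivative_control[OF f h rel] o_def)
qed

text \<open>
The drift is \<open>\<Delta> = F(x) + G(x) u\<^sup>*\<close>, with \<open>u\<^sup>* = k\<^sub>0 x\<^sub>0\<^sup>*\<close> the input at the equilibrium; it vanishes at \<open>x\<^sup>*\<close>,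
so the Lipschitz condition bounds it by the error.
\<close>

lemma closed_loop_is_observer_loop:
  fixes f g :: "real ^ 'n \<Rightarrow> real ^ 'n" and k \<beta> :: "real ^ 'n"
  assumes f: "smooth f" and h: "smooth h" and A: "assumption_A b_lo f g h" and hi: "\<And>x. G_fun f g h x \<le> b_hi"
    and lip: "\<And>x. norm (H_fun f g h x - H_fun f g h xs) \<le> L * norm (Phi f h x - Phi f h xs)"
    and xs: "Phi f h xs = z_star y" and us: "F_fun f h xs + G_fun f g h xs * (k0 * x0s) = 0"
    and \<Lambda>0: "0 \<le> \<Lambda>" and \<Lambda>: "(1 + \<bar>k0 * x0s\<bar>) * L \<le> \<Lambda>"
    and w: "\<And>t. t \<in> {0..T} \<Longrightarrow> (w has_vector_derivative closed_loop_field f g h y \<beta> k0 k \<epsilon> (w t)) (at t within {0..T})"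
  defines "u \<equiv> \<lambda>t. pid_input k0 k (y - h (fst (snd (w t)))) (fst (w t)) (snd (snd (w t)))"
  shows "observer_loop b_lo b_hi \<Lambda> \<beta> (k0, k) \<epsilon> T
    (\<lambda>t. (fst (w t) - x0s, z_star y - Phi f h (fst (snd (w t))))) (\<lambda>t. snd (snd (w t)))
    (\<lambda>t. - (F_fun f h (fst (snd (w t))) + G_fun f g h (fst (snd (w t))) * u t))"
  unfolding observer_loop_def
proof (intro ballI conjI)
  fix t assume t: "t \<in> {0..T}"
  have rel: "uniform_relative_degree f g h" and lo: "\<And>x. b_lo \<le> G_fun f g h x"
    using A unfolding assumption_A_def by auto
  define x where "x t = fst (snd (w t))" for t
  define E where "E t = z_star y - Phi f h (x t)" for t
  have e: "E t $# 1 = y - h (x t)" for t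
    by (simp add: E_def z_star_def Phi_nth_comp tuple_nth_comp Suc_le_eq)
  have x0': "((\<lambda>t. fst (w t)) has_vector_derivative E t $# 1) (at t within {0..T})"
    using bounded_linear.has_vector_derivative[OF bounded_linear_fst w[OF t]]
    unfolding e x_def by (simp add: closed_loop_field_def Let_def)
  have x': "(x has_vector_derivative f (x t) + u t *\<^sub>R g (x t)) (at t within {0..T})"
    using bounded_linear.has_vector_derivative[OF bounded_linear_fst_comp[OF bounded_linear_snd] w[OF t]]
    unfolding x_def u_def by (simp add: closed_loop_field_def Let_def)
  have "(E has_vector_derivative 0 - shift (Phi f h (x t)) (F_fun f h (x t) + u t * G_fun f g h (x t))) (at t within {0..T})"
    unfolding E_def by (intro has_vector_derivative_diff has_vector_derivative_const Phi_trajectory f h rel x')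
  then have E': "(E has_vector_derivative shift (E t) (- (F_fun f h (x t) + G_fun f g h (x t) * u t))) (at t within {0..T})"
    unfolding shift_error[of "Phi f h (x t)" _ y] by (simp add: E_def mult.commute)
  show "((\<lambda>t. (fst (w t) - x0s, z_star y - Phi f h (fst (snd (w t))))) has_vector_derivative
      chain (fst (w t) - x0s, z_star y - Phi f h (fst (snd (w t))))
        (- (F_fun f h (fst (snd (w t))) + G_fun f g h (fst (snd (w t))) * u t))) (at t within {0..T})"
    using has_vector_derivative_Pair[OF has_vector_derivative_diff[OF x0' has_vector_derivative_const[of x0s]] E']
    unfolding chain_def by (simp add: E_def x_def)
  show "((\<lambda>t. snd (snd (w t))) has_vector_derivative
      observer_rhs \<beta> \<epsilon> (snd (fst (w t) - x0s, z_star y - Phi f h (fst (snd (w t)))) $# 1) (snd (snd (w t))))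
      (at t within {0..T})"
    using bounded_linear.has_vector_derivative[OF bounded_linear_snd_comp[OF bounded_linear_snd] w[OF t]] e[of t]
    unfolding E_def x_def by (simp add: closed_loop_field_def Let_def)
  define \<Delta> where "\<Delta> = F_fun f h (x t) + G_fun f g h (x t) * (k0 * x0s)"
  have "\<bar>\<Delta>\<bar> \<le> \<Lambda> * norm (fst (w t) - x0s, E t)"
  proof -
    let ?d = "H_fun f g h (x t) - H_fun f g h xs"
    have "\<Delta> = fst ?d + snd ?d * (k0 * x0s)"
      using us by (simp add: \<Delta>_def H_fun_def algebra_simps)
    then have "\<bar>\<Delta>\<bar> \<le> \<bar>fst ?d\<bar> + \<bar>snd ?d\<bar> * \<bar>k0 * x0s\<bar>"
      by (metis abs_mult abs_triangle_ineq)
    also have "\<dots> \<le> norm ?d + norm ?d * \<bar>k0 * x0s\<bar>"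
      using norm_fst_le[of "fst ?d" "snd ?d", unfolded prod.collapse real_norm_def]
        norm_snd_le[of "snd ?d" "fst ?d", unfolded prod.collapse real_norm_def]
      by (intro add_mono mult_right_mono abs_ge_zero)
    also have "\<dots> = (1 + \<bar>k0 * x0s\<bar>) * norm ?d" by (simp add: algebra_simps)
    also have "\<dots> \<le> (1 + \<bar>k0 * x0s\<bar>) * (L * norm (E t))"
      using lip[of "x t"] unfolding E_def xs by (intro mult_left_mono) (auto simp: norm_minus_commute)
    also have "\<dots> \<le> \<Lambda> * norm (E t)"
      unfolding mult.assoc[symmetric] by (intro mult_right_mono \<Lambda>) auto
    also have "\<dots> \<le> \<Lambda> * norm (fst (w t) - x0s, E t)"
      using \<Lambda>0 norm_snd_le by (intro mult_left_mono) auto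
    finally show ?thesis .
  qed
  moreover have "- (F_fun f h (x t) + G_fun f g h (x t) * u t) = - \<Delta> - G_fun f g h (x t) *
      ((k0, k) \<bullet> (fst (w t) - x0s, E t) - estimation_gap k (E t - snd (snd (w t))))"
  proof -
    have "u t = (k0, k) \<bullet> (fst (w t) - x0s, E t) - estimation_gap k (E t - snd (snd (w t))) + k0 * x0s"
      unfolding u_def x_def[symmetric] e[symmetric] by (rule pid_input_eq) auto
    then have "(k0, k) \<bullet> (fst (w t) - x0s, E t) - estimation_gap k (E t - snd (snd (w t))) = u t - k0 * x0s"
      by linarith
    then show ?thesis
      unfolding \<Delta>_def by (simp only:) (simp add: algebra_simps)
  qed
  ultimately show "\<exists>\<theta> \<Delta>. b_lo \<le> \<theta> \<and> \<theta> \<le> b_hi \<and> \<bar>\<Delta>\<bar> \<le> \<Lambda> * norm (fst (w t) - x0s, z_star y - Phi f h (fst (snd (w t)))) \<and>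
    - (F_fun f h (fst (snd (w t))) + G_fun f g h (fst (snd (w t))) * u t) = - \<Delta> - \<theta> *
      ((k0, k) \<bullet> (fst (w t) - x0s, z_star y - Phi f h (fst (snd (w t)))) -
       estimation_gap (snd (k0, k)) (snd (fst (w t) - x0s, z_star y - Phi f h (fst (snd (w t)))) - snd (snd (w t))))"
    using lo[of "x t"] hi[of "x t"] unfolding E_def x_def by auto
qed

text \<open>
Exponential convergence of \<open>\<Phi>(x)\<close> to \<open>p\<close>, which carries the regulation error and its derivatives.
\<close>

definition tracks :: "(real ^ 'n \<Rightarrow> real ^ 'n) \<Rightarrow> real ^ 'n \<Rightarrow> (real \<Rightarrow> real ^ 'n) \<Rightarrow> bool" where
  "tracks \<Phi> p x \<longleftrightarrow> (\<exists>C>0. \<exists>\<alpha>>0. \<forall>t\<ge>0. norm (p - \<Phi> (x t)) \<le> C * exp (- \<alpha> * t))"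

text \<open>
The decay estimate holds on every interval on which a solution exists. With the confinement
property it is an a priori bound, which yields a solution on \<open>[0, \<infinity>)\<close>; applied to intervals \<open>[0, t]\<close> of
an arbitrary solution it yields convergence.
\<close>

lemma closed_loop_regulation:
  fixes f g :: "real ^ 'n \<Rightarrow> real ^ 'n" and k \<beta> :: "real ^ 'n"
  assumes data: "admissible_data b_lo b_hi L \<tau> \<beta>" and sys: "smooth_system f g h" and A: "assumption_A b_lo f g h"
    and B: "assumption_B1 y b_hi L \<tau> f g h" and ctrl: "confines_trajectories (Phi f h)"
    and K: "(k0, k) \<in> stabilizing_gains b_lo b_hi ((1 + \<tau> (norm (z_star y :: real ^ 'n)) / b_lo) * L)"
  shows "\<exists>\<epsilon>_star>0. \<forall>\<epsilon>. 0 < \<epsilon> \<and> \<epsilon> < \<epsilon>_star \<longrightarrow> (\<forall>a b.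
    (\<exists>x0 x z. closed_loop_solution f g h y \<beta> k0 k \<epsilon> a b x0 x z) \<and>
    (\<forall>x0 x z. closed_loop_solution f g h y \<beta> k0 k \<epsilon> a b x0 x z \<longrightarrow> tracks (Phi f h) (z_star y) x))"
proof -
  define \<Lambda> where "\<Lambda> = (1 + \<tau> (norm (z_star y :: real ^ 'n)) / b_lo) * L"
  have f: "smooth f" and g: "smooth g" and h: "smooth h" using sys unfolding smooth_system_def by auto
  have b: "b_lo > 0" "b_hi > 0" "L > 0" and \<tau>: "\<tau> (norm (z_star y :: real ^ 'n)) \<ge> 0" and hurwitz: "Hurwitz (observer_poly \<beta>)"
    using data unfolding admissible_data_def by auto
  have rel: "uniform_relative_degree f g h" and lo: "\<And>x. b_lo \<le> G_fun f g h x"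
    using A unfolding assumption_A_def by auto
  have hi: "\<And>x. G_fun f g h x \<le> b_hi" and H_bound: "\<And>x. norm (H_fun f g h x) \<le> \<tau> (norm (Phi f h x))"
    using B unfolding assumption_B1_def by auto
  obtain xs where xs: "Phi f h xs = z_star y"
    and lip: "\<And>x. norm (H_fun f g h x - H_fun f g h xs) \<le> L * norm (Phi f h x - Phi f h xs)"
    using B unfolding assumption_B1_def by auto
  have \<Lambda>0: "\<Lambda> \<ge> 0" using b \<tau> by (simp add: \<Lambda>_def)
  have k0: "k0 \<noteq> 0"
    using stabilizing_gains_integral_nonzero[OF K] order_trans[OF lo hi] \<Lambda>0 by (simp add: \<Lambda>_def)
  \<comment> \<open>The integrator value at equilibrium.\<close>
  define x0s where "x0s = - (F_fun f h xs / G_fun f g h xs) / k0"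
  have us_eq: "k0 * x0s = - (F_fun f h xs / G_fun f g h xs)" using k0 by (simp add: x0s_def)
  have Gpos: "G_fun f g h xs > 0" using lo[of xs] b(1) by linarith
  have us: "F_fun f h xs + G_fun f g h xs * (k0 * x0s) = 0"
    using Gpos unfolding us_eq by simp
  have "\<bar>k0 * x0s\<bar> \<le> \<tau> (norm (z_star y :: real ^ 'n)) / b_lo"
  proof -
    have "\<bar>F_fun f h xs\<bar> \<le> \<tau> (norm (z_star y :: real ^ 'n))"
      using norm_fst_le[of "F_fun f h xs" "G_fun f g h xs"] H_bound[of xs] by (simp add: H_fun_def xs)
    then show ?thesis
      unfolding us_eq using lo[of xs] b(1) Gpos by (auto simp: abs_divide intro!: frac_le)
  qed
  then have \<Lambda>: "(1 + \<bar>k0 * x0s\<bar>) * L \<le> \<Lambda>"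
    unfolding \<Lambda>_def using b(3) by (intro mult_right_mono) auto
  obtain \<epsilon>_star where \<epsilon>_star: "\<epsilon>_star > 0" and decay: "\<forall>\<epsilon>. 0 < \<epsilon> \<and> \<epsilon> < \<epsilon>_star \<longrightarrow> (\<exists>C \<alpha>. C > 0 \<and> \<alpha> > 0 \<and>
    (\<forall>T W z v. observer_loop b_lo b_hi \<Lambda> \<beta> (k0, k) \<epsilon> T W z v \<longrightarrow>
      (\<forall>t\<in>{0..T}. norm (W t) + norm (z t) + \<bar>v t\<bar> \<le> C * (norm (W 0) + norm (z 0)) * exp (- \<alpha> * t))))"
    using observer_loop_decay[OF K[folded \<Lambda>_def] b(1,2) \<Lambda>0 hurwitz] by (elim exE conjE) (rule that)
  obtain c where c: "c > 0" "\<And>(E :: real ^ 'n) v. norm (shift E v) \<le> c * (norm E + \<bar>v\<bar>)"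
    using shift_bound by blast
  have "(\<exists>x0 x z. closed_loop_solution f g h y \<beta> k0 k \<epsilon> a b x0 x z) \<and>
    (\<forall>x0 x z. closed_loop_solution f g h y \<beta> k0 k \<epsilon> a b x0 x z \<longrightarrow> tracks (Phi f h) (z_star y) x)"
    if \<epsilon>: "0 < \<epsilon>" "\<epsilon> < \<epsilon>_star" for \<epsilon> a b
  proof -
    let ?X = "closed_loop_field f g h y \<beta> k0 k \<epsilon>"
    obtain C \<alpha> where C: "C > 0" "\<alpha> > 0" and est: "\<forall>T W z v. observer_loop b_lo b_hi \<Lambda> \<beta> (k0, k) \<epsilon> T W z v \<longrightarrow>
      (\<forall>t\<in>{0..T}. norm (W t) + norm (z t) + \<bar>v t\<bar> \<le> C * (norm (W 0) + norm (z 0)) * exp (- \<alpha> * t))"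
      using decay[rule_format, OF conjI[OF \<epsilon>]] by (elim exE conjE) (rule that)
    \<comment> \<open>The initial error is \<open>(- x0s, z\<^sup>* - \<Phi>(a))\<close>; adding 1 makes \<open>M\<close> positive.\<close>
    define M where "M = C * (norm (- x0s, z_star y - Phi f h a) + norm b) + 1"
    have M: "M > 0" using C unfolding M_def by (intro add_nonneg_pos mult_nonneg_nonneg add_nonneg_nonneg) auto
    define u where "u w = pid_input k0 k (y - h (fst (snd w))) (fst w) (snd (snd w))" for w
    define x where "x = (\<lambda>w :: real \<times> (real ^ 'n) \<times> (real ^ 'n). fst (snd w))"
    have bounds: "norm (fst (w t) - x0s) \<le> M * exp (- \<alpha> * t)" "norm (z_star y - Phi f h (x (w t))) \<le> M * exp (- \<alpha> * t)"
      "norm (snd (snd (w t))) \<le> M * exp (- \<alpha> * t)"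
      "norm (shift (Phi f h (x (w t))) (F_fun f h (x (w t)) + u (w t) * G_fun f g h (x (w t)))) \<le> c * (M * exp (- \<alpha> * t))"
      if w0: "w 0 = (0, a, b)" and w: "\<And>t. t \<in> {0..T} \<Longrightarrow> (w has_vector_derivative ?X (w t)) (at t within {0..T})"
        and t: "t \<in> {0..T}" for w T t
    proof -
      define E where "E t = z_star y - Phi f h (x (w t))" for t
      define v where "v t = - (F_fun f h (x (w t)) + G_fun f g h (x (w t)) * u (w t))" for t
      have "observer_loop b_lo b_hi \<Lambda> \<beta> (k0, k) \<epsilon> T (\<lambda>t. (fst (w t) - x0s, E t)) (\<lambda>t. snd (snd (w t))) v"
        unfolding E_def v_def u_def x_def
        by (rule closed_loop_is_observer_loop[OF f h A hi lip xs us \<Lambda>0 \<Lambda> w])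
      from est[rule_format, OF this t]
      have "norm (fst (w t) - x0s, E t) + norm (snd (snd (w t))) + \<bar>v t\<bar> \<le> (M - 1) * exp (- \<alpha> * t)"
        by (simp add: w0 M_def E_def x_def)
      also have "\<dots> \<le> M * exp (- \<alpha> * t)" by (intro mult_right_mono) auto
      finally have le: "norm (fst (w t) - x0s, E t) + norm (snd (snd (w t))) + \<bar>v t\<bar> \<le> M * exp (- \<alpha> * t)" .
      note parts = norm_fst_le[of "fst (w t) - x0s" "E t"] norm_snd_le[of "E t" "fst (w t) - x0s"]
      show "norm (fst (w t) - x0s) \<le> M * exp (- \<alpha> * t)" "norm (z_star y - Phi f h (x (w t))) \<le> M * exp (- \<alpha> * t)"
        "norm (snd (snd (w t))) \<le> M * exp (- \<alpha> * t)"
        using le parts norm_ge_zero[of "snd (snd (w t))"] norm_ge_zero[of "(fst (w t) - x0s, E t)"] abs_ge_zero[of "v t"]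
        unfolding E_def[symmetric] by linarith+
      have "norm (shift (Phi f h (x (w t))) (F_fun f h (x (w t)) + u (w t) * G_fun f g h (x (w t)))) = norm (shift (E t) (v t))"
        unfolding shift_error[of "Phi f h (x (w t))" _ y] by (simp add: E_def v_def mult.commute)
      also have "\<dots> \<le> c * (norm (E t) + \<bar>v t\<bar>)" by (rule c)
      also have "\<dots> \<le> c * (M * exp (- \<alpha> * t))"
        using le parts norm_ge_zero[of "snd (snd (w t))"] c(1) by (intro mult_left_mono) linarith+
      finally show "norm (shift (Phi f h (x (w t))) (F_fun f h (x (w t)) + u (w t) * G_fun f g h (x (w t)))) \<le> c * (M * exp (- \<alpha> * t))" .
    qed
    define M' where "M' = norm (z_star y :: real ^ 'n) + M + c * M"
    obtain R where R: "\<And>T x x'. 0 \<le> T \<Longrightarrow> x 0 = a \<Longrightarrow> (\<And>t. t \<in> {0..T} \<Longrightarrow>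
        (x has_vector_derivative x' t) (at t within {0..T}) \<and> norm (Phi f h (x t)) \<le> M' \<and>
        norm (frechet_derivative (Phi f h) (at (x t)) (x' t)) \<le> M' * exp (- \<alpha> * t)) \<Longrightarrow> norm (x T) \<le> R"
      using ctrl[unfolded confines_trajectories_def, rule_format, OF C(2), of a M'] by blast
    have existence: "\<exists>w. w 0 = (0, a, b) \<and> (\<forall>t\<ge>0. (w has_vector_derivative ?X (w t)) (at t within {0..}))"
    proof (rule global_solution_of_bounded)
      show "\<exists>L. L-lipschitz_on (cball 0 R) ?X" for R
        using lipschitz_on_balls_closed_loop_field[OF f g h] unfolding lipschitz_on_balls_def by blast
      fix T :: real and w assume T: "0 \<le> T" and w0: "w 0 = (0, a, b)"
        and w: "\<And>t. t \<in> {0..T} \<Longrightarrow> (w has_vector_derivative ?X (w t)) (at t within {0..T})"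
      note bnd = bounds[OF w0 w]
      have small: "M * exp (- \<alpha> * t) \<le> M" if "t \<in> {0..T}" for t
        using that C M by (simp add: mult_le_cancel_left1)
      have "norm (x (w T)) \<le> R"
      proof (rule R[OF T, of "\<lambda>t. x (w t)" "\<lambda>t. f (x (w t)) + u (w t) *\<^sub>R g (x (w t))"])
        show "x (w 0) = a" by (simp add: w0 x_def)
        fix t assume t: "t \<in> {0..T}"
        have "norm (Phi f h (x (w t))) \<le> norm (z_star y :: real ^ 'n) + norm (z_star y - Phi f h (x (w t)))"
          using norm_triangle_ineq4[of "z_star y" "z_star y - Phi f h (x (w t))"] by simp
        then have 1: "norm (Phi f h (x (w t))) \<le> M'"
          using bnd(2)[OF _ t] small[OF t] mult_pos_pos[OF c(1) M] unfolding M'_def by linarith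
        have "c * M \<le> M'" using M by (simp add: M'_def)
        then have 2: "c * (M * exp (- \<alpha> * t)) \<le> M' * exp (- \<alpha> * t)"
          unfolding mult.assoc[symmetric] by (rule mult_right_mono) simp
        have 3: "((\<lambda>t. x (w t)) has_vector_derivative f (x (w t)) + u (w t) *\<^sub>R g (x (w t))) (at t within {0..T})"
          using bounded_linear.has_vector_derivative[OF bounded_linear_fst_comp[OF bounded_linear_snd] w[OF t]]
          unfolding x_def u_def by (simp add: closed_loop_field_def Let_def)
        show "((\<lambda>t. x (w t)) has_vector_derivative f (x (w t)) + u (w t) *\<^sub>R g (x (w t))) (at t within {0..T}) \<and>
          norm (Phi f h (x (w t))) \<le> M' \<and>
          norm (frechet_derivative (Phi f h) (at (x (w t))) (f (x (w t)) + u (w t) *\<^sub>R g (x (w t)))) \<le> M' * exp (- \<alpha> * t)"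
          using 1 3 order_trans[OF bnd(4)[OF _ t] 2] unfolding Phi_derivative_control[OF f h rel] by simp
      qed
      moreover have "norm (fst (w T)) \<le> \<bar>x0s\<bar> + M" "norm (snd (snd (w T))) \<le> M"
      proof -
        have "T \<in> {0..T}" using T by simp
        from bnd(1,3)[OF _ this] small[OF this] show "norm (fst (w T)) \<le> \<bar>x0s\<bar> + M" "norm (snd (snd (w T))) \<le> M"
          by auto
      qed
      moreover have "norm (w T) \<le> norm (fst (w T)) + (norm (x (w T)) + norm (snd (snd (w T))))"
        using norm_Pair_le[of "fst (w T)" "snd (w T)"] norm_Pair_le[of "x (w T)" "snd (snd (w T))"] by (simp add: x_def)
      ultimately show "norm (w T) \<le> \<bar>x0s\<bar> + M + (R + M)" by linarith
    qed
    show ?thesis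
    proof (intro conjI allI impI)
      obtain w where "w 0 = (0, a, b)" "\<forall>t\<ge>0. (w has_vector_derivative ?X (w t)) (at t within {0..})"
        using existence by blast
      then show "\<exists>x0 x z. closed_loop_solution f g h y \<beta> k0 k \<epsilon> a b x0 x z"
        by (intro exI[of _ "\<lambda>t. fst (w t)"] exI[of _ "\<lambda>t. fst (snd (w t))"] exI[of _ "\<lambda>t. snd (snd (w t))"])
          (simp add: closed_loop_solution_iff)
    next
      fix x0 x1 z assume "closed_loop_solution f g h y \<beta> k0 k \<epsilon> a b x0 x1 z"
      then have w0: "(x0 0, x1 0, z 0) = (0, a, b)" and w: "\<And>t. t \<ge> 0 \<Longrightarrow> ((\<lambda>t. (x0 t, x1 t, z t))
          has_vector_derivative ?X (x0 t, x1 t, z t)) (at t within {0..})"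
        unfolding closed_loop_solution_iff by auto
      have "norm (z_star y - Phi f h (x1 t)) \<le> M * exp (- \<alpha> * t)" if "t \<ge> 0" for t
      proof -
        have "((\<lambda>t. (x0 t, x1 t, z t)) has_vector_derivative ?X (x0 s, x1 s, z s)) (at s within {0..t})"
          if "s \<in> {0..t}" for s
          using that by (intro has_vector_derivative_within_subset[OF w]) auto
        from bounds(2)[of "\<lambda>t. (x0 t, x1 t, z t)", OF w0 this, of t] show ?thesis
          using \<open>t \<ge> 0\<close> by (simp add: x_def)
      qed
      then show "tracks (Phi f h) (z_star y) x1"
        unfolding tracks_def using M C(2) by blast
    qed
  qed
  then show ?thesis using \<epsilon>_star by blast
qed


lemma tracks_regulation_error:
  assumes "tracks (Phi f h) (z_star y) (x :: real \<Rightarrow> real ^ 'n)"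
  shows "converges_to_zero_exponentially (\<lambda>t. y - h (x t))"
proof -
  have "(z_star y - Phi f h x) $# 1 = y - h x" for x :: "real ^ 'n"
    by (simp add: z_star_def Phi_nth_comp tuple_nth_comp Suc_le_eq)
  then have "\<bar>y - h x\<bar> \<le> norm (z_star y - Phi f h x)" for x :: "real ^ 'n"
    by (metis abs_nth_comp_le)
  then show ?thesis
    using assms unfolding tracks_def converges_to_zero_exponentially_def by (meson order_trans)
qed

lemma confines_of_assumption_C:
  assumes sys: "smooth_system f g h" and A: "assumption_A b_lo f g h" and C: "assumption_C f h"
  shows "confines_trajectories (Phi f h)"
proof -
  obtain N1 N2 where N: "N1 > 0" "N2 > 0"
    "\<And>x. onorm ((*v) (matrix_inv (jacobian (Phi f h) (at x)))) \<le> N1 * norm x * ln (norm x) + N2"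
    using C unfolding assumption_C_def by blast
  have f: "smooth f" and g: "smooth g" and h: "smooth h" and rel: "uniform_relative_degree f g h"
    using sys A unfolding smooth_system_def assumption_A_def by auto
  have diff: "Phi f h differentiable (at x)" for x
    unfolding differentiable_def using Phi_has_derivative[OF f h] by blast
  show ?thesis
    by (rule confines_of_log_growth[OF diff jacobian_Phi_invertible[OF f g h rel] N])
qed

lemma continuous_inv_Phi:
  assumes "assumption_C' f h"
  shows "continuous_on UNIV (inv (Phi f h))"
  using assms C_k_pred[of 0 "inv (Phi f h)"] unfolding assumption_C'_def by simp

lemma trajectory_converges:
  fixes \<Phi> :: "real ^ 'n \<Rightarrow> real ^ 'n"
  assumes bij: "bij \<Phi>" and cont: "continuous_on UNIV (inv \<Phi>)" and tracks: "tracks \<Phi> p x"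
  shows "bounded (x ` {0..})" "(x \<longlongrightarrow> inv \<Phi> p) at_top"
proof -
  obtain C \<alpha> where C: "C > 0" "\<alpha> > 0" and decay: "\<And>t. t \<ge> 0 \<Longrightarrow> norm (p - \<Phi> (x t)) \<le> C * exp (- \<alpha> * t)"
    using tracks unfolding tracks_def by blast
  have x: "x t = inv \<Phi> (\<Phi> (x t))" for t using bij by (simp add: bij_is_inj)
  have "\<Phi> (x t) \<in> cball p C" if "t \<ge> 0" for t
  proof -
    have "C * exp (- \<alpha> * t) \<le> C * 1" using that C by (intro mult_left_mono) auto
    then show ?thesis using decay[OF that] by (simp add: dist_norm)
  qed
  then have "x ` {0..} \<subseteq> inv \<Phi> ` cball p C"
    using x by (metis (no_types, lifting) atLeast_iff image_subset_iff imageI)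
  moreover have "bounded (inv \<Phi> ` cball p C)"
    by (intro compact_imp_bounded compact_continuous_image) (auto intro: continuous_on_subset[OF cont])
  ultimately show "bounded (x ` {0..})" by (rule bounded_subset[rotated])
  have null: "((\<lambda>t. C * exp (- \<alpha> * t)) \<longlongrightarrow> C * 0) at_top"
    using C(2) by (intro tendsto_mult tendsto_const filterlim_compose[OF exp_at_bot]
        filterlim_tendsto_neg_mult_at_bot[OF tendsto_const]) (auto simp: filterlim_ident)
  have "\<forall>\<^sub>F t in at_top. norm (\<Phi> (x t) - p) \<le> C * exp (- \<alpha> * t)"
    using eventually_ge_at_top[of 0] by eventually_elim (use decay in \<open>simp add: norm_minus_commute\<close>)
  from Lim_null_comparison[OF this null[unfolded mult_zero_right]]
  have "((\<lambda>t. \<Phi> (x t) - p) \<longlongrightarrow> 0) at_top" .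
  then have "((\<lambda>t. \<Phi> (x t)) \<longlongrightarrow> p) at_top" by (simp add: LIM_zero_iff)
  moreover have "isCont (inv \<Phi>) p" using cont by (simp add: continuous_on_eq_continuous_at)
  ultimately have "((\<lambda>t. inv \<Phi> (\<Phi> (x t))) \<longlongrightarrow> inv \<Phi> p) at_top" by (rule isCont_tendsto_compose[rotated])
  then show "(x \<longlongrightarrow> inv \<Phi> p) at_top" using x by simp
qed

text \<open>
The gain set is chosen before the system, and the order of the quantifiers is the point here:
\<open>\<Lambda>\<close> is computed from the data alone.
\<close>

lemma regulating_gains:
  fixes \<beta> :: "real ^ 'n"
  assumes data: "admissible_data b_lo b_hi L \<tau> \<beta>"
  shows "\<exists>\<Omega> :: (real \<times> (real ^ 'n)) set. open \<Omega> \<and> \<not> bounded \<Omega> \<and>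
    (\<forall>f g h k0 k. smooth_system f g h \<and> assumption_A b_lo f g h \<and> assumption_B1 y b_hi L \<tau> f g h \<and>
      confines_trajectories (Phi f h) \<and> (k0, k) \<in> \<Omega> \<longrightarrow>
      (\<exists>\<epsilon>_star>0. \<forall>\<epsilon>. 0 < \<epsilon> \<and> \<epsilon> < \<epsilon>_star \<longrightarrow> (\<forall>a b.
        (\<exists>x0 x z. closed_loop_solution f g h y \<beta> k0 k \<epsilon> a b x0 x z) \<and>
        (\<forall>x0 x z. closed_loop_solution f g h y \<beta> k0 k \<epsilon> a b x0 x z \<longrightarrow> tracks (Phi f h) (z_star y) x))))"
proof -
  define \<Lambda> where "\<Lambda> = (1 + \<tau> (norm (z_star y :: real ^ 'n)) / b_lo) * L"
  have b: "b_lo > 0" "b_hi > 0" and \<Lambda>: "\<Lambda> \<ge> 0"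
    using data unfolding admissible_data_def \<Lambda>_def by auto
  show ?thesis
  proof (intro exI[of _ "stabilizing_gains b_lo b_hi \<Lambda>"] conjI allI impI, goal_cases)
    case 1
    show ?case by (rule open_stabilizing_gains[OF b])
  next
    case 2
    show ?case by (rule unbounded_stabilizing_gains[OF b(1) \<Lambda>])
  next
    case (3 f g h k0 k)
    from 3[unfolded \<Lambda>_def] show ?case
      by (elim conjE) (rule closed_loop_regulation[OF data]; assumption)
  qed
qed

theorem theorem3:
  "(\<forall>y b_lo b_hi L \<tau> (\<beta> :: real ^ 'n).
      admissible_data b_lo b_hi L \<tau> \<beta> \<longrightarrow>
      (\<exists>\<Omega> :: (real \<times> (real ^ 'n)) set. open \<Omega> \<and> \<not> bounded \<Omega> \<and>
        (\<forall>(f :: real ^ 'n \<Rightarrow> real ^ 'n) g h. smooth_system f g h \<and> assumption_A b_lo f g h \<and>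
            assumption_B1 y b_hi L \<tau> f g h \<and> assumption_C f h \<longrightarrow>
          (\<forall>(k0, k) \<in> \<Omega>. \<exists>\<epsilon>_star>0. \<forall>\<epsilon>. 0 < \<epsilon> \<and> \<epsilon> < \<epsilon>_star \<longrightarrow>
            (\<forall>a b.
              (\<exists>x0 x z. closed_loop_solution f g h y \<beta> k0 k \<epsilon> a b x0 x z) \<and>
              (\<forall>x0 x z. closed_loop_solution f g h y \<beta> k0 k \<epsilon> a b x0 x z \<longrightarrow>
                 converges_to_zero_exponentially (\<lambda>t. y - h (x t))))))))
   \<and>
   (\<exists>x_star :: real \<Rightarrow> (real ^ 'n \<Rightarrow> real ^ 'n) \<Rightarrow> real ^ 'n.
    \<forall>y b_lo b_hi L \<tau> (\<beta> :: real ^ 'n).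
      admissible_data b_lo b_hi L \<tau> \<beta> \<longrightarrow>
      (\<exists>\<Omega> :: (real \<times> (real ^ 'n)) set. open \<Omega> \<and> \<not> bounded \<Omega> \<and>
        (\<forall>(f :: real ^ 'n \<Rightarrow> real ^ 'n) g h. smooth_system f g h \<and> assumption_A b_lo f g h \<and>
            assumption_B1 y b_hi L \<tau> f g h \<and> assumption_C' f h \<longrightarrow>
          (\<forall>(k0, k) \<in> \<Omega>. \<exists>\<epsilon>_star>0. \<forall>\<epsilon>. 0 < \<epsilon> \<and> \<epsilon> < \<epsilon>_star \<longrightarrow>
            (\<forall>a b.
              (\<exists>x0 x z. closed_loop_solution f g h y \<beta> k0 k \<epsilon> a b x0 x z) \<and>
              (\<forall>x0 x z. closed_loop_solution f g h y \<beta> k0 k \<epsilon> a b x0 x z \<longrightarrow>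
                 converges_to_zero_exponentially (\<lambda>t. y - h (x t)) \<and>
                 bounded (x ` {0..}) \<and>
                 (x \<longlongrightarrow> x_star y (Phi f h)) at_top))))))"
proof (intro conjI exI[of _ "\<lambda>y \<Phi>. inv \<Phi> (z_star y)"] allI impI, goal_cases)
  case (1 y b_lo b_hi L \<tau> \<beta>)
  from regulating_gains[OF this, of y] obtain \<Omega> where \<Omega>: "open \<Omega>" "\<not> bounded \<Omega>" and reg: "\<forall>f g h k0 k.
      smooth_system f g h \<and> assumption_A b_lo f g h \<and> assumption_B1 y b_hi L \<tau> f g h \<and>
      confines_trajectories (Phi f h) \<and> (k0, k) \<in> \<Omega> \<longrightarrow>
      (\<exists>\<epsilon>_star>0. \<forall>\<epsilon>. 0 < \<epsilon> \<and> \<epsilon> < \<epsilon>_star \<longrightarrow> (\<forall>a b.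
        (\<exists>x0 x z. closed_loop_solution f g h y \<beta> k0 k \<epsilon> a b x0 x z) \<and>
        (\<forall>x0 x z. closed_loop_solution f g h y \<beta> k0 k \<epsilon> a b x0 x z \<longrightarrow> tracks (Phi f h) (z_star y) x)))"
    by (elim exE conjE) (rule that)
  show ?case
  proof (intro exI[of _ \<Omega>] conjI \<Omega> allI impI, clarify, goal_cases)
    case (1 f g h k0 k)
    then have "confines_trajectories (Phi f h)" by (intro confines_of_assumption_C)
    with 1 obtain \<epsilon>_star where \<epsilon>_star: "\<epsilon>_star > 0" "\<forall>\<epsilon>. 0 < \<epsilon> \<and> \<epsilon> < \<epsilon>_star \<longrightarrow> (\<forall>a b.
        (\<exists>x0 x z. closed_loop_solution f g h y \<beta> k0 k \<epsilon> a b x0 x z) \<and>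
        (\<forall>x0 x z. closed_loop_solution f g h y \<beta> k0 k \<epsilon> a b x0 x z \<longrightarrow> tracks (Phi f h) (z_star y) x))"
      using reg by meson
    show ?case
      by (intro exI[of _ \<epsilon>_star] conjI allI impI tracks_regulation_error[of f]) (use \<epsilon>_star in blast)+
  qed
next
  case (2 y b_lo b_hi L \<tau> \<beta>)
  from regulating_gains[OF this, of y] obtain \<Omega> where \<Omega>: "open \<Omega>" "\<not> bounded \<Omega>" and reg: "\<forall>f g h k0 k.
      smooth_system f g h \<and> assumption_A b_lo f g h \<and> assumption_B1 y b_hi L \<tau> f g h \<and>
      confines_trajectories (Phi f h) \<and> (k0, k) \<in> \<Omega> \<longrightarrow>
      (\<exists>\<epsilon>_star>0. \<forall>\<epsilon>. 0 < \<epsilon> \<and> \<epsilon> < \<epsilon>_star \<longrightarrow> (\<forall>a b.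
        (\<exists>x0 x z. closed_loop_solution f g h y \<beta> k0 k \<epsilon> a b x0 x z) \<and>
        (\<forall>x0 x z. closed_loop_solution f g h y \<beta> k0 k \<epsilon> a b x0 x z \<longrightarrow> tracks (Phi f h) (z_star y) x)))"
    by (elim exE conjE) (rule that)
  show ?case
  proof (intro exI[of _ \<Omega>] conjI \<Omega> allI impI, clarify, goal_cases)
    case (1 f g h k0 k)
    then have bij: "bij (Phi f h)" and cont: "continuous_on UNIV (inv (Phi f h))"
      using continuous_inv_Phi unfolding assumption_C'_def by auto
    have "confines_trajectories (Phi f h)" by (rule confines_of_homeomorphism[OF bij cont])
    with 1 obtain \<epsilon>_star where \<epsilon>_star: "\<epsilon>_star > 0" "\<forall>\<epsilon>. 0 < \<epsilon> \<and> \<epsilon> < \<epsilon>_star \<longrightarrow> (\<forall>a b.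
        (\<exists>x0 x z. closed_loop_solution f g h y \<beta> k0 k \<epsilon> a b x0 x z) \<and>
        (\<forall>x0 x z. closed_loop_solution f g h y \<beta> k0 k \<epsilon> a b x0 x z \<longrightarrow> tracks (Phi f h) (z_star y) x))"
      using reg by meson
    show ?case
      by (intro exI[of _ \<epsilon>_star] conjI allI impI tracks_regulation_error[of f] trajectory_converges[OF bij cont])
        (use \<epsilon>_star in blast)+
  qed
qed

end
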